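(* Let $q$ be an odd prime power and fix a non-square $e \in \mathbf{F}_q$. Let $\mathfrak{p} \in \mathbf{F}_q[T]$ be a monic irreducible polynomial (a prime of $\mathbf{F}_q[T]$). Then the class number of the Dedekind ring $\mathbf{F}_q[T,\sqrt{e\mathfrak{p}}]$ is even if and only if $\deg \mathfrak{p}$ is even, and it is divisible by $4$ if and only if $\deg \mathfrak{p}$ is divisible by $4$.
   Context: $\mathbf{F}_q$ is the finite field with $q$ elements. For $e$ a non-square in $\mathbf{F}_q$ and $\mathfrak{p}$ monic irreducible in $\mathbf{F}_q[T]$, the ring $\mathbf{F}_q[T,\sqrt{e\mathfrak{p}}]$ is the integral closure of $\mathbf{F}_q[T]$ in the quadratic extension $\mathbf{F}_q(T)(\sqrt{e\mathfrak{p}})$ of $\mathbf{F}_q(T)$. Its class number is the order of its (finite) ideal class group. *)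

theory Defs
  imports
    "HOL-Algebra.Algebraic_Closure_Type"
    "HOL-Algebra.Generated_Fields"
    "HOL-Algebra.Ideal_Product"
    "HOL-Algebra.Coset"
    "HOL-Computational_Algebra.Computational_Algebra"
    "HOL-Library.Cardinality"
begin

text \<open>
  Subrings of a field are represented by their carrier sets inside an ambient type of class field.
\<close>

text \<open>The zero polynomial is excluded since its leading coefficient is \<open>0 \<noteq> 1\<close>.\<close>
definition integral_closure :: "'k::field set \<Rightarrow> 'k set \<Rightarrow> 'k set" where
  "integral_closure A L =
     {x \<in> L. \<exists>f :: 'k poly. (\<forall>i. Polynomial.coeff f i \<in> A) \<and>
               Polynomial.lead_coeff f = 1 \<and> poly f x = 0}"

definition field_of_fractions :: "'k::field set \<Rightarrow> 'k set" where
  "field_of_fractions R = {a / b | a b. a \<in> R \<and> b \<in> R \<and> b \<noteq> 0}"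

definition fractional_ideals :: "'k::field set \<Rightarrow> 'k set set" where
  "fractional_ideals R =
     {I. I \<subseteq> field_of_fractions R \<and> 0 \<in> I \<and> I \<noteq> {0} \<and>
         (\<forall>x\<in>I. \<forall>y\<in>I. x + y \<in> I) \<and>
         (\<forall>r\<in>R. \<forall>x\<in>I. r * x \<in> I) \<and>
         (\<exists>d\<in>R. d \<noteq> 0 \<and> (\<forall>x\<in>I. d * x \<in> R))}"

definition principal_fractional_ideals :: "'k::field set \<Rightarrow> 'k set set" where
  "principal_fractional_ideals R = {(\<lambda>r. r * x) ` R | x. x \<in> field_of_fractions R \<and> x \<noteq> 0}"

text \<open>
  The product \<open>ideal_prod\<close> consists of the finite nonempty sums of products \<open>i * j\<close>; it does not use
  the carrier of its ring argument, so it applies to fractional ideals as well. The monoid below is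
  a group whenever \<open>R\<close> is a Dedekind ring.
\<close>
definition fractional_ideal_group :: "'k::field set \<Rightarrow> 'k set monoid" where
  "fractional_ideal_group R =
     \<lparr>carrier = fractional_ideals R, monoid.mult = ideal_prod ring_of_type_algebra, one = R\<rparr>"

definition ideal_class_group :: "'k::field set \<Rightarrow> 'k set set monoid" where
  "ideal_class_group R = fractional_ideal_group R Mod principal_fractional_ideals R"

text \<open>As \<open>order\<close> is a cardinality, this is \<open>0\<close> if the ideal class group is infinite.\<close>
definition class_number :: "'k::field set \<Rightarrow> nat" where
  "class_number R = Coset.order (ideal_class_group R)"

definition poly_to_ac :: "'a::field poly \<Rightarrow> 'a poly fract alg_closure" where
  "poly_to_ac f = to_ac (to_fract f)"

text \<open>
  For \<open>s\<close> a square root of a polynomial \<open>D\<close> in the algebraic closure of the rational function field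
  \<open>F(T)\<close>, this is the ring \<open>F[T, sqrt D]\<close>: the integral closure of \<open>F[T]\<close> in \<open>F(T)(s)\<close>.
  It is the same for both choices of \<open>s\<close>.
\<close>
definition quadratic_ring :: "'a::field poly fract alg_closure \<Rightarrow> 'a poly fract alg_closure set" where
  "quadratic_ring s =
     integral_closure (range poly_to_ac)
       (generate_field ring_of_type_algebra (insert s (range to_ac)))"

end

theory Submission
  imports Defs "HOL-Algebra.Sylow"
begin

text \<open>
  Write \<open>A = F\<^sub>q[T]\<close>, \<open>D = e \<pp>\<close>, \<open>d = deg \<pp>\<close>, and \<open>R = A + A s\<close> with \<open>s\<^sup>2 = D\<close>. Both the parity of the
  class number and its divisibility by \<open>4\<close> are read off from the ideal classes of order \<open>2\<close> and \<open>4\<close>,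
  so the theorem is a piece of genus theory for the extension \<open>K = F\<^sub>q(T)(s)\<close>, in which \<open>s\<close> generates the
  only ramified prime of \<open>R\<close>. The norm form \<open>a\<^sup>2 - D b\<^sup>2\<close> is anisotropic and its leading terms never
  cancel, because the leading coefficient \<open>e\<close> of \<open>D\<close> is not a square (\<open>norm_form_degree\<close>); in particular the units of \<open>R\<close> are the nonzero constants.

  \<^bold>\<open>Classes of order two.\<close> Let \<open>J\<^sup>2 = (u)\<close>. Then the norm of \<open>u\<close> is a constant \<open>c\<close> times the square of
  the norm of \<open>J\<close>. If \<open>c\<close> is a square, Hilbert's Theorem 90 changes \<open>J\<close> by a principal ideal into an ideal
  stable under conjugation, and such ideals are principal (\<open>square_principal\<close>,
  \<open>ambiguous_principal\<close>). For odd \<open>d\<close> leading coefficients force \<open>c\<close> to be a square, so there is no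
  class of order two and the class number is odd.

  \<^bold>\<open>Even degree.\<close> Now \<open>e\<close> is a square modulo \<open>\<pp>\<close>, and a box argument shows that \<open>D = U\<^sup>2 - e V\<^sup>2\<close> with
  \<open>deg V = d / 2\<close> (\<open>genus_representation\<close>). The element \<open>(U + s) / V\<close> has norm \<open>e\<close>, and the ideal \<open>I\<close> that it
  generates together with \<open>1\<close> has order exactly two in the class group: if it were principal, \<open>e\<close> would be
  the square of a constant. The norm of \<open>I\<close> is \<open>1 / V\<close>.

  \<^bold>\<open>\<open>d\<close> congruent to \<open>2\<close> modulo \<open>4\<close>.\<close> The parity of the degree of the norm of an ideal is additive and
  vanishes on principal ideals. The ideal \<open>I\<close> is odd. An even ideal \<open>J\<close> whose square is principal is
  itself principal: otherwise \<open>c\<close> is \<open>e\<close> times a square, so \<open>J I\<close> falls under the square case and is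
  principal, and \<open>J\<close> would be odd like \<open>I\<close> (\<open>even_two_torsion_trivial\<close>). A subgroup of order \<open>4\<close> of the class
  group would contain a nontrivial even class of order two, so \<open>4\<close> does not divide the class number.

  \<^bold>\<open>\<open>d\<close> divisible by \<open>4\<close>.\<close> The class of \<open>I\<close> is a square, so there is a class of order four. Indeed
  a reciprocity computation with the roots of \<open>\<pp>\<close> shows that \<open>V\<close> is a square modulo \<open>\<pp>\<close>
  (\<open>factor_is_square_mod\<close>). A box argument then yields an element \<open>\<alpha>\<close> of \<open>K\<close> whose norm is a constant
  times \<open>V\<close> (\<open>conic_point\<close>). So \<open>B = \<alpha> I\<close> has norm \<open>1\<close>, and Hilbert's Theorem 90 for ideals, with
  \<open>C = R + B\<close>, gives \<open>B C' = C\<close> for the conjugate \<open>C'\<close> of \<open>C\<close>; hence \<open>I\<close> is equivalent to \<open>C\<^sup>2\<close>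
  (\<open>class_of_order_four\<close>).

  Finiteness of the class group comes from a Dirichlet-style approximation argument (\<open>reduced_ideal\<close>), and
  invertibility of ideals from the fact that the product of an ideal with its conjugate is generated by
  an element of \<open>F\<^sub>q(T)\<close> (\<open>ideal_norm\<close>).
\<close>

section \<open>Polynomials over a field\<close>

text \<open>
  Short names for the notions on the type of polynomials; lists of coefficients, modules and rings given
  by their carrier have notions of the same names.
\<close>
abbreviation (input) deg :: "'a::zero poly \<Rightarrow> nat" where "deg \<equiv> Polynomial.degree"
abbreviation (input) lead_coeff :: "'a::zero poly \<Rightarrow> 'a" where "lead_coeff p \<equiv> Polynomial.lead_coeff p"
abbreviation (input) coeff :: "'a::zero poly \<Rightarrow> nat \<Rightarrow> 'a" where "coeff \<equiv> Polynomial.coeff"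
abbreviation (input) smult :: "'a::comm_semiring_0 \<Rightarrow> 'a poly \<Rightarrow> 'a poly" where "smult \<equiv> Polynomial.smult"
abbreviation (input) irreducible :: "'a::comm_semiring_1 \<Rightarrow> bool" where "irreducible \<equiv> Factorial_Ring.irreducible"

text \<open>
  Division with remainder by a nonzero element of least degree.
\<close>
lemma poly_ideal_principal:
  fixes U :: "'a::field poly set"
  assumes "0 \<in> U" "\<And>x y. x \<in> U \<Longrightarrow> y \<in> U \<Longrightarrow> x + y \<in> U" "\<And>r x. x \<in> U \<Longrightarrow> r * x \<in> U"
  shows "\<exists>g\<in>U. \<forall>x\<in>U. g dvd x"
proof (cases "U \<subseteq> {0}")
  case True
  then show ?thesis using assms(1) by auto
next
  case False
  then obtain h where "h \<in> U \<and> h \<noteq> 0" by auto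
  then obtain g where g: "g \<in> U" "g \<noteq> 0"
    and min: "\<And>y. y \<in> U \<Longrightarrow> y \<noteq> 0 \<Longrightarrow> deg g \<le> deg y"
    using ex_has_least_nat[of "\<lambda>g. g \<in> U \<and> g \<noteq> 0" h deg] by blast
  have "g dvd x" if x: "x \<in> U" for x
  proof -
    have "x mod g = x + (- (x div g)) * g"
      by (simp add: minus_div_mult_eq_mod[symmetric])
    then have "x mod g \<in> U" using assms(2,3) x g(1) by metis
    then have "x mod g = 0"
      using min[of "x mod g"] degree_mod_less'[of g x] g(2) by fastforce
    then show ?thesis by auto
  qed
  then show ?thesis using g(1) by blast
qed

lemma poly_bezout:
  fixes a b :: "'a::field poly"
  shows "\<exists>g u v. g = u * a + v * b \<and> g dvd a \<and> g dvd b"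
proof -
  define U where "U = {u * a + v * b | u v. True}"
  have "0 \<in> U" unfolding U_def by (auto intro: exI[of _ 0])
  moreover have "x + y \<in> U" if xy: "x \<in> U" "y \<in> U" for x y
  proof -
    obtain u v u' v' where "x = u * a + v * b" "y = u' * a + v' * b"
      using xy unfolding U_def by blast
    then have "x + y = (u + u') * a + (v + v') * b" by (simp add: algebra_simps)
    then show ?thesis unfolding U_def by blast
  qed
  moreover have "r * x \<in> U" if x: "x \<in> U" for r x
  proof -
    obtain u v where "x = u * a + v * b" using x unfolding U_def by blast
    then have "r * x = (r * u) * a + (r * v) * b" by (simp add: algebra_simps)
    then show ?thesis unfolding U_def by blast
  qed
  ultimately obtain g where g: "g \<in> U" "\<forall>x\<in>U. g dvd x"
    using poly_ideal_principal[of U] by blast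
  have "a \<in> U" unfolding U_def by (rule CollectI, rule exI[of _ 1], rule exI[of _ 0]) simp
  moreover have "b \<in> U" unfolding U_def by (rule CollectI, rule exI[of _ 0], rule exI[of _ 1]) simp
  ultimately show ?thesis using g unfolding U_def by blast
qed

text \<open>
  The Bezout coefficients \<open>u\<close>, \<open>v\<close> certify that the reduced fraction \<open>a' / b'\<close> is in lowest terms.
\<close>
lemma poly_lowest_terms:
  fixes a b :: "'a::field poly"
  assumes "b \<noteq> 0"
  shows "\<exists>g a' b' u v. g \<noteq> 0 \<and> a = g * a' \<and> b = g * b' \<and> u * a' + v * b' = 1"
proof -
  obtain g u v where g: "g = u * a + v * b" "g dvd a" "g dvd b" using poly_bezout by blast
  have g0: "g \<noteq> 0" using g(3) assms by auto
  obtain a' b' where ab: "a = g * a'" "b = g * b'" using g(2,3) by (auto elim!: dvdE)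
  have "g * (u * a' + v * b') = g * 1" using g(1) ab by (simp add: algebra_simps)
  then have "u * a' + v * b' = 1" using g0 by simp
  then show ?thesis using g0 ab by blast
qed

lemma irreducible_poly_dvd_mult:
  fixes p :: "'a::field poly"
  assumes "irreducible p" "p dvd a * b"
  shows "p dvd a \<or> p dvd b"
proof (rule disjCI)
  assume nb: "\<not> p dvd b"
  obtain g u v where g: "g = u * p + v * b" "g dvd p" "g dvd b" using poly_bezout by blast
  have "g dvd 1"
  proof (rule ccontr)
    assume n: "\<not> g dvd 1"
    obtain k where k: "p = g * k" using g(2) by (auto elim: dvdE)
    then have "k dvd 1" using n assms(1) unfolding Factorial_Ring.irreducible_def by blast
    then have "p dvd g" using k by (metis dvd_mult_unit_iff dvd_refl mult.commute dvd_mult_unit_iff')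
    then show False using g(3) nb dvd_trans by blast
  qed
  then obtain w where w: "1 = g * w" by (auto elim: dvdE)
  have "a = a * (g * w)" using w by simp
  also have "\<dots> = p * (u * w * a) + (a * b) * (v * w)" by (simp add: g(1) algebra_simps)
  finally show "p dvd a" using assms(2) by (metis dvd_add dvd_mult2 dvd_triv_left)
qed

text \<open>
  Vanishing of coefficients, rather than a bound on the degree, makes the zero polynomial a member for every
  \<open>n\<close>, so that these sets are vector spaces of dimension \<open>n\<close>, the boxes of the pigeonhole arguments.
\<close>
definition polys_below :: "nat \<Rightarrow> 'a::zero poly set" where
  "polys_below n = {f. \<forall>i\<ge>n. coeff f i = 0}"

lemma polys_below_degree: "f \<in> polys_below n \<longleftrightarrow> f = 0 \<or> deg f < n"
proof
  assume "f \<in> polys_below n"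
  then have "lead_coeff f = 0" if "deg f \<ge> n"
    using that unfolding polys_below_def by blast
  then show "f = 0 \<or> deg f < n"
    by (cases "f = 0") (auto simp: not_less[symmetric])
qed (auto simp: polys_below_def coeff_eq_0)

lemma card_polys_below:
  "finite (polys_below n :: 'a::{finite,zero} poly set) \<and>
   card (polys_below n :: 'a::{finite,zero} poly set) = CARD('a) ^ n"
proof (induction n)
  case 0
  have "polys_below 0 = {0 :: 'a poly}" unfolding polys_below_def by (auto intro: poly_eqI)
  then show ?case by simp
next
  case (Suc n)
  have eq: "polys_below (Suc n) = (\<lambda>(c, f :: 'a poly). pCons c f) ` (UNIV \<times> polys_below n)"
  proof (intro equalityI subsetI)
    fix f :: "'a poly" assume f: "f \<in> polys_below (Suc n)"
    obtain c g where cg: "f = pCons c g" by (cases f)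
    have "g \<in> polys_below n"
      unfolding polys_below_def
    proof (intro CollectI allI impI)
      fix i assume "i \<ge> n"
      then show "coeff g i = 0"
        using f cg unfolding polys_below_def by (auto dest: spec[of _ "Suc i"])
    qed
    then show "f \<in> (\<lambda>(c, f). pCons c f) ` (UNIV \<times> polys_below n)" using cg by auto
  next
    fix f :: "'a poly" assume "f \<in> (\<lambda>(c, f). pCons c f) ` (UNIV \<times> polys_below n)"
    then obtain c g where cg: "f = pCons c g" "g \<in> polys_below n" by auto
    then show "f \<in> polys_below (Suc n)"
      unfolding polys_below_def by (auto simp: coeff_pCons split: nat.split)
  qed
  have inj: "inj_on (\<lambda>(c, f :: 'a poly). pCons c f) (UNIV \<times> polys_below n)"
    by (auto simp: inj_on_def)
  show ?case unfolding eq using Suc inj by (simp add: card_image card_cartesian_product)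
qed

lemmas finite_polys_below [simp] = card_polys_below[THEN conjunct1]
lemmas card_polys_below' = card_polys_below[THEN conjunct2]

lemma polys_below_diff: "f \<in> polys_below n \<Longrightarrow> g \<in> polys_below n \<Longrightarrow> f - g \<in> polys_below n"
  for f g :: "'a::ab_group_add poly"
  unfolding polys_below_def by auto

section \<open>The norm form\<close>

text \<open>
  At infinity the form \<open>a\<^sup>2 - D b\<^sup>2\<close> is definite: if the degrees of the two terms agree, cancellation of the
  leading coefficients would exhibit the leading coefficient of \<open>D\<close> as a square.
\<close>
lemma norm_form_degree:
  fixes D a b :: "'a::field poly"
  assumes ns: "\<nexists>x. x ^ 2 = lead_coeff D" and b: "b \<noteq> 0"
  shows "a\<^sup>2 - D * b\<^sup>2 \<noteq> 0"
    and "deg (a\<^sup>2 - D * b\<^sup>2)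
      = max (2 * deg a) (deg D + 2 * deg b)"
proof -
  define n where "n = max (2 * deg a) (deg D + 2 * deg b)"
  have D0: "D \<noteq> 0" using ns by (metis leading_coeff_0_iff zero_power2)
  have da: "deg (a\<^sup>2) = 2 * deg a"
    by (cases "a = 0") (simp_all add: degree_power_eq)
  have db: "deg (D * b\<^sup>2) = deg D + 2 * deg b"
    using D0 b by (simp add: degree_mult_eq degree_power_eq)
  have la: "lead_coeff (a\<^sup>2) = (lead_coeff a)\<^sup>2"
    by (simp add: lead_coeff_power)
  have lb: "lead_coeff (D * b\<^sup>2) = lead_coeff D * (lead_coeff b)\<^sup>2"
    by (simp add: lead_coeff_power lead_coeff_mult)
  have lb0: "lead_coeff D * (lead_coeff b)\<^sup>2 \<noteq> 0" using D0 b by simp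
  have c: "coeff (a\<^sup>2 - D * b\<^sup>2) n \<noteq> 0"
  proof -
    consider "2 * deg a < deg D + 2 * deg b"
      | "2 * deg a > deg D + 2 * deg b"
      | "2 * deg a = deg D + 2 * deg b" by linarith
    then show ?thesis
    proof cases
      case 1
      then have "coeff (a\<^sup>2) n = 0" using da unfolding n_def by (simp add: coeff_eq_0)
      moreover have "coeff (D * b\<^sup>2) n = lead_coeff (D * b\<^sup>2)"
        using 1 db unfolding n_def by simp
      ultimately show ?thesis using lb lb0 by simp
    next
      case 2
      then have "coeff (D * b\<^sup>2) n = 0" using db unfolding n_def by (simp add: coeff_eq_0)
      moreover have "coeff (a\<^sup>2) n = lead_coeff (a\<^sup>2)"
        using 2 da unfolding n_def by simp
      moreover have "a \<noteq> 0" using 2 by auto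
      ultimately show ?thesis using la by simp
    next
      case 3
      have "coeff (D * b\<^sup>2) n = lead_coeff (D * b\<^sup>2)"
        "coeff (a\<^sup>2) n = lead_coeff (a\<^sup>2)"
        using 3 db da unfolding n_def by simp_all
      moreover have "(lead_coeff a)\<^sup>2 \<noteq> lead_coeff D * (lead_coeff b)\<^sup>2"
      proof
        assume "(lead_coeff a)\<^sup>2 = lead_coeff D * (lead_coeff b)\<^sup>2"
        then have "(lead_coeff a / lead_coeff b)\<^sup>2 = lead_coeff D"
          using b by (simp add: power_divide)
        then show False using ns by blast
      qed
      ultimately show ?thesis using la lb by simp
    qed
  qed
  then show "a\<^sup>2 - D * b\<^sup>2 \<noteq> 0" by auto
  have "deg (a\<^sup>2 - D * b\<^sup>2) \<le> n"
    unfolding n_def using da db degree_diff_le_max[of "a\<^sup>2" "D * b\<^sup>2"] by simp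
  then show "deg (a\<^sup>2 - D * b\<^sup>2)
      = max (2 * deg a) (deg D + 2 * deg b)"
    using le_degree[OF c] unfolding n_def by simp
qed

lemma norm_form_anisotropic:
  fixes D a b :: "'a::field poly"
  assumes "\<nexists>x. x ^ 2 = lead_coeff D" "a\<^sup>2 = D * b\<^sup>2"
  shows "a = 0 \<and> b = 0"
  using norm_form_degree(1)[OF assms(1), of b a] assms(2) by (cases "b = 0") auto

lemma norm_form_even_degree:
  fixes D a b :: "'a::field poly"
  assumes "\<nexists>x. x ^ 2 = lead_coeff D" "even (deg D)"
  shows "even (deg (a\<^sup>2 - D * b\<^sup>2))"
proof (cases "b = 0")
  case True
  then show ?thesis by (cases "a = 0") (simp_all add: degree_power_eq)
next
  case False
  then show ?thesis using norm_form_degree(2)[OF assms(1) False, of a] assms(2)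
    by (simp add: max_def)
qed

text \<open>
  By parity of degrees \<open>a\<^sup>2\<close> dominates, so \<open>c\<close> is a quotient of squares of leading coefficients.
\<close>
lemma norm_form_eq_const_square:
  fixes D a b :: "'a::field poly"
  assumes ns: "\<nexists>x. x ^ 2 = lead_coeff D" and odd: "odd (deg D)"
    and eq: "a\<^sup>2 - D * b\<^sup>2 = smult c (f\<^sup>2)" and f: "f \<noteq> 0"
  shows "\<exists>k. c = k\<^sup>2"
proof (cases "a\<^sup>2 - D * b\<^sup>2 = 0")
  case True
  then show ?thesis using eq f by (intro exI[of _ 0]) simp
next
  case False
  have lead: "lead_coeff (a\<^sup>2 - D * b\<^sup>2) = (lead_coeff a)\<^sup>2"
  proof (cases "b = 0")
    case True
    then show ?thesis by (simp add: lead_coeff_power)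
  next
    case b: False
    have c0: "c \<noteq> 0" using False eq by auto
    have "even (deg (a\<^sup>2 - D * b\<^sup>2))"
      using f c0 by (simp add: eq degree_power_eq)
    then have gt: "2 * deg a > deg D + 2 * deg b"
      and n: "deg (a\<^sup>2 - D * b\<^sup>2) = 2 * deg a"
      using norm_form_degree(2)[OF ns b, of a] odd by (auto simp: max_def split: if_splits; presburger)+
    have "deg (D * b\<^sup>2) \<le> deg D + 2 * deg b"
      using degree_mult_le[of D "b\<^sup>2"] b by (simp add: degree_power_eq)
    then have "coeff (D * b\<^sup>2) (2 * deg a) = 0"
      using gt by (intro coeff_eq_0) simp
    moreover have "deg (a\<^sup>2) = 2 * deg a"
      by (cases "a = 0") (simp_all add: degree_power_eq)
    ultimately show ?thesis
      unfolding n using lead_coeff_power[of a 2] by simp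
  qed
  have "c * (lead_coeff f)\<^sup>2 = (lead_coeff a)\<^sup>2"
    using lead False unfolding eq lead_coeff_smult lead_coeff_power by simp
  then have "c = (lead_coeff a / lead_coeff f)\<^sup>2"
    using f by (simp add: power_divide field_simps)
  then show ?thesis by blast
qed

section \<open>Finite fields inside an algebraic closure\<close>

definition ac_eval :: "'a::field poly \<Rightarrow> 'a alg_closure \<Rightarrow> 'a alg_closure" where
  "ac_eval f x = poly (map_poly to_ac f) x"

lemma ac_eval_simps [simp]:
  "ac_eval 0 x = 0" "ac_eval 1 x = 1" "ac_eval (pCons a f) x = to_ac a + x * ac_eval f x"
  by (simp_all add: ac_eval_def map_poly_pCons one_pCons)

lemma ac_eval_add: "ac_eval (f + g) x = ac_eval f x + ac_eval g x"
  by (induction f g rule: poly_induct2) (simp_all add: algebra_simps)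

lemma ac_eval_smult: "ac_eval (smult c f) x = to_ac c * ac_eval f x"
  by (induction f) (simp_all add: algebra_simps)

lemma ac_eval_mult: "ac_eval (f * g) x = ac_eval f x * ac_eval g x"
  by (induction f) (simp_all add: ac_eval_add ac_eval_smult algebra_simps)

lemma ac_eval_minus: "ac_eval (- f) x = - ac_eval f x"
  using ac_eval_smult[of "-1" f x] by simp

lemma ac_eval_diff: "ac_eval (f - g) x = ac_eval f x - ac_eval g x"
  using ac_eval_add[of f "-g" x] by (simp add: ac_eval_minus)

lemma ac_eval_power: "ac_eval (f ^ n) x = ac_eval f x ^ n"
  by (induction n) (simp_all add: ac_eval_mult)

text \<open>
  The polynomials \<open>(x + 1)\<^sup>q\<close> and \<open>x\<^sup>q + 1\<close> have degree \<open>q\<close>, equal leading coefficients, and agree at the \<open>q\<close>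
  elements of the base field; hence they coincide. This gives additivity of the \<open>q\<close>-th power map without
  writing \<open>q\<close> as a power of the characteristic.
\<close>
lemma frobenius_add:
  fixes x y :: "'a::finite_field alg_closure"
  shows "(x + y) ^ (CARD('a) ^ n) = x ^ (CARD('a) ^ n) + y ^ (CARD('a) ^ n)"
proof -
  define q where "q = CARD('a)"
  have q1: "q \<ge> 1" unfolding q_def by (simp add: Suc_leI)
  define f g :: "'a alg_closure poly" where "f = [:1, 1:] ^ q" and "g = Polynomial.monom 1 q + 1"
  have "f = g"
  proof (rule poly_eqI_degree_lead_coeff[where A = "range to_ac" and n = q])
    have df: "deg f = q" unfolding f_def by (simp add: degree_power_eq)
    have dg: "deg g = q"
      unfolding g_def using q1 by (subst degree_add_eq_left) (simp_all add: degree_monom_eq)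
    have "lead_coeff f = 1" unfolding f_def by (simp add: lead_coeff_power)
    then show "coeff f q = coeff g q"
      using df q1 by (simp add: g_def)
    show "deg f \<le> q" "deg g \<le> q" using df dg by simp_all
    show "card (range (to_ac :: 'a \<Rightarrow> _)) \<ge> q"
      unfolding q_def by (simp add: card_image inj_to_ac)
    show "poly f z = poly g z" if "z \<in> range to_ac" for z
    proof -
      obtain a :: 'a where z: "z = to_ac a" using \<open>z \<in> range to_ac\<close> by auto
      have "(1 + a) ^ q = a ^ q + 1"
        unfolding q_def by (simp add: finite_field_power_card_eq_same)
      then have "to_ac ((1 + a) ^ q) = to_ac (a ^ q + 1)" by simp
      then show ?thesis unfolding f_def g_def z by (simp add: poly_monom)
    qed
  qed
  have one: "(1 + z) ^ q = z ^ q + 1" for z :: "'a alg_closure"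
  proof -
    have "poly f z = poly g z" using \<open>f = g\<close> by simp
    then show ?thesis unfolding f_def g_def by (simp add: poly_monom)
  qed
  have base: "(x + y) ^ q = x ^ q + y ^ q" for x y :: "'a alg_closure"
  proof (cases "x = 0")
    case True
    then show ?thesis using q1 by (simp add: power_0_left)
  next
    case False
    have "(x + y) ^ q = x ^ q * (1 + y / x) ^ q"
      using False by (simp add: power_mult_distrib[symmetric] field_simps)
    also have "\<dots> = x ^ q * ((y / x) ^ q + 1)" by (simp only: one)
    also have "\<dots> = x ^ q + y ^ q" using False by (simp add: power_divide distrib_left)
    finally show ?thesis .
  qed
  show ?thesis
  proof (induction n)
    case (Suc n)
    have step: "z ^ (CARD('a) ^ Suc n) = (z ^ (CARD('a) ^ n)) ^ q" for z :: "'a alg_closure"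
      unfolding q_def by (simp add: power_mult[symmetric] mult.commute)
    show ?case by (simp only: step Suc.IH base)
  qed simp
qed

text \<open>
  The subfield with \<open>q\<^sup>n\<close> elements of the algebraic closure.
\<close>
definition fixed_field :: "nat \<Rightarrow> 'a::finite_field alg_closure set" where
  "fixed_field n = {x. x ^ (CARD('a) ^ n) = x}"

lemma card_gt_1: "CARD('a::finite_field) > 1"
  using card_mono[of UNIV "{0, 1 :: 'a}"] by simp

lemma frobenius_neg:
  fixes x y :: "'a::finite_field alg_closure"
  shows "(- x) ^ (CARD('a) ^ n) = - (x ^ (CARD('a) ^ n))"
  using frobenius_add[of x "-x" n] by (simp add: eq_neg_iff_add_eq_0 power_0_left add.commute)

lemma frobenius_diff:
  fixes x y :: "'a::finite_field alg_closure"
  shows "(x - y) ^ (CARD('a) ^ n) = x ^ (CARD('a) ^ n) - y ^ (CARD('a) ^ n)"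
  using frobenius_add[of x "-y" n] by (simp add: frobenius_neg)

lemma frobenius_to_ac: "to_ac (a :: 'a::finite_field) ^ (CARD('a) ^ n) = to_ac a"
  by (simp add: to_ac_power[symmetric] finite_field_power_card_power_eq_same del: to_ac_power)

lemma frobenius_ac_eval:
  fixes f :: "'a::finite_field poly"
  shows "ac_eval f x ^ (CARD('a) ^ n) = ac_eval f (x ^ (CARD('a) ^ n))"
  by (induction f) (simp_all add: frobenius_add frobenius_to_ac power_mult_distrib power_0_left)

lemma fixed_field_closed:
  fixes x y :: "'a::finite_field alg_closure"
  assumes "x \<in> fixed_field n" "y \<in> fixed_field n"
  shows "x + y \<in> fixed_field n" "x - y \<in> fixed_field n" "- x \<in> fixed_field n"
    "x * y \<in> fixed_field n" "x / y \<in> fixed_field n" "x ^ k \<in> fixed_field n"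
  using assms unfolding fixed_field_def
  by (simp_all add: frobenius_add frobenius_diff frobenius_neg power_mult_distrib power_divide
      power_mult[symmetric] mult.commute[of k]) (simp add: power_mult)

lemma fixed_field_to_ac: "to_ac a \<in> fixed_field n"
  unfolding fixed_field_def by (simp add: frobenius_to_ac)

lemma fixed_field_one: "1 \<in> fixed_field n"
  unfolding fixed_field_def by simp

lemma frobenius_comp:
  fixes x :: "'a::finite_field alg_closure"
  shows "(x ^ (CARD('a) ^ m)) ^ (CARD('a) ^ n) = x ^ (CARD('a) ^ (m + n))"
  by (simp add: power_mult[symmetric] power_add)

lemma fixed_field_mono:
  assumes "m dvd n"
  shows "fixed_field m \<subseteq> (fixed_field n :: 'a::finite_field alg_closure set)"
proof
  fix x :: "'a alg_closure" assume x: "x \<in> fixed_field m"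
  have "x ^ (CARD('a) ^ (m * k)) = x" for k
    using x unfolding fixed_field_def
    by (induction k) (simp_all add: frobenius_comp[symmetric])
  then show "x \<in> fixed_field n" using assms unfolding fixed_field_def by (auto elim!: dvdE)
qed

lemma card_fixed_field:
  assumes "n > 0"
  shows "finite (fixed_field n :: 'a::finite_field alg_closure set)"
    and "card (fixed_field n :: 'a alg_closure set) \<le> CARD('a) ^ n"
proof -
  define Q where "Q = CARD('a) ^ n"
  have Q: "Q > 1" unfolding Q_def using assms card_gt_1 by (intro one_less_power)
  define f :: "'a alg_closure poly" where "f = Polynomial.monom 1 Q + Polynomial.monom (- 1) 1"
  have dg: "deg f = Q"
    unfolding f_def using Q by (subst degree_add_eq_left) (simp_all add: degree_monom_eq)
  then have f0: "f \<noteq> 0" using Q by auto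
  have eq: "fixed_field n = {x. poly f x = 0}"
    unfolding fixed_field_def f_def Q_def by (simp add: poly_monom)
  show "finite (fixed_field n :: 'a alg_closure set)" unfolding eq using f0 by (rule poly_roots_finite)
  show "card (fixed_field n :: 'a alg_closure set) \<le> CARD('a) ^ n"
    unfolding eq using card_poly_roots_bound[OF f0] dg Q_def by simp
qed

lemma fixed_field_1:
  "fixed_field 1 = range (to_ac :: 'a::finite_field \<Rightarrow> _)"
proof -
  have "card (range (to_ac :: 'a \<Rightarrow> _)) = CARD('a)" by (simp add: card_image inj_to_ac)
  moreover have "range (to_ac :: 'a \<Rightarrow> _) \<subseteq> fixed_field 1" using fixed_field_to_ac by blast
  ultimately show ?thesis
    using card_fixed_field[of 1]
    by (metis One_nat_def card_seteq lessI power_one_right)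
qed

text \<open>
  Evaluation at a root \<open>\<theta>\<close> identifies the residue field of \<open>p\<close> with the subfield fixed by the \<open>d\<close>-th power of
  Frobenius, so congruences modulo \<open>p\<close> become equations between elements of the algebraic closure.
\<close>
locale irreducible_root =
  fixes p :: "'a::finite_field poly" and \<theta> :: "'a alg_closure"
  assumes irr: "irreducible p" and root: "ac_eval p \<theta> = 0"
begin

abbreviation "d \<equiv> deg p"

lemma degree_pos: "d > 0"
  using irr is_unit_iff_degree[of p] unfolding Factorial_Ring.irreducible_def by auto

lemma ac_eval_eq_0_iff: "ac_eval f \<theta> = 0 \<longleftrightarrow> p dvd f"
proof
  assume "p dvd f"
  then show "ac_eval f \<theta> = 0" using root by (auto elim!: dvdE simp: ac_eval_mult)
next
  assume f: "ac_eval f \<theta> = 0"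
  obtain g u v where g: "g = u * p + v * f" "g dvd p" "g dvd f" using poly_bezout by blast
  have "ac_eval g \<theta> = 0" using f root g(1) by (simp add: ac_eval_add ac_eval_mult)
  then have "\<not> g dvd 1" by (auto elim!: dvdE simp: ac_eval_mult dest!: arg_cong[of 1 _ "\<lambda>h. ac_eval h \<theta>"])
  moreover obtain k where k: "p = g * k" using g(2) by (auto elim: dvdE)
  ultimately have "k dvd 1" using irr unfolding Factorial_Ring.irreducible_def by blast
  then have "p dvd g" using k by (metis dvd_mult_unit_iff dvd_refl mult.commute dvd_mult_unit_iff')
  then show "p dvd f" using g(3) dvd_trans by blast
qed

lemma ac_eval_mod: "ac_eval (f mod p) \<theta> = ac_eval f \<theta>"
  using root by (simp add: minus_div_mult_eq_mod[symmetric] ac_eval_diff ac_eval_mult)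

lemma mod_below: "f mod p \<in> polys_below d"
proof -
  have "p \<noteq> 0" using irr by auto
  then show ?thesis using degree_mod_less[of p f] by (simp add: polys_below_degree)
qed

lemma inj_ac_eval: "inj_on (\<lambda>f. ac_eval f \<theta>) (polys_below d)"
proof (rule inj_onI)
  fix f g assume "f \<in> polys_below d" "g \<in> polys_below d" "ac_eval f \<theta> = ac_eval g \<theta>"
  then have fg: "f - g \<in> polys_below d" "p dvd f - g"
    using ac_eval_eq_0_iff[of "f - g"] by (simp_all add: ac_eval_diff polys_below_diff)
  then show "f = g" using dvd_imp_degree_le[of p "f - g"] by (fastforce simp: polys_below_degree)
qed

text \<open>
  The values at \<open>\<theta>\<close> form a finite integral domain with \<open>q\<^sup>d\<close> elements; multiplication by a nonzero value
  permutes the nonzero ones, and comparing products gives Fermat's little theorem.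
\<close>
lemma ac_eval_in_fixed_field: "ac_eval f \<theta> \<in> fixed_field d"
proof (cases "ac_eval f \<theta> = 0")
  case True
  then show ?thesis unfolding fixed_field_def by (simp add: power_0_left)
next
  case False
  define x where "x = ac_eval f \<theta>"
  define S where "S = (\<lambda>f. ac_eval f \<theta>) ` polys_below d - {0}"
  have S_iff: "y \<in> S \<longleftrightarrow> y \<noteq> 0 \<and> (\<exists>g. y = ac_eval g \<theta>)" for y
  proof -
    have "(\<lambda>f. ac_eval f \<theta>) ` polys_below d = range (\<lambda>f. ac_eval f \<theta>)"
    proof (intro equalityI subsetI)
      fix y assume "y \<in> range (\<lambda>f. ac_eval f \<theta>)"
      then obtain f where "y = ac_eval (f mod p) \<theta>" using ac_eval_mod by auto
      then show "y \<in> (\<lambda>f. ac_eval f \<theta>) ` polys_below d" using mod_below by blast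
    qed blast
    then show ?thesis unfolding S_def by auto
  qed
  have fin: "finite S" unfolding S_def by simp
  have "0 \<in> (\<lambda>f. ac_eval f \<theta>) ` polys_below d"
    by (rule image_eqI[of _ _ 0]) (simp_all add: polys_below_def)
  then have cS: "card S = CARD('a) ^ d - 1"
    unfolding S_def using card_image[OF inj_ac_eval] card_polys_below'[where 'a = 'a, of d] by simp
  have x: "x \<noteq> 0" "x \<in> S" using False S_iff unfolding x_def by auto
  have "x * y \<in> S" if y: "y \<in> S" for y
  proof -
    obtain g where "y = ac_eval g \<theta>" "y \<noteq> 0" using y S_iff by blast
    then have "x * y = ac_eval (f * g) \<theta>" "x * y \<noteq> 0" using x(1) by (simp_all add: x_def ac_eval_mult)
    then show ?thesis using S_iff by blast
  qed
  then have "(*) x ` S \<subseteq> S" by blast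
  moreover have inj: "inj_on ((*) x) S" using x(1) by (auto simp: inj_on_def)
  ultimately have "(*) x ` S = S" using fin by (simp add: endo_inj_surj)
  then have "(\<Prod>y\<in>S. y) = (\<Prod>y\<in>S. x * y)"
    using prod.reindex[OF inj, of "\<lambda>y. y"] by simp
  also have "\<dots> = x ^ card S * (\<Prod>y\<in>S. y)" by (simp add: prod.distrib)
  finally have "x ^ card S = 1" using fin S_iff by simp
  moreover have "x ^ (CARD('a) ^ d) = x * x ^ card S"
    unfolding cS by (metis Suc_pred' zero_less_card_finite power_Suc zero_less_power)
  ultimately show ?thesis unfolding fixed_field_def x_def by simp
qed

lemma fixed_field_eq: "fixed_field d = range (\<lambda>f. ac_eval f \<theta>)"
proof -
  have "(\<lambda>f. ac_eval f \<theta>) ` polys_below d = fixed_field d"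
  proof (rule card_seteq)
    show "finite (fixed_field d :: 'a alg_closure set)" using card_fixed_field degree_pos by blast
    show "(\<lambda>f. ac_eval f \<theta>) ` polys_below d \<subseteq> fixed_field d" using ac_eval_in_fixed_field by blast
    show "card (fixed_field d :: 'a alg_closure set) \<le> card ((\<lambda>f. ac_eval f \<theta>) ` polys_below d)"
      using card_fixed_field(2)[OF degree_pos] card_image[OF inj_ac_eval]
        card_polys_below'[where 'a = 'a, of d] by simp
  qed
  then show ?thesis using ac_eval_in_fixed_field by blast
qed

text \<open>
  A coincidence among the conjugates would put all \<open>q\<^sup>d\<close> values at \<open>\<theta>\<close> into a smaller finite field.
\<close>
lemma conjugates_inj: "inj_on (\<lambda>i. \<theta> ^ (CARD('a) ^ i)) {..<d}"
proof -
  have False if ij: "i < j" "j < d" "\<theta> ^ (CARD('a) ^ i) = \<theta> ^ (CARD('a) ^ j)" for i j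
  proof -
    define k where "k = j - i"
    have k: "k > 0" "k < d" "j = k + i" using ij unfolding k_def by auto
    have "(\<theta> ^ (CARD('a) ^ k) - \<theta>) ^ (CARD('a) ^ i) = 0"
      using ij(3) unfolding k(3) by (simp add: frobenius_diff frobenius_comp)
    then have th: "\<theta> ^ (CARD('a) ^ k) = \<theta>" by simp
    have "ac_eval f \<theta> \<in> fixed_field k" for f
      unfolding fixed_field_def by (simp add: frobenius_ac_eval th)
    then have "(\<lambda>f. ac_eval f \<theta>) ` polys_below d \<subseteq> fixed_field k" by blast
    then have "CARD('a) ^ d \<le> CARD('a) ^ k"
      using card_fixed_field[OF k(1)] card_image[OF inj_ac_eval]
        card_polys_below'[where 'a = 'a, of d] card_mono order_trans by metis
    then show False using k(2) card_gt_1[where 'a = 'a] by simp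
  qed
  then show ?thesis by (intro inj_onI) (metis lessThan_iff linorder_neqE_nat)
qed

text \<open>
  A square root taken in the algebraic closure descends to the residue field as soon as Frobenius fixes it.
\<close>
lemma square_modI:
  assumes "r \<in> fixed_field d" "r\<^sup>2 = ac_eval f \<theta>"
  shows "\<exists>g. p dvd g\<^sup>2 - f"
proof -
  obtain g where "r = ac_eval g \<theta>" using assms(1) fixed_field_eq by auto
  then have "ac_eval (g\<^sup>2 - f) \<theta> = 0" using assms(2) by (simp add: ac_eval_diff ac_eval_power)
  then show ?thesis using ac_eval_eq_0_iff by blast
qed

end

section \<open>Squares and binary forms over a finite field\<close>

text \<open>
  In characteristic two the pairs \<open>{x, x + 1}\<close> would partition the field.
\<close>
lemma odd_CARD_imp_two_nonzero:
  assumes "odd CARD('a::finite_field)"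
  shows "(2 :: 'a) \<noteq> 0"
proof
  assume two: "(2 :: 'a) = 0"
  have m: "x + x = 0" for x :: 'a using two by (metis mult_2 mult_zero_left)
  have "even (card (UNIV :: 'a set))"
  proof -
    define P where "P = {{x, x + 1} | x :: 'a. True}"
    have U: "\<Union>P = UNIV" unfolding P_def by auto
    have "x + 1 + 1 = x" for x :: 'a using m[of 1] by (simp add: add.assoc)
    then have "disjoint P"
      unfolding P_def disjoint_def by auto
    moreover have c2: "card A = 2" if "A \<in> P" for A using that unfolding P_def by auto
    ultimately have "card (\<Union>P) = sum card P"
      by (intro card_Union_disjoint) (auto simp: P_def pairwise_def disjnt_def disjoint_def)
    also have "\<dots> = 2 * card P" using c2 by simp
    finally show ?thesis using U by simp
  qed
  then show False using assms by simp
qed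

lemma collision:
  assumes "f ` A \<subseteq> B" "finite B" "card B < card A"
  shows "\<exists>a\<in>A. \<exists>b\<in>A. a \<noteq> b \<and> f a = f b"
proof -
  have "card (f ` A) < card A" using assms card_mono[of B "f ` A"] by simp
  then show ?thesis using pigeonhole[of f A] by (auto simp: inj_on_def)
qed

text \<open>
  Squaring is at most two-to-one, and the cardinality is odd.
\<close>
lemma card_squares:
  assumes odd: "odd CARD('a::finite_field)"
  shows "CARD('a) < 2 * card (range (\<lambda>x :: 'a. x\<^sup>2))"
proof -
  define S where "S = range (\<lambda>x :: 'a. x\<^sup>2)"
  have fib: "card {x :: 'a. x\<^sup>2 = y} \<le> 2" for y
  proof (cases "\<exists>r :: 'a. r\<^sup>2 = y")
    case True
    then obtain r :: 'a where r: "r\<^sup>2 = y" by auto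
    then have "{x. x\<^sup>2 = y} \<subseteq> {r, -r}" by (auto simp: power2_eq_iff)
    then have "card {x. x\<^sup>2 = y} \<le> card {r, -r}" by (intro card_mono) auto
    also have "\<dots> \<le> 2" by (simp add: card_insert_if)
    finally show ?thesis .
  qed auto
  have "CARD('a) = card (\<Union>y\<in>S. {x. x\<^sup>2 = y})" unfolding S_def by (rule arg_cong[of _ _ card]) auto
  also have "\<dots> \<le> (\<Sum>y\<in>S. card {x :: 'a. x\<^sup>2 = y})" by (intro card_UN_le) simp
  also have "\<dots> \<le> (\<Sum>y\<in>S. 2)" by (intro sum_mono fib)
  finally have "CARD('a) \<le> 2 * card S" by simp
  moreover have "CARD('a) \<noteq> 2 * card S" using odd by (metis dvd_triv_left)
  ultimately show ?thesis unfolding S_def by simp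
qed

text \<open>
  The norm of a quadratic extension of finite fields is surjective. Here it suffices that the more than
  \<open>q / 2\<close> values of \<open>\<alpha>\<^sup>2\<close> meet the equally many values of \<open>e + e \<beta>\<^sup>2\<close>.
\<close>
lemma nonsquare_binary_form_represents:
  fixes e :: "'a::finite_field"
  assumes odd: "odd CARD('a)" and ns: "\<nexists>x. x ^ 2 = e"
  shows "\<exists>\<alpha> \<beta>. \<beta> \<noteq> 0 \<and> \<alpha>\<^sup>2 - e * \<beta>\<^sup>2 = e"
proof -
  define S where "S = range (\<lambda>x :: 'a. x\<^sup>2)"
  have cS: "CARD('a) < 2 * card S" unfolding S_def by (rule card_squares[OF odd])
  define S' where "S' = (\<lambda>y. e + e * y) ` S"
  have e0: "e \<noteq> 0" using ns by (metis zero_power2)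
  have "card S' = card S" unfolding S'_def using e0 by (intro card_image) (auto simp: inj_on_def)
  moreover have "card (S \<union> S') \<le> CARD('a)" by (intro card_mono) auto
  ultimately have "S \<inter> S' \<noteq> {}"
    using cS card_Un_disjoint[of S S'] by auto
  then obtain \<alpha> \<beta> where ab: "\<alpha>\<^sup>2 = e + e * \<beta>\<^sup>2" unfolding S_def S'_def by auto
  then have "\<beta> \<noteq> 0" "\<alpha>\<^sup>2 - e * \<beta>\<^sup>2 = e" using ns by auto
  then show ?thesis by blast
qed

lemma square_or_nonsquare_times_square:
  fixes e x :: "'a::finite_field"
  assumes odd: "odd CARD('a)" and ns: "\<nexists>x. x ^ 2 = e"
  shows "\<exists>k. x = k\<^sup>2 \<or> x = e * k\<^sup>2"
proof -
  define S where "S = range (\<lambda>x :: 'a. x\<^sup>2)"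
  have e0: "e \<noteq> 0" using ns by (metis zero_power2)
  have cS: "card ((*) e ` S) = card S" using e0 by (intro card_image) (auto simp: inj_on_def)
  have "S \<inter> (*) e ` S \<subseteq> {0}"
  proof
    fix y assume "y \<in> S \<inter> (*) e ` S"
    then obtain a b where ab: "y = a\<^sup>2" "y = e * b\<^sup>2" unfolding S_def by blast
    have "b = 0"
    proof (rule ccontr)
      assume "b \<noteq> 0"
      then have "(a / b)\<^sup>2 = e" using ab by (simp add: power_divide nonzero_divide_eq_eq)
      then show False using ns by blast
    qed
    then show "y \<in> {0}" using ab by simp
  qed
  then have "card (S \<inter> (*) e ` S) \<le> 1" using card_mono[of "{0}" "S \<inter> (*) e ` S"] by simp
  then have "CARD('a) \<le> card (S \<union> (*) e ` S)"
    using card_Un_Int[of S "(*) e ` S"] cS card_squares[OF odd] unfolding S_def by simp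
  then have "S \<union> (*) e ` S = UNIV" by (intro card_seteq) auto
  then show ?thesis unfolding S_def by (auto simp: set_eq_iff image_iff)
qed

section \<open>Representing the prime, and a rational point on a conic\<close>

context irreducible_root
begin

context
  fixes e :: 'a
  assumes odd: "odd CARD('a)" and ns: "\<nexists>x. x ^ 2 = e" and even: "even d"
begin

lemma sqrt_nonsquare:
  assumes "\<epsilon>\<^sup>2 = to_ac e"
  shows "\<epsilon> ^ CARD('a) = - \<epsilon>" and "\<epsilon> \<in> fixed_field 2"
proof -
  have "(\<epsilon> ^ CARD('a))\<^sup>2 = (\<epsilon>\<^sup>2) ^ CARD('a)" by (simp add: power_mult[symmetric] mult.commute)
  also have "\<dots> = \<epsilon>\<^sup>2" using frobenius_to_ac[of e 1] unfolding assms by simp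
  finally have "\<epsilon> ^ CARD('a) = \<epsilon> \<or> \<epsilon> ^ CARD('a) = - \<epsilon>" by (simp add: power2_eq_iff)
  moreover have "\<epsilon> ^ CARD('a) \<noteq> \<epsilon>"
  proof
    assume "\<epsilon> ^ CARD('a) = \<epsilon>"
    then have "\<epsilon> \<in> range to_ac" using fixed_field_1 unfolding fixed_field_def by auto
    then obtain a where "\<epsilon> = to_ac a" by auto
    then have "to_ac (a\<^sup>2) = to_ac e" using assms by simp
    then show False using ns unfolding to_ac_eq_iff by blast
  qed
  ultimately show *: "\<epsilon> ^ CARD('a) = - \<epsilon>" by blast
  have "(\<epsilon> ^ (CARD('a) ^ 1)) ^ (CARD('a) ^ 1) = \<epsilon>"
    unfolding frobenius_neg[of \<epsilon> 1] using * frobenius_neg[of \<epsilon> 1] by simp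
  then show "\<epsilon> \<in> fixed_field 2" unfolding frobenius_comp fixed_field_def by (simp add: power2_eq_square)
qed

lemma nonsquare_is_square_mod: "\<exists>\<rho>. p dvd \<rho>\<^sup>2 - [:e:]"
proof -
  obtain \<epsilon> where e: "\<epsilon>\<^sup>2 = to_ac e" using nth_root_exists[of 2] by auto
  \<comment> \<open>the quadratic extension lies in the residue field because \<open>d\<close> is even\<close>
  have "\<epsilon> \<in> fixed_field d" using sqrt_nonsquare(2)[OF e] fixed_field_mono even by blast
  then show ?thesis using square_modI[of \<epsilon> "[:e:]"] e by simp
qed

text \<open>
  This is the reciprocity law for the two conjugate factors of \<open>e p\<close> over the quadratic constant
  extension. If \<open>\<epsilon>\<^sup>2 = e\<close>, then \<open>U - \<epsilon> V\<close> and \<open>U + \<epsilon> V\<close> share out the conjugates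
  \<open>\<theta>\<^sub>j = \<theta> ^ (q ^ j)\<close> of \<open>\<theta>\<close> according to the parity of \<open>j\<close>. So up to a constant of the field with \<open>q\<^sup>2\<close>
  elements \<open>V(\<theta>)\<close> is the product of the differences \<open>\<tau>\<^sub>j = \<theta> - \<theta>\<^sub>j\<close> over odd \<open>j\<close>. Frobenius gives
  \<open>\<tau>\<^bsub>d-j\<^esub> = - \<tau>\<^sub>j ^ (q ^ (d - j))\<close>, so the factors for \<open>j\<close> and \<open>d - j\<close> multiply to minus an even power of
  \<open>\<tau>\<^sub>j\<close>. The two indices differ because \<open>d / 2\<close> is even. Finally, constants from the field with \<open>q\<^sup>2\<close>
  elements are squares in the field with \<open>q\<^sup>4\<close> elements, which is contained in the residue field.
\<close>
lemma factor_is_square_mod: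
  assumes four: "4 dvd d" and D: "U\<^sup>2 - smult e (V\<^sup>2) = smult e p"
    and dU: "deg U \<le> d div 2" and dV: "deg V \<le> d div 2"
  shows "\<exists>\<rho>. p dvd \<rho>\<^sup>2 - smult c V"
proof -
  let ?q = "CARD('a)"
  have two: "(2 :: 'a alg_closure) \<noteq> 0"
    using odd_CARD_imp_two_nonzero[OF odd] by (metis to_ac_eq_0_iff to_ac_numeral)
  have qodd: "odd (?q ^ n)" for n using odd by simp
  obtain \<epsilon>0 where e0: "\<epsilon>0\<^sup>2 = to_ac e" using nth_root_exists[of 2] by auto
  have "ac_eval (U\<^sup>2 - smult e (V\<^sup>2)) \<theta> = 0"
    unfolding D by (simp add: ac_eval_smult root)
  then have "(ac_eval U \<theta>)\<^sup>2 = (\<epsilon>0 * ac_eval V \<theta>)\<^sup>2"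
    by (simp add: ac_eval_diff ac_eval_power ac_eval_smult e0 power_mult_distrib)
  then have "ac_eval U \<theta> = \<epsilon>0 * ac_eval V \<theta> \<or> ac_eval U \<theta> = - \<epsilon>0 * ac_eval V \<theta>"
    by (simp add: power2_eq_iff)
  then obtain \<epsilon> where e: "\<epsilon>\<^sup>2 = to_ac e" and UV: "ac_eval U \<theta> = \<epsilon> * ac_eval V \<theta>"
    using e0 by (metis power2_minus)
  have e_neq: "\<epsilon> \<noteq> 0" using e ns by (metis power2_eq_iff to_ac_eq_0_iff zero_power2)
  have e_odd: "\<epsilon> ^ (?q ^ j) = - \<epsilon>" if "odd j" for j
  proof -
    obtain k where j: "j = 2 * k + 1" using \<open>odd j\<close> by (auto elim: oddE)
    have "\<epsilon> \<in> fixed_field (2 * k)" using sqrt_nonsquare(2)[OF e] fixed_field_mono[of 2 "2 * k"] by auto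
    then have "\<epsilon> ^ (?q ^ j) = (\<epsilon>) ^ (?q ^ 1)"
      unfolding j frobenius_comp[symmetric] fixed_field_def by simp
    then show ?thesis using sqrt_nonsquare(1)[OF e] by simp
  qed
  define conj where "conj j = \<theta> ^ (?q ^ j)" for j
  define \<tau> where "\<tau> j = \<theta> - conj j" for j
  define J where "J = {j. j < d \<and> odd j}"
  \<comment> \<open>representatives of the pairs \<open>{j, d - j}\<close> of odd indices\<close>
  define J1 where "J1 = {j. j < d div 2 \<and> odd j}"
  have fin: "finite J" "finite J1" unfolding J_def J1_def by simp_all
  have J_split: "J = J1 \<union> (\<lambda>j. d - j) ` J1" "J1 \<inter> (\<lambda>j. d - j) ` J1 = {}"
  proof -
    show "J = J1 \<union> (\<lambda>j. d - j) ` J1"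
    proof (intro equalityI subsetI)
      fix j assume j: "j \<in> J"
      then have "j \<noteq> d div 2" using four unfolding J_def by (auto elim!: dvdE)
      then have "j \<in> J1 \<or> d - j \<in> J1 \<and> j = d - (d - j)"
        using j four unfolding J_def J1_def by (auto elim!: dvdE)
      then show "j \<in> J1 \<union> (\<lambda>j. d - j) ` J1" by blast
    next
      fix j assume "j \<in> J1 \<union> (\<lambda>j. d - j) ` J1"
      then consider "j \<in> J1" | i where "i \<in> J1" "j = d - i" by blast
      then show "j \<in> J"
      proof cases
        case 2
        then have "i > 0" "i < d" "odd i" unfolding J1_def by (auto intro: odd_pos)
        then show ?thesis using 2 even degree_pos unfolding J_def by auto
      qed (auto simp: J_def J1_def)
    qed
    show "J1 \<inter> (\<lambda>j. d - j) ` J1 = {}" unfolding J1_def by auto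
  qed
  have inj1: "inj_on (\<lambda>j. d - j) J1" unfolding J1_def by (auto simp: inj_on_def)
  have cardJ: "card J = d div 2"
  proof -
    have "J = (\<lambda>i. 2 * i + 1) ` {..<d div 2}"
    proof (intro equalityI subsetI)
      fix j assume "j \<in> J"
      then have "j = 2 * (j div 2) + 1" "j div 2 < d div 2" using even unfolding J_def by auto
      then show "j \<in> (\<lambda>i. 2 * i + 1) ` {..<d div 2}" by blast
    qed (use even in \<open>auto simp: J_def\<close>)
    then show ?thesis by (simp add: card_image inj_on_def)
  qed
  have th: "\<theta> \<in> fixed_field d" using ac_eval_in_fixed_field[of "[:0, 1:]"] by simp
  then have tau_fix: "\<tau> j \<in> fixed_field d" for j
    unfolding \<tau>_def conj_def by (intro fixed_field_closed)
  have tau_opp: "\<tau> (d - j) = - (\<tau> j ^ (?q ^ (d - j)))" if "j < d" for j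
  proof -
    have "conj j ^ (?q ^ (d - j)) = \<theta>"
      unfolding conj_def frobenius_comp using that th unfolding fixed_field_def by simp
    then show ?thesis unfolding \<tau>_def by (simp add: frobenius_diff conj_def[symmetric])
  qed
  define \<beta> where "\<beta> = (\<Prod>j\<in>J. \<tau> j)"
  define r where "r = (\<Prod>j\<in>J1. \<tau> j ^ ((1 + ?q ^ (d - j)) div 2))"
  have r_fix: "r \<in> fixed_field d"
    unfolding r_def using fin(2)
    by (induction J1 rule: finite_induct) (simp_all add: fixed_field_one fixed_field_closed tau_fix)
  have beta: "\<beta> = (- 1) ^ card J1 * r\<^sup>2"
  proof -
    have "\<beta> = (\<Prod>j\<in>J1. \<tau> j) * (\<Prod>j\<in>J1. \<tau> (d - j))"
      unfolding \<beta>_def J_split(1)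
      using prod.union_disjoint[OF fin(2) finite_imageI[OF fin(2)] J_split(2), of \<tau>] prod.reindex[OF inj1, of \<tau>]
      by simp
    also have "\<dots> = (\<Prod>j\<in>J1. (- 1) * (\<tau> j ^ ((1 + ?q ^ (d - j)) div 2))\<^sup>2)"
    proof -
      have "\<tau> j * \<tau> (d - j) = (- 1) * (\<tau> j ^ ((1 + ?q ^ (d - j)) div 2))\<^sup>2" if "j \<in> J1" for j
      proof -
        have "j < d" using that unfolding J1_def by auto
        have "(1 + ?q ^ (d - j)) div 2 * 2 = 1 + ?q ^ (d - j)"
          using qodd[of "d - j"] by (intro dvd_div_mult_self) (simp del: even_power)
        then have "(\<tau> j ^ ((1 + ?q ^ (d - j)) div 2))\<^sup>2 = \<tau> j ^ (1 + ?q ^ (d - j))"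
          by (simp only: power_mult[symmetric])
        then show ?thesis using tau_opp[OF \<open>j < d\<close>] by simp
      qed
      then show ?thesis by (simp add: prod.distrib[symmetric])
    qed
    also have "\<dots> = (- 1) ^ card J1 * r\<^sup>2"
      unfolding r_def prod.distrib prod_power_distrib by simp
    finally show ?thesis .
  qed
  \<comment> \<open>\<open>U + \<epsilon> V\<close> splits over the odd conjugates\<close>
  define G where "G = map_poly to_ac U + smult \<epsilon> (map_poly to_ac V)"
  define \<kappa> where "\<kappa> = coeff G (d div 2)"
  define H where "H = smult \<kappa> (\<Prod>j\<in>J. [:- conj j, 1:])"
  have dG: "deg G \<le> d div 2"
    unfolding G_def using dU dV
    by (intro degree_add_le) (auto intro: order.trans[OF degree_smult_le] order.trans[OF map_poly_degree_leq])
  have degP: "deg (\<Prod>j\<in>J. [:- conj j, 1:]) = d div 2"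
    using cardJ by (subst degree_prod_eq_sum_degree) auto
  have ldP: "coeff (\<Prod>j\<in>J. [:- conj j, 1:]) (d div 2) = 1"
    using lead_coeff_prod[of "\<lambda>j. [:- conj j, 1:]" J] unfolding degP by simp
  have "G = H"
  proof (rule poly_eqI_degree_lead_coeff[where A = "conj ` J" and n = "d div 2"])
    show "coeff G (d div 2) = coeff H (d div 2)"
      unfolding H_def using ldP by (simp add: \<kappa>_def)
    show "deg G \<le> d div 2" by (rule dG)
    show "deg H \<le> d div 2" unfolding H_def using degP by simp
    have "inj_on conj J" using conjugates_inj unfolding conj_def J_def by (auto simp: inj_on_def)
    then show "d div 2 \<le> card (conj ` J)" using cardJ by (simp add: card_image)
    show "poly G z = poly H z" if z: "z \<in> conj ` J" for z
    proof -
      obtain j where j: "j \<in> J" "z = conj j" using z by auto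
      have "poly G z = ac_eval U z + \<epsilon> * ac_eval V z" unfolding G_def ac_eval_def by simp
      also have "\<dots> = ac_eval U \<theta> ^ (?q ^ j) + \<epsilon> * ac_eval V \<theta> ^ (?q ^ j)"
        unfolding j(2) conj_def by (simp add: frobenius_ac_eval)
      also have "\<dots> = 0" unfolding UV using e_odd[of j] j(1) by (simp add: power_mult_distrib J_def)
      finally show ?thesis unfolding H_def using j fin by (auto simp: poly_prod)
    qed
  qed
  then have "ac_eval U \<theta> + \<epsilon> * ac_eval V \<theta> = poly H \<theta>"
    unfolding G_def ac_eval_def by (metis poly_add poly_smult)
  then have "2 * \<epsilon> * ac_eval V \<theta> = \<kappa> * \<beta>"
    unfolding H_def UV \<beta>_def \<tau>_def by (simp add: poly_prod mult.assoc)
  then have Vth: "ac_eval V \<theta> = \<kappa> * (- 1) ^ card J1 / (2 * \<epsilon>) * r\<^sup>2"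
    using two e_neq unfolding beta by (simp add: field_simps)
  define m where "m = to_ac c * (\<kappa> * (- 1) ^ card J1 / (2 * \<epsilon>))"
  have kap: "\<kappa> = to_ac (coeff U (d div 2)) + \<epsilon> * to_ac (coeff V (d div 2))"
    unfolding \<kappa>_def G_def by (simp add: coeff_map_poly)
  have "2 \<in> (fixed_field 2 :: 'a alg_closure set)" using fixed_field_to_ac[of 2 2] by simp
  then have m2: "m \<in> fixed_field 2"
    unfolding m_def kap using sqrt_nonsquare(2)[OF e]
    by (intro fixed_field_closed) (auto intro: fixed_field_to_ac fixed_field_one)
  \<comment> \<open>a square root of an element of the quadratic extension lies in the quartic one\<close>
  obtain w where w: "w\<^sup>2 = m" using nth_root_exists[of 2 m] by auto
  have "(w ^ (?q ^ 2))\<^sup>2 = (w\<^sup>2) ^ (?q ^ 2)" by (simp add: power_mult[symmetric] mult.commute)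
  also have "\<dots> = w\<^sup>2" using m2 unfolding w fixed_field_def by simp
  finally have "w ^ (?q ^ 2) = w \<or> w ^ (?q ^ 2) = - w" by (simp add: power2_eq_iff)
  then have "(w ^ (?q ^ 2)) ^ (?q ^ 2) = w" using frobenius_neg[of w 2] by auto
  then have "w \<in> fixed_field 4" unfolding frobenius_comp fixed_field_def by simp
  then have "w * r \<in> fixed_field d" using fixed_field_mono[OF four] r_fix by (intro fixed_field_closed) auto
  moreover have "(w * r)\<^sup>2 = ac_eval (smult c V) \<theta>"
    unfolding ac_eval_smult Vth power_mult_distrib w m_def by simp
  ultimately show ?thesis by (rule square_modI)
qed

text \<open>
  Thue's lemma: let \<open>\<rho>\<^sup>2 \<equiv> e\<close> modulo \<open>p\<close>. There are \<open>q\<^bsup>d+1\<^esup>\<close> pairs \<open>(f, g)\<close> in the box and only \<open>q\<^sup>d\<close>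
  residues of \<open>f - \<rho> g\<close>, so some nonzero pair has \<open>p | f\<^sup>2 - e g\<^sup>2\<close>. The box is just small enough to
  make the degree equal to \<open>d\<close>, and as \<open>deg g < d / 2\<close> the quotient is the square of the leading
  coefficient of \<open>f\<close>.
\<close>
lemma prime_eq_norm_from_constant_extension:
  assumes monic: "lead_coeff p = 1"
  shows "\<exists>f g. p = f\<^sup>2 - smult e (g\<^sup>2) \<and> deg f = d div 2 \<and> g \<in> polys_below (d div 2)"
proof -
  obtain \<rho> where rho: "p dvd \<rho>\<^sup>2 - [:e:]" using nonsquare_is_square_mod by blast
  define A :: "('a poly \<times> 'a poly) set" where "A = polys_below (d div 2 + 1) \<times> polys_below (d div 2)"
  have cA: "card A = CARD('a) ^ (d + 1)"
    unfolding A_def using even by (auto simp: card_cartesian_product card_polys_below' power_add[symmetric] mult_2[symmetric] elim!: evenE)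
  have "\<exists>fg\<in>A. \<exists>fg'\<in>A. fg \<noteq> fg' \<and> (fst fg - \<rho> * snd fg) mod p = (fst fg' - \<rho> * snd fg') mod p"
    using mod_below cA card_gt_1[where 'a = 'a] by (intro collision[where B = "polys_below d"]) (auto simp: card_polys_below')
  then obtain fg fg' where fg: "fg \<in> A" "fg' \<in> A" "fg \<noteq> fg'"
    "(fst fg - \<rho> * snd fg) mod p = (fst fg' - \<rho> * snd fg') mod p"
    by blast
  define f g where "f = fst fg - fst fg'" and "g = snd fg - snd fg'"
  have fb: "f \<in> polys_below (d div 2 + 1)" and gb: "g \<in> polys_below (d div 2)"
    using fg(1,2) unfolding A_def f_def g_def by (auto intro: polys_below_diff)
  have nz: "f \<noteq> 0 \<or> g \<noteq> 0" using fg(3) unfolding f_def g_def by (auto simp: prod_eq_iff)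
  have "p dvd (fst fg - \<rho> * snd fg) - (fst fg' - \<rho> * snd fg')"
    using fg(4) by (simp add: mod_eq_dvd_iff)
  then have "p dvd f - \<rho> * g" unfolding f_def g_def by (simp add: algebra_simps)
  moreover have "f\<^sup>2 - [:e:] * g\<^sup>2 = (f - \<rho> * g) * (f + \<rho> * g) + (\<rho>\<^sup>2 - [:e:]) * g\<^sup>2"
    by (simp only: power2_eq_square algebra_simps)
  ultimately have dv: "p dvd f\<^sup>2 - [:e:] * g\<^sup>2" using rho by (metis dvd_add dvd_mult2)
  have ns': "\<nexists>x. x ^ 2 = lead_coeff [:e:]" using ns by simp
  have N0: "f\<^sup>2 - [:e:] * g\<^sup>2 \<noteq> 0" using norm_form_anisotropic[OF ns', of f g] nz by auto
  have df: "2 * deg f \<le> d" using fb even unfolding polys_below_degree by (auto elim!: evenE)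
  have dg: "g \<noteq> 0 \<Longrightarrow> 2 * deg g < d" using gb unfolding polys_below_degree by auto
  have "d \<le> deg (f\<^sup>2 - [:e:] * g\<^sup>2)" using dvd_imp_degree_le[OF dv N0] .
  then have df': "2 * deg f = d"
    using norm_form_degree(2)[OF ns', of g f] df dg
    by (cases "g = 0"; cases "f = 0") (auto simp: degree_power_eq max_def split: if_splits)
  have "deg (f\<^sup>2 - [:e:] * g\<^sup>2) = d"
    using norm_form_degree(2)[OF ns', of g f] df' dg
    by (cases "g = 0"; cases "f = 0") (auto simp: degree_power_eq max_def split: if_splits)
  obtain h where h: "f\<^sup>2 - [:e:] * g\<^sup>2 = p * h" using dv by (auto elim: dvdE)
  have "deg h = 0"
    using \<open>deg (f\<^sup>2 - [:e:] * g\<^sup>2) = d\<close> N0 unfolding h by (auto simp: degree_mult_eq)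
  then obtain k where k: "h = [:k:]" using degree_eq_zeroE by blast
  have f0: "f \<noteq> 0" using df' degree_pos by auto
  have "coeff (g\<^sup>2) d = 0"
    using dg by (cases "g = 0") (auto intro!: coeff_eq_0 simp: degree_power_eq)
  moreover have "coeff (f\<^sup>2) d = (lead_coeff f)\<^sup>2"
    using lead_coeff_power[of f 2] f0 df' by (simp add: degree_power_eq)
  ultimately have kf: "k = (lead_coeff f)\<^sup>2"
    using arg_cong[OF h, of "\<lambda>h. coeff h d"] monic unfolding k by simp
  define c where "c = lead_coeff f"
  have c0: "c \<noteq> 0" unfolding c_def using f0 by simp
  have sm: "f\<^sup>2 - smult e (g\<^sup>2) = smult (c\<^sup>2) p"
    using h unfolding k kf c_def by simp
  have "(smult (1 / c) f)\<^sup>2 - smult e ((smult (1 / c) g)\<^sup>2)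
     = smult ((1 / c)\<^sup>2) (f\<^sup>2 - smult e (g\<^sup>2))"
    by (simp add: power2_eq_square smult_diff_right mult_ac)
  also have "\<dots> = p" unfolding sm using c0 by (simp add: power_divide)
  finally show ?thesis
    using df' gb c0 by (intro exI[of _ "smult (1 / c) f"] exI[of _ "smult (1 / c) g"])
      (auto simp: polys_below_def)
qed

text \<open>
  Multiply a representation of \<open>p\<close> by one of the constant \<open>e\<close>. The coefficient \<open>\<beta> \<noteq> 0\<close> of the latter
  raises the degree of \<open>V\<close> to exactly \<open>d / 2\<close>.
\<close>
lemma genus_representation:
  assumes monic: "lead_coeff p = 1"
  shows "\<exists>U V. U\<^sup>2 - smult e (V\<^sup>2) = smult e p
    \<and> deg U \<le> d div 2 \<and> deg V = d div 2 \<and> V \<noteq> 0"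
proof -
  obtain f g where fg: "p = f\<^sup>2 - smult e (g\<^sup>2)" "deg f = d div 2"
    "g \<in> polys_below (d div 2)" using prime_eq_norm_from_constant_extension[OF monic] by blast
  obtain \<alpha> \<beta> where ab: "\<beta> \<noteq> 0" "\<alpha>\<^sup>2 - e * \<beta>\<^sup>2 = e" using nonsquare_binary_form_represents[OF odd ns] by blast
  define U V where "U = smult \<alpha> f + smult (e * \<beta>) g"
    and "V = smult \<beta> f + smult \<alpha> g"
  have "U\<^sup>2 - [:e:] * V\<^sup>2 = [:\<alpha>\<^sup>2 - e * \<beta>\<^sup>2:] * (f\<^sup>2 - [:e:] * g\<^sup>2)"
  proof -
    have s: "smult c h = [:c:] * h" for c and h :: "'a poly" by simp
    have m: "[:a * b:] = [:a:] * [:b:]" "[:a\<^sup>2:] = [:a:]\<^sup>2" "[:a - b:] = [:a:] - [:b:]" for a b :: 'a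
      by (simp_all add: power2_eq_square)
    show ?thesis unfolding U_def V_def s m by (simp only: power2_eq_square algebra_simps)
  qed
  then have "U\<^sup>2 - smult e (V\<^sup>2) = smult e p" using fg(1) ab(2) by simp
  moreover have g': "g = 0 \<or> deg g < d div 2" using fg(3) by (simp add: polys_below_degree)
  then have "deg U \<le> d div 2"
    unfolding U_def using fg(2)
    by (intro degree_add_le) (auto intro: order.trans[OF degree_smult_le])
  moreover have pos: "d div 2 > 0" using even degree_pos by (auto elim!: evenE)
  have "deg V = d div 2"
    unfolding V_def
  proof (subst degree_add_eq_left)
    show "deg (smult \<alpha> g) < deg (smult \<beta> f)"
      using ab(1) fg(2) g' pos by auto
  qed (use ab(1) fg(2) in simp)
  ultimately show ?thesis using pos by (intro exI[of _ U] exI[of _ V]) auto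
qed

text \<open>
  A Legendre-type argument. Put \<open>Q = V x\<^sup>2 + 2 U x y + e V y\<^sup>2 - c m\<^sup>2\<close>, so that with \<open>z = V x + U y\<close> one has
  \<open>V Q = z\<^sup>2 - e p y\<^sup>2 - c V m\<^sup>2\<close>. As \<open>c V \<equiv> \<rho>\<^sup>2\<close> modulo \<open>p\<close>, the linear condition \<open>z \<equiv> \<rho> m\<close> implies
  \<open>p | Q\<close>. The box for \<open>(x, y, m)\<close> has \<open>q\<^bsup>d+1\<^esup>\<close> points, and within it \<open>deg Q \<le> d\<close>, the coefficient of degree
  \<open>d\<close> being \<open>l \<xi>\<^sup>2\<close> with \<open>l\<close> the leading coefficient of \<open>V\<close>. Hence \<open>Q = l \<xi>\<^sup>2 p\<close>. The choice
  \<open>c = - l e\<close> turns \<open>V Q\<close> into \<open>- c V \<cdot> e p w\<^sup>2\<close> with the constant \<open>w = \<xi> / e\<close>, and the two sides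
  of the conclusion appear as multiples of values of the norm form.
\<close>
lemma conic_point:
  assumes monic: "lead_coeff p = 1" and four: "4 dvd d"
    and D: "U\<^sup>2 - smult e (V\<^sup>2) = smult e p"
    and dU: "deg U \<le> d div 2" and dV: "deg V = d div 2" and V0: "V \<noteq> 0"
  shows "\<exists>c z y m w. c \<noteq> 0 \<and> (m \<noteq> 0 \<or> w \<noteq> 0) \<and>
    z\<^sup>2 - smult e p * y\<^sup>2 = smult c V * (m\<^sup>2 - smult e p * w\<^sup>2)"
proof -
  define l where "l = lead_coeff V"
  define c where "c = - (l * e)"
  have e0: "e \<noteq> 0" using ns by (metis zero_power2)
  have c0: "c \<noteq> 0" unfolding c_def l_def using e0 V0 by simp
  obtain n where n: "d = 4 * n" using four by (auto elim: dvdE)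
  have npos: "n > 0" using n degree_pos by simp
  obtain \<rho> where rho: "p dvd \<rho>\<^sup>2 - smult c V"
    using factor_is_square_mod[OF four D dU] dV by auto
  define A :: "('a poly \<times> 'a poly \<times> 'a poly) set"
    where "A = polys_below (n + 1) \<times> polys_below n \<times> polys_below (2 * n)"
  have cA: "card A = CARD('a) ^ (d + 1)"
    unfolding A_def n by (simp add: card_cartesian_product card_polys_below' power_add[symmetric])
  define L where "L t = V * fst t + U * fst (snd t) - \<rho> * snd (snd t)" for t
  have "\<exists>t\<in>A. \<exists>t'\<in>A. t \<noteq> t' \<and> L t mod p = L t' mod p"
    using mod_below cA card_gt_1[where 'a = 'a] by (intro collision[where B = "polys_below d"]) (auto simp: card_polys_below')
  then obtain t t' where t: "t \<in> A" "t' \<in> A" "t \<noteq> t'" "L t mod p = L t' mod p"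
    by blast
  define x y m where "x = fst t - fst t'" and "y = fst (snd t) - fst (snd t')" and "m = snd (snd t) - snd (snd t')"
  have xb: "x \<in> polys_below (n + 1)" and yb: "y \<in> polys_below n" and mb: "m \<in> polys_below (2 * n)"
    using t(1,2) unfolding A_def x_def y_def m_def by (auto intro: polys_below_diff)
  have nz: "x \<noteq> 0 \<or> y \<noteq> 0 \<or> m \<noteq> 0"
    using t(3) unfolding x_def y_def m_def by (auto simp: prod_eq_iff)
  define z where "z = V * x + U * y"
  have "p dvd L t - L t'" using t(4) by (simp add: mod_eq_dvd_iff)
  then have zdv: "p dvd z - \<rho> * m" unfolding L_def z_def x_def y_def m_def by (simp add: algebra_simps)
  define Q where "Q = V * x\<^sup>2 + 2 * U * x * y + [:e:] * V * y\<^sup>2 - [:c:] * m\<^sup>2"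
  have D': "[:e:] * p = U\<^sup>2 - [:e:] * V\<^sup>2" using D by simp
  have VQ: "V * Q = z\<^sup>2 - [:e:] * p * y\<^sup>2 - [:c:] * V * m\<^sup>2"
  proof -
    have "V * (V * x\<^sup>2 + 2 * U * x * y + E * V * y\<^sup>2 - C * m\<^sup>2)
      = (V * x + U * y)\<^sup>2 - (U\<^sup>2 - E * V\<^sup>2) * y\<^sup>2 - C * V * m\<^sup>2" for E C
      by (simp add: power2_eq_square algebra_simps)
    then show ?thesis unfolding D' z_def Q_def .
  qed
  have "V * Q = (z - \<rho> * m) * (z + \<rho> * m) + (\<rho>\<^sup>2 - [:c:] * V) * m\<^sup>2 - p * ([:e:] * y\<^sup>2)"
  proof -
    have "z\<^sup>2 - E * p * y\<^sup>2 - C * V * m\<^sup>2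
      = (z - \<rho> * m) * (z + \<rho> * m) + (\<rho>\<^sup>2 - C * V) * m\<^sup>2 - p * (E * y\<^sup>2)" for E C
      by (simp add: power2_eq_square algebra_simps)
    then show ?thesis unfolding VQ .
  qed
  moreover have "p dvd \<rho>\<^sup>2 - [:c:] * V" using rho by simp
  ultimately have "p dvd V * Q" using zdv by (metis dvd_add dvd_diff dvd_mult2 dvd_triv_left)
  moreover have "\<not> p dvd V" using dvd_imp_degree_le[of p V] V0 dV degree_pos by auto
  ultimately have "p dvd Q" using irreducible_poly_dvd_mult[OF irr] by blast
  then obtain h where h: "Q = p * h" by (auto elim: dvdE)
  have dx: "deg x \<le> n" using xb unfolding polys_below_degree by auto
  have y': "y = 0 \<or> deg y < n" using yb unfolding polys_below_degree by auto
  have m': "m = 0 \<or> deg m < 2 * n" using mb unfolding polys_below_degree by auto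
  have dV': "deg V = 2 * n" and dU': "deg U \<le> 2 * n" using dV dU n by auto
  have low: "deg (2 * U * x * y + [:e:] * V * y\<^sup>2 - [:c:] * m\<^sup>2) < 4 * n"
  proof -
    have "deg (2 * U * x * y) < 4 * n"
    proof (cases "y = 0")
      case False
      have "deg (2 * U * x * y) = deg ([:2:] * (U * (x * y)))"
        by (simp add: numeral_poly mult.assoc)
      also have "\<dots> \<le> deg (U * (x * y))" by (simp add: degree_smult_le)
      also have "\<dots> \<le> deg U + (deg x + deg y)"
        by (meson add_left_mono degree_mult_le order.trans)
      finally show ?thesis using dU' dx y' False by linarith
    qed (use npos in simp)
    moreover have "deg ([:e:] * V * y\<^sup>2) < 4 * n"
    proof (cases "y = 0")
      case False
      then show ?thesis using e0 V0 dV' y' by (simp add: degree_mult_eq degree_power_eq)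
    qed (use npos in simp)
    moreover have "deg ([:c:] * m\<^sup>2) < 4 * n"
    proof (cases "m = 0")
      case False
      then show ?thesis using c0 m' by (simp add: degree_power_eq)
    qed (use npos in simp)
    ultimately show ?thesis by (intro degree_diff_less degree_add_less)
  qed
  define \<xi> where "\<xi> = coeff x n"
  have top: "coeff (V * x\<^sup>2) (4 * n) = l * \<xi>\<^sup>2"
  proof (cases "deg x = n \<and> x \<noteq> 0")
    case True
    then have "deg (V * x\<^sup>2) = 4 * n" using V0 dV' by (simp add: degree_mult_eq degree_power_eq)
    then show ?thesis using lead_coeff_mult[of V "x\<^sup>2"] lead_coeff_power[of x 2] True unfolding l_def \<xi>_def by simp
  next
    case False
    then have "\<xi> = 0" unfolding \<xi>_def using dx by (auto intro: coeff_eq_0)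
    moreover have "coeff (V * x\<^sup>2) (4 * n) = 0"
      using False dx V0 dV' npos by (cases "x = 0") (auto intro!: coeff_eq_0 simp: degree_mult_eq degree_power_eq)
    ultimately show ?thesis by simp
  qed
  have Qsplit: "Q = V * x\<^sup>2 + (2 * U * x * y + [:e:] * V * y\<^sup>2 - [:c:] * m\<^sup>2)" unfolding Q_def by simp
  have Qtop: "coeff Q (4 * n) = l * \<xi>\<^sup>2"
    unfolding Qsplit using top coeff_eq_0[OF low] by simp
  have "deg (V * x\<^sup>2) \<le> 4 * n"
    using degree_mult_le[of V "x\<^sup>2"] dx dV' by (cases "x = 0") (auto simp: degree_power_eq)
  then have dQ: "deg Q \<le> d" unfolding Qsplit n using low by (intro degree_add_le) auto
  have "deg h = 0"
  proof (cases "h = 0")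
    case False
    then have "deg Q = d + deg h" unfolding h using irr by (intro degree_mult_eq) auto
    then show ?thesis using dQ by simp
  qed simp
  then obtain k where k: "h = [:k:]" using degree_eq_zeroE by blast
  have kl: "k = l * \<xi>\<^sup>2" using Qtop monic unfolding h k n[symmetric] by simp
  define w where "w = [:\<xi> / e:]"
  \<comment> \<open>this identity dictates the choice of \<open>c\<close>\<close>
  have key: "[:k:] * p = - ([:c:] * ([:e:] * p * w\<^sup>2))"
  proof -
    have "- ([:c:] * ([:e:] * p * w\<^sup>2)) = [:- (c * e * (\<xi> / e)\<^sup>2):] * p"
      unfolding w_def by (simp add: power2_eq_square mult_ac)
    moreover have "- (c * e * (\<xi> / e)\<^sup>2) = k" unfolding c_def kl using e0 by (simp add: power2_eq_square)
    ultimately show ?thesis by simp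
  qed
  have "z\<^sup>2 - [:e:] * p * y\<^sup>2 = V * Q + [:c:] * V * m\<^sup>2" unfolding VQ by simp
  also have "V * Q = V * ([:k:] * p)" unfolding h k by (simp add: mult.commute)
  also have "V * ([:k:] * p) + [:c:] * V * m\<^sup>2 = [:c:] * V * (m\<^sup>2 - [:e:] * p * w\<^sup>2)"
  proof -
    have "V * - (C * (E * p * w\<^sup>2)) + C * V * m\<^sup>2 = C * V * (m\<^sup>2 - E * p * w\<^sup>2)" for C E
      by (simp add: algebra_simps)
    then show ?thesis unfolding key .
  qed
  finally have eq: "z\<^sup>2 - smult e p * y\<^sup>2 = smult c V * (m\<^sup>2 - smult e p * w\<^sup>2)"
    by simp
  have ns': "\<nexists>x. x ^ 2 = lead_coeff (smult e p)" using ns monic e0 by simp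
  have "m \<noteq> 0 \<or> w \<noteq> 0"
  proof (rule ccontr)
    assume mw: "\<not> ?thesis"
    then have "z = 0 \<and> y = 0" using eq norm_form_anisotropic[OF ns', of z y] by simp
    then show False using mw nz V0 unfolding z_def by auto
  qed
  then show ?thesis using eq c0 by blast
qed

end

end

section \<open>The quadratic field, its conjugation and its ring of integers\<close>

text \<open>
  The field \<open>'k\<close> only has to contain the polynomials and a square root \<open>s\<close> of \<open>e p\<close>; fractions are formed
  inside it.
\<close>
locale imaginary_quadratic =
  fixes emb :: "'a::finite_field poly \<Rightarrow> 'k::field" and e :: 'a and p :: "'a poly" and s :: 'k
  assumes emb_add: "\<And>f g. emb (f + g) = emb f + emb g"
    and emb_mult: "\<And>f g. emb (f * g) = emb f * emb g"
    and emb_1 [simp]: "emb 1 = 1"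
    and emb_eq_0_iff [simp]: "\<And>f. emb f = 0 \<longleftrightarrow> f = 0"
    and odd_card: "odd CARD('a)"
    and nonsquare: "\<nexists>x. x ^ 2 = e"
    and monic: "lead_coeff p = 1"
    and irr: "irreducible p"
    and s_sq: "s ^ 2 = emb (smult e p)"
begin

abbreviation D :: "'a poly" where "D \<equiv> smult e p"
abbreviation d :: nat where "d \<equiv> deg p"

lemma e_nonzero: "e \<noteq> 0"
  using nonsquare by (metis zero_power2)

lemma nonsquare_lead: "\<nexists>x. x ^ 2 = lead_coeff D"
  using nonsquare monic e_nonzero by simp

lemma degree_D: "deg D = d"
  using e_nonzero by simp

lemma d_pos: "d > 0"
  using irr is_unit_iff_degree[of p] unfolding Factorial_Ring.irreducible_def by auto

lemma two_nonzero: "(2 :: 'a) \<noteq> 0"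
  by (rule odd_CARD_imp_two_nonzero[OF odd_card])

lemma emb_0 [simp]: "emb 0 = 0" by simp

lemma emb_minus: "emb (- f) = - emb f"
  using emb_add[of f "- f"] by (simp add: eq_neg_iff_add_eq_0 add.commute)

lemma emb_diff: "emb (f - g) = emb f - emb g"
  using emb_add[of f "- g"] by (simp add: emb_minus)

lemma emb_power: "emb (f ^ n) = emb f ^ n"
  by (induction n) (simp_all add: emb_mult)

lemma emb_eq_iff [simp]: "emb f = emb g \<longleftrightarrow> f = g"
  using emb_eq_0_iff[of "f - g"] by (simp add: emb_diff)

definition el :: "'a poly \<Rightarrow> 'a poly \<Rightarrow> 'k" where "el a b = emb a + emb b * s"

definition A :: "'k set" where "A = range emb"
definition F :: "'k set" where "F = {emb a / emb c | a c. c \<noteq> 0}"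
definition R :: "'k set" where "R = {el a b | a b. True}"
definition K :: "'k set" where "K = {el a b / emb c | a b c. c \<noteq> 0}"

lemma s_s: "s * s = emb D" using s_sq by (simp add: power2_eq_square)

lemma el_add: "el a b + el a' b' = el (a + a') (b + b')"
  unfolding el_def by (simp add: emb_add algebra_simps)

lemma el_minus: "- el a b = el (- a) (- b)"
  unfolding el_def by (simp add: emb_minus)

lemma el_mult: "el a b * el a' b' = el (a * a' + D * (b * b')) (a * b' + b * a')"
proof -
  have "el a b * el a' b' = emb a * emb a' + (emb b * emb b') * (s * s) + (emb a * emb b' + emb b * emb a') * s"
    unfolding el_def by (simp add: algebra_simps)
  then show ?thesis unfolding s_s el_def emb_add emb_mult by (simp add: mult_ac)
qed

lemma emb_el: "emb c * el a b = el (c * a) (c * b)"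
  unfolding el_def by (simp add: emb_mult algebra_simps)

lemma el_0_right [simp]: "el a 0 = emb a" unfolding el_def by simp

lemma el_0_1: "el 0 1 = s" unfolding el_def by simp

lemma el_conj: "el a b * el a (- b) = emb (a\<^sup>2 - D * b\<^sup>2)"
  unfolding el_mult by (simp add: power2_eq_square algebra_simps)

lemma norm_zero: "a\<^sup>2 - D * b\<^sup>2 = 0 \<longleftrightarrow> a = 0 \<and> b = 0"
  using norm_form_anisotropic[OF nonsquare_lead, of a b] by auto

lemma el_eq_0_iff [simp]: "el a b = 0 \<longleftrightarrow> a = 0 \<and> b = 0"
proof
  assume "el a b = 0"
  then have "emb (a\<^sup>2 - D * b\<^sup>2) = 0" unfolding el_conj[symmetric] by simp
  then show "a = 0 \<and> b = 0" unfolding emb_eq_0_iff norm_zero .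
qed simp

lemma el_eq_iff: "el a b = el a' b' \<longleftrightarrow> a = a' \<and> b = b'"
proof -
  have "el a b - el a' b' = el (a - a') (b - b')"
    by (simp only: diff_conv_add_uminus el_minus el_add)
  then show ?thesis using el_eq_0_iff[of "a - a'" "b - b'"] by (metis diff_0_right eq_iff_diff_eq_0)
qed

lemma emb_in_A [simp]: "emb f \<in> A" unfolding A_def by simp

lemma A_subset_R: "A \<subseteq> R"
proof
  fix x assume "x \<in> A"
  then obtain a where "x = el a 0" unfolding A_def by auto
  then show "x \<in> R" unfolding R_def by blast
qed

lemma frac_1: "el a b = el a b / emb 1" "emb a = emb a / emb 1" by simp_all

lemma A_subset_F: "A \<subseteq> F"
  unfolding A_def F_def using frac_1(2) one_neq_zero by blast

lemma R_subset_K: "R \<subseteq> K"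
  unfolding R_def K_def using frac_1(1) one_neq_zero by blast

lemma F_subset_K: "F \<subseteq> K"
proof
  fix x assume "x \<in> F"
  then obtain a c where "c \<noteq> 0" "x = el a 0 / emb c" unfolding F_def by auto
  then show "x \<in> K" unfolding K_def by blast
qed

lemma emb_in_F [simp]: "emb f \<in> F" using A_subset_F by auto
lemma emb_in_R [simp]: "emb f \<in> R" using A_subset_R by auto
lemma emb_in_K [simp]: "emb f \<in> K" using F_subset_K by auto
lemma el_in_R [simp]: "el a b \<in> R" unfolding R_def by blast
lemma el_in_K [simp]: "el a b \<in> K" using R_subset_K by auto
lemma s_in_R [simp]: "s \<in> R" using el_in_R[of 0 1] unfolding el_0_1 .
lemma s_in_K [simp]: "s \<in> K" using R_subset_K by auto
lemma R_0 [simp]: "0 \<in> R" using emb_in_R[of 0] by simp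
lemma R_1 [simp]: "1 \<in> R" using emb_in_R[of 1] by simp
lemma K_1 [simp]: "1 \<in> K" using emb_in_K[of 1] by simp
lemma F_1 [simp]: "1 \<in> F" using emb_in_F[of 1] by simp
lemma s_nonzero [simp]: "s \<noteq> 0" using el_eq_0_iff[of 0 1] unfolding el_0_1 by simp

lemma K_cases: assumes "z \<in> K" obtains a b c where "c \<noteq> 0" "z = el a b / emb c"
  using assms unfolding K_def by blast

lemma F_cases: assumes "z \<in> F" obtains a c where "c \<noteq> 0" "z = emb a / emb c"
  using assms unfolding F_def by blast

lemma R_add [simp]: "x \<in> R \<Longrightarrow> y \<in> R \<Longrightarrow> x + y \<in> R"
  unfolding R_def using el_add by blast
lemma R_mult [simp]: "x \<in> R \<Longrightarrow> y \<in> R \<Longrightarrow> x * y \<in> R"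
  unfolding R_def using el_mult by blast
lemma R_minus [simp]: "x \<in> R \<Longrightarrow> - x \<in> R"
  unfolding R_def using el_minus by blast

lemma frac_add: "c \<noteq> 0 \<Longrightarrow> c' \<noteq> 0 \<Longrightarrow>
  el a b / emb c + el a' b' / emb c' = el (c' * a + c * a') (c' * b + c * b') / emb (c * c')"
proof -
  assume "c \<noteq> 0" "c' \<noteq> 0"
  then have "el a b / emb c + el a' b' / emb c' = (emb c' * el a b + emb c * el a' b') / (emb c * emb c')"
    by (simp add: add_frac_eq mult.commute)
  then show ?thesis by (simp only: emb_el el_add emb_mult)
qed

lemma frac_mult: "(el a b / emb c) * (el a' b' / emb c') =
  el (a * a' + D * (b * b')) (a * b' + b * a') / emb (c * c')"
  by (simp only: times_divide_times_eq el_mult emb_mult)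

lemma K_add [simp]: "x \<in> K \<Longrightarrow> y \<in> K \<Longrightarrow> x + y \<in> K"
proof -
  assume "x \<in> K" "y \<in> K"
  then obtain a b c a' b' c' where "c \<noteq> 0" "x = el a b / emb c" "c' \<noteq> 0" "y = el a' b' / emb c'"
    by (metis K_cases)
  then show ?thesis using frac_add[of c c' a b a' b'] unfolding K_def by fastforce
qed

lemma K_mult [simp]: "x \<in> K \<Longrightarrow> y \<in> K \<Longrightarrow> x * y \<in> K"
proof -
  assume "x \<in> K" "y \<in> K"
  then obtain a b c a' b' c' where "c \<noteq> 0" "x = el a b / emb c" "c' \<noteq> 0" "y = el a' b' / emb c'"
    by (metis K_cases)
  then show ?thesis using frac_mult[of a b c a' b' c'] unfolding K_def by fastforce
qed

lemma K_minus [simp]: "x \<in> K \<Longrightarrow> - x \<in> K"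
  using K_mult[OF emb_in_K[of "-1"], of x] by (simp add: emb_minus)

lemma K_diff [simp]: "x \<in> K \<Longrightarrow> y \<in> K \<Longrightarrow> x - y \<in> K"
  using K_add[of x "- y"] by simp

lemma K_inverse [simp]: "x \<in> K \<Longrightarrow> inverse x \<in> K"
proof (cases "x = 0")
  case False
  assume "x \<in> K"
  then obtain a b c where x: "c \<noteq> 0" "x = el a b / emb c" by (rule K_cases)
  then have ab: "el a b \<noteq> 0" "a\<^sup>2 - D * b\<^sup>2 \<noteq> 0" using False norm_zero by auto
  then have "el a (- b) \<noteq> 0" by simp
  then have "inverse x = emb c * el a (- b) / emb (a\<^sup>2 - D * b\<^sup>2)"
    unfolding el_conj[symmetric] x(2) using ab x(1) by (simp add: field_simps)
  also have "\<dots> = el (c * a) (c * (- b)) / emb (a\<^sup>2 - D * b\<^sup>2)" by (simp only: emb_el)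
  finally show ?thesis unfolding K_def using ab(2) by blast
qed simp

lemma K_divide [simp]: "x \<in> K \<Longrightarrow> y \<in> K \<Longrightarrow> x / y \<in> K"
  by (simp add: divide_inverse)

lemma F_mult [simp]: "x \<in> F \<Longrightarrow> y \<in> F \<Longrightarrow> x * y \<in> F"
proof -
  assume "x \<in> F" "y \<in> F"
  then obtain a c a' c' where "c \<noteq> 0" "x = emb a / emb c" "c' \<noteq> 0" "y = emb a' / emb c'"
    by (metis F_cases)
  then have "x * y = emb (a * a') / emb (c * c')" "c * c' \<noteq> 0" by (simp_all add: emb_mult)
  then show ?thesis unfolding F_def by blast
qed

lemma F_add [simp]: "x \<in> F \<Longrightarrow> y \<in> F \<Longrightarrow> x + y \<in> F"
proof -
  assume "x \<in> F" "y \<in> F"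
  then obtain a c a' c' where "c \<noteq> 0" "x = emb a / emb c" "c' \<noteq> 0" "y = emb a' / emb c'"
    by (metis F_cases)
  then have "x + y = emb (a * c' + a' * c) / emb (c * c')" "c * c' \<noteq> 0"
    by (simp_all add: emb_mult emb_add add_frac_eq)
  then show ?thesis unfolding F_def by blast
qed

lemma F_minus [simp]: "x \<in> F \<Longrightarrow> - x \<in> F"
  using F_mult[OF emb_in_F[of "-1"], of x] by (simp add: emb_minus)

lemma F_inverse [simp]: "x \<in> F \<Longrightarrow> inverse x \<in> F"
proof (cases "x = 0")
  case False
  assume "x \<in> F"
  then obtain a c where "c \<noteq> 0" "x = emb a / emb c" by (rule F_cases)
  then have "inverse x = emb c / emb a" "a \<noteq> 0" using False by auto
  then show ?thesis unfolding F_def by blast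
qed simp

lemma F_divide [simp]: "x \<in> F \<Longrightarrow> y \<in> F \<Longrightarrow> x / y \<in> F"
  by (simp add: divide_inverse)

lemma R_inter_F: "x \<in> R \<Longrightarrow> x \<in> F \<Longrightarrow> x \<in> A"
proof -
  assume "x \<in> R" "x \<in> F"
  then obtain a b f c where x: "x = el a b" "c \<noteq> 0" "x = emb f / emb c" unfolding R_def F_def by blast
  then have "el a b = emb f / emb c" by simp
  then have "emb c * el a b = emb f" using x(2) by (simp only: times_divide_eq_right) simp
  then have "el (c * a) (c * b) = el f 0" by (simp add: emb_el)
  then have "b = 0" using x(2) by (simp add: el_eq_iff del: el_0_right)
  then show ?thesis using x(1) by simp
qed

text \<open>
  Conjugation of \<open>K\<close> over \<open>F\<close>, well defined because the coordinates with respect to \<open>1\<close> and \<open>s\<close> are unique;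
  outside \<open>K\<close> it is unspecified.
\<close>
definition conj :: "'k \<Rightarrow> 'k" where
  "conj z = (THE w. \<exists>a b c. c \<noteq> 0 \<and> z = el a b / emb c \<and> w = el a (- b) / emb c)"

lemma conj_frac:
  assumes c: "c \<noteq> 0"
  shows "conj (el a b / emb c) = el a (- b) / emb c"
  unfolding conj_def
proof (rule the_equality)
  show "\<exists>a' b' c'. c' \<noteq> 0 \<and> el a b / emb c = el a' b' / emb c' \<and> el a (- b) / emb c = el a' (- b') / emb c'"
    using c by blast
next
  fix w assume "\<exists>a' b' c'. c' \<noteq> 0 \<and> el a b / emb c = el a' b' / emb c' \<and> w = el a' (- b') / emb c'"
  then obtain a' b' c' where w: "c' \<noteq> 0" "el a b / emb c = el a' b' / emb c'" "w = el a' (- b') / emb c'" by blast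
  then have "emb c' * el a b = emb c * el a' b'" using c by (simp add: field_simps)
  then have "c' * a = c * a'" "c' * b = c * b'" by (simp_all add: emb_el el_eq_iff)
  then have "emb c' * el a (- b) = emb c * el a' (- b')" unfolding emb_el by simp
  then show "w = el a (- b) / emb c" unfolding w(3) using w(1) c by (simp add: frac_eq_eq mult.commute)
qed

lemma conj_el [simp]: "conj (el a b) = el a (- b)"
  using conj_frac[of 1 a b] by simp

lemma conj_in_K [simp]: "z \<in> K \<Longrightarrow> conj z \<in> K"
  by (erule K_cases) (auto simp: conj_frac)

lemma conj_conj [simp]: "z \<in> K \<Longrightarrow> conj (conj z) = z"
  by (erule K_cases) (auto simp: conj_frac)

lemma conj_add: "x \<in> K \<Longrightarrow> y \<in> K \<Longrightarrow> conj (x + y) = conj x + conj y"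
proof -
  assume "x \<in> K" "y \<in> K"
  then obtain a b c a' b' c' where *: "c \<noteq> 0" "x = el a b / emb c" "c' \<noteq> 0" "y = el a' b' / emb c'"
    by (metis K_cases)
  then have "c * c' \<noteq> 0" by simp
  then show ?thesis using * by (simp add: frac_add conj_frac)
qed

lemma conj_mult: "x \<in> K \<Longrightarrow> y \<in> K \<Longrightarrow> conj (x * y) = conj x * conj y"
proof -
  assume "x \<in> K" "y \<in> K"
  then obtain a b c a' b' c' where *: "c \<noteq> 0" "x = el a b / emb c" "c' \<noteq> 0" "y = el a' b' / emb c'"
    by (metis K_cases)
  then have "c * c' \<noteq> 0" by simp
  then show ?thesis unfolding *(2,4) frac_mult using * by (simp add: conj_frac frac_mult del: times_divide_eq_left times_divide_eq_right times_divide_times_eq)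
qed

lemma conj_F [simp]: "x \<in> F \<Longrightarrow> conj x = x"
  by (erule F_cases) (metis conj_frac el_0_right minus_zero)

lemma conj_R [simp]: "x \<in> R \<Longrightarrow> conj x \<in> R"
  unfolding R_def by (auto simp del: el_eq_0_iff) blast

lemma conj_eq_0_iff [simp]: "z \<in> K \<Longrightarrow> conj z = 0 \<longleftrightarrow> z = 0"
  by (metis conj_conj conj_F emb_0 emb_in_F)

lemma conj_inverse: "z \<in> K \<Longrightarrow> conj (inverse z) = inverse (conj z)"
proof (cases "z = 0")
  case False
  assume z: "z \<in> K"
  have "conj (z * inverse z) = conj z * conj (inverse z)" using z by (intro conj_mult) auto
  then show ?thesis using z False by (simp add: conj_F[OF F_1] inverse_unique)
qed (simp add: conj_F[OF emb_in_F[of 0, simplified]])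

lemma conj_divide: "x \<in> K \<Longrightarrow> y \<in> K \<Longrightarrow> conj (x / y) = conj x / conj y"
  by (simp add: divide_inverse conj_mult conj_inverse)

lemma conj_s [simp]: "conj s = - s"
  using conj_el[of 0 1] el_minus[of 0 1] unfolding el_0_1 by simp

lemma conj_fixed_imp_F: "z \<in> K \<Longrightarrow> conj z = z \<Longrightarrow> z \<in> F"
proof -
  assume "z \<in> K" "conj z = z"
  then obtain a b c where *: "c \<noteq> 0" "z = el a b / emb c" "el a (- b) / emb c = el a b / emb c"
    by (metis K_cases conj_frac)
  then have "- b = b" by (simp add: el_eq_iff)
  then have "2 * b = 0" by (metis add.right_inverse mult_2)
  then have "smult 2 b = 0" by (simp add: numeral_poly)
  then have "b = 0" using two_nonzero by simp
  then show ?thesis using * by auto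
qed

lemma norm_in_F: "z \<in> K \<Longrightarrow> z * conj z \<in> F"
  by (rule conj_fixed_imp_F) (simp_all add: conj_mult mult.commute)

lemma trace_in_F: "z \<in> K \<Longrightarrow> z + conj z \<in> F"
  by (rule conj_fixed_imp_F) (simp_all add: conj_add add.commute)

lemma norm_frac: "c \<noteq> 0 \<Longrightarrow> (el a b / emb c) * conj (el a b / emb c) = emb (a\<^sup>2 - D * b\<^sup>2) / emb (c\<^sup>2)"
  unfolding conj_frac using el_conj[of a b] by (simp add: emb_mult power2_eq_square)

text \<open>
  Write \<open>z = x + y s\<close>. The trace gives \<open>x \<in> A\<close> as \<open>2\<close> is a unit, and then the norm gives \<open>D y\<^sup>2 \<in> A\<close>.
  The denominator of \<open>y\<close> is a unit because \<open>D\<close> is squarefree.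
\<close>
lemma trace_norm_integral:
  assumes z: "z \<in> K" and tr: "z + conj z \<in> A" and nm: "z * conj z \<in> A"
  shows "z \<in> R"
proof -
  obtain a b c where c: "c \<noteq> 0" "z = el a b / emb c" using z by (rule K_cases)
  obtain t where t: "z + conj z = emb t" using tr unfolding A_def by auto
  obtain n where n: "z * conj z = emb n" using nm unfolding A_def by auto
  have "emb c * emb t = el a b + el a (- b)"
    unfolding t[symmetric] c(2) conj_frac[OF c(1)] using c(1) by (simp add: distrib_left)
  also have "\<dots> = emb (a + a)" by (simp add: el_add)
  finally have ct: "c * t = a + a" by (simp add: emb_mult[symmetric])
  define t' where "t' = smult (1 / 2) t"
  have "c * t' = smult (1 / 2) (smult 2 a)"
    unfolding t'_def using ct by (simp add: numeral_poly mult_2[symmetric] mult_2_right)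
  then have ac: "a = c * t'" using two_nonzero by simp
  have "emb (a\<^sup>2 - D * b\<^sup>2) = emb (c\<^sup>2 * n)"
    using n norm_frac[OF c(1), of a b] c by (simp add: emb_mult field_simps)
  then have "a\<^sup>2 - D * b\<^sup>2 = c\<^sup>2 * n" by (simp only: emb_eq_iff)
  then have Db: "D * b\<^sup>2 = c\<^sup>2 * (t'\<^sup>2 - n)" unfolding ac by (simp add: power_mult_distrib algebra_simps)
  obtain g b' c' u v where g: "g \<noteq> 0" "b = g * b'" "c = g * c'" "u * b' + v * c' = 1"
    using poly_lowest_terms[OF c(1), of b] by blast
  define m where "m = t'\<^sup>2 - n"
  have "g\<^sup>2 * (D * b'\<^sup>2) = g\<^sup>2 * (c'\<^sup>2 * m)"
    using Db unfolding g(2,3) m_def by (simp add: power_mult_distrib mult_ac)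
  then have Db': "D * b'\<^sup>2 = c'\<^sup>2 * m" using g(1) by (subst (asm) mult_left_cancel) simp_all
  have "D = D * (u * b' + v * c')\<^sup>2" using g(4) by simp
  also have "\<dots> = u\<^sup>2 * (D * b'\<^sup>2) + c' * (D * (2 * u * v * b' + v\<^sup>2 * c'))"
    by (simp add: power2_eq_square algebra_simps)
  also have "\<dots> = c' * (u\<^sup>2 * c' * m + D * (2 * u * v * b' + v\<^sup>2 * c'))"
    unfolding Db' by (simp add: power2_eq_square algebra_simps)
  finally have "c' dvd D" by (metis dvd_triv_left)
  then have "c' dvd p" using e_nonzero by (simp add: dvd_smult_iff)
  then obtain k where k: "p = c' * k" by (auto elim: dvdE)
  have "c' dvd 1"
  proof (rule ccontr)
    assume "\<not> c' dvd 1"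
    then have "k dvd 1" using irr k unfolding Factorial_Ring.irreducible_def by blast
    then have pc: "p dvd c'" using k by (metis dvd_mult_unit_iff dvd_refl mult.commute dvd_mult_unit_iff')
    then obtain r where r: "c' = p * r" by (auto elim: dvdE)
    have "p * ([:e:] * b'\<^sup>2) = p * (p * (r\<^sup>2 * m))" using Db' unfolding r by (simp add: power2_eq_square mult_ac)
    then have "[:e:] * b'\<^sup>2 = p * (r\<^sup>2 * m)" using irr by (subst (asm) mult_left_cancel) auto
    then have "p dvd smult e (b' * b')" by (simp add: power2_eq_square)
    then have "p dvd b' * b'" using e_nonzero by (simp add: dvd_smult_iff)
    then have "p dvd b'" using irreducible_poly_dvd_mult[OF irr] by blast
    then have "p dvd 1" using pc g(4) by (metis dvd_add dvd_mult)
    then show False using irr unfolding Factorial_Ring.irreducible_def by blast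
  qed
  then obtain w where w: "1 = c' * w" by (auto elim: dvdE)
  have "z = emb c * el t' (b' * w) / emb c"
  proof -
    have "c * (b' * w) = b * (c' * w)" unfolding g by (simp add: mult_ac)
    then have "c * (b' * w) = b" using w by simp
    then show ?thesis unfolding c(2) ac emb_el by simp
  qed
  then show ?thesis using c(1) by simp
qed

text \<open>
  The norm of a unit has degree zero, whereas the norm form has degree at least \<open>d\<close> once \<open>b \<noteq> 0\<close>.
\<close>
lemma R_unit_const:
  assumes "x \<in> R" "y \<in> R" "x * y = 1"
  shows "\<exists>c. c \<noteq> 0 \<and> x = emb [:c:]"
proof -
  obtain a b a' b' where ab: "x = el a b" "y = el a' b'" using assms(1,2) unfolding R_def by blast
  have "emb ((a\<^sup>2 - D * b\<^sup>2) * (a'\<^sup>2 - D * b'\<^sup>2)) = (x * y) * (conj x * conj y)"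
    unfolding emb_mult el_conj[symmetric] ab by (simp add: mult_ac)
  also have "conj x * conj y = conj (x * y)" using assms(1,2) R_subset_K by (intro conj_mult[symmetric]) auto
  finally have "emb ((a\<^sup>2 - D * b\<^sup>2) * (a'\<^sup>2 - D * b'\<^sup>2)) = emb 1" using assms(3) by simp
  then have "(a\<^sup>2 - D * b\<^sup>2) dvd 1" unfolding emb_eq_iff by (metis dvd_triv_left)
  then have deg: "deg (a\<^sup>2 - D * b\<^sup>2) = 0"
    by (metis is_unit_iff_degree dvd_0_left_iff one_neq_zero)
  have b: "b = 0"
    using norm_form_degree(2)[OF nonsquare_lead, of b a] deg d_pos degree_D by (cases "b = 0") auto
  then have "deg a = 0" using deg by (cases "a = 0") (simp_all add: degree_power_eq)
  then obtain c where "a = [:c:]" using degree_eq_zeroE by blast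
  then show ?thesis using assms(3) ab b by (intro exI[of _ c]) auto
qed

end

section \<open>Products of subsets of a field\<close>

abbreviation iprod :: "'k::field set \<Rightarrow> 'k set \<Rightarrow> 'k set" where
  "iprod \<equiv> ideal_prod ring_of_type_algebra"

definition scale :: "'k::field \<Rightarrow> 'k set \<Rightarrow> 'k set" where
  "scale x I = (\<lambda>r. r * x) ` I"

lemma iprod_memI: "i \<in> I \<Longrightarrow> j \<in> J \<Longrightarrow> i * j \<in> iprod I J"
  using ideal_prod.prod[of i I j J ring_of_type_algebra] by (simp add: ring_of_type_algebra_def)

lemma iprod_add: "x \<in> iprod I J \<Longrightarrow> y \<in> iprod I J \<Longrightarrow> x + y \<in> iprod I J"
  using ideal_prod.sum[of x ring_of_type_algebra I J y] by (simp add: ring_of_type_algebra_def)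

lemma iprod_least:
  assumes "\<And>i j. i \<in> I \<Longrightarrow> j \<in> J \<Longrightarrow> i * j \<in> M" "\<And>x y. x \<in> M \<Longrightarrow> y \<in> M \<Longrightarrow> x + y \<in> M"
  shows "iprod I J \<subseteq> M"
proof
  fix x assume "x \<in> iprod I J"
  then show "x \<in> M"
    by induction (use assms in \<open>auto simp: ring_of_type_algebra_def\<close>)
qed

lemma iprod_comm: "iprod I J = iprod J I"
proof -
  have "iprod I J \<subseteq> iprod J I" for I J :: "'k::field set"
    by (rule iprod_least) (auto simp: iprod_add mult.commute intro: iprod_memI[of _ J _ I, THEN back_subst[of "\<lambda>x. x \<in> iprod J I"]])
  then show ?thesis by blast
qed

lemma iprod_assoc: "iprod (iprod I J) L = iprod I (iprod J L)"
proof -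
  have sub: "iprod (iprod I J) L \<subseteq> iprod I (iprod J L)" for I J L :: "'k::field set"
  proof (rule iprod_least)
    fix z l assume z: "z \<in> iprod I J" and l: "l \<in> L"
    have "iprod I J \<subseteq> {z. z * l \<in> iprod I (iprod J L)}"
      by (rule iprod_least) (auto simp: l iprod_memI iprod_add mult.assoc distrib_right)
    then show "z * l \<in> iprod I (iprod J L)" using z by blast
  qed (rule iprod_add)
  have "iprod I (iprod J L) = iprod (iprod L J) I" by (simp add: iprod_comm)
  also have "\<dots> \<subseteq> iprod L (iprod J I)" by (rule sub)
  also have "\<dots> = iprod (iprod I J) L" by (simp add: iprod_comm)
  finally show ?thesis using sub by blast
qed

text \<open>
  Applied to \<open>I J\<close> and its conjugate, this makes the ideal norm multiplicative.
\<close>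
lemma iprod_swap: "iprod (iprod I J) (iprod L M) = iprod (iprod I L) (iprod J M)"
  by (metis iprod_assoc iprod_comm)

lemma iprod_scale: "iprod (scale x I) J = scale x (iprod I J)"
proof
  show "iprod (scale x I) J \<subseteq> scale x (iprod I J)"
  proof (rule iprod_least)
    fix i j assume "i \<in> scale x I" "j \<in> J"
    then obtain k where "k \<in> I" "i = k * x" unfolding scale_def by auto
    then show "i * j \<in> scale x (iprod I J)" using iprod_memI[of k I j J] \<open>j \<in> J\<close>
      unfolding scale_def by (auto intro!: image_eqI[of _ _ "k * j"])
  next
    fix a b assume "a \<in> scale x (iprod I J)" "b \<in> scale x (iprod I J)"
    then obtain a' b' where "a' \<in> iprod I J" "b' \<in> iprod I J" "a = a' * x" "b = b' * x" unfolding scale_def by auto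
    then show "a + b \<in> scale x (iprod I J)" using iprod_add[of a' I J b']
      unfolding scale_def by (auto intro!: image_eqI[of _ _ "a' + b'"] simp: distrib_right)
  qed
  have "iprod I J \<subseteq> {y. y * x \<in> iprod (scale x I) J}"
  proof (rule iprod_least)
    fix i j assume ij: "i \<in> I" "j \<in> J"
    then have "i * x \<in> scale x I" unfolding scale_def by auto
    from iprod_memI[OF this ij(2)] show "i * j \<in> {y. y * x \<in> iprod (scale x I) J}" by (simp add: mult_ac)
  qed (auto simp: distrib_right iprod_add)
  then show "scale x (iprod I J) \<subseteq> iprod (scale x I) J" unfolding scale_def by auto
qed

lemma iprod_scale_right: "iprod I (scale x J) = scale x (iprod I J)"
  using iprod_scale[of x J I] by (simp add: iprod_comm)

lemma scale_scale: "scale x (scale y I) = scale (x * y) I"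
  unfolding scale_def by (auto simp: image_image mult_ac)

lemma scale_1 [simp]: "scale 1 I = I" unfolding scale_def by simp

lemma mem_scale: "x \<noteq> 0 \<Longrightarrow> y \<in> scale x I \<longleftrightarrow> y / x \<in> I"
  unfolding scale_def by (auto simp: image_iff field_simps) (metis nonzero_mult_div_cancel_right times_divide_eq_left)

section \<open>Fractional ideals and their norms\<close>

context imaginary_quadratic
begin

abbreviation "FI \<equiv> fractional_ideals R"

lemma field_of_fractions_R: "field_of_fractions R = K"
proof
  show "field_of_fractions R \<subseteq> K" unfolding field_of_fractions_def using R_subset_K by (auto simp: subset_iff)
  show "K \<subseteq> field_of_fractions R"
  proof
    fix z assume "z \<in> K"
    then obtain a b c where "c \<noteq> 0" "z = el a b / emb c" by (rule K_cases)
    then show "z \<in> field_of_fractions R" unfolding field_of_fractions_def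
      by (intro CollectI exI[of _ "el a b"] exI[of _ "emb c"]) simp
  qed
qed

lemma R_in_K [simp]: "x \<in> R \<Longrightarrow> x \<in> K" using R_subset_K by blast
lemma F_in_K [simp]: "x \<in> F \<Longrightarrow> x \<in> K" using F_subset_K by blast

lemma norm_R: "x \<in> R \<Longrightarrow> \<exists>c. x * conj x = emb c \<and> (x \<noteq> 0 \<longrightarrow> c \<noteq> 0)"
proof -
  assume "x \<in> R"
  then obtain a b where x: "x = el a b" unfolding R_def by blast
  then have "x * conj x = emb (a\<^sup>2 - D * b\<^sup>2)" using el_conj by simp
  then show ?thesis using norm_zero x by (intro exI[of _ "a\<^sup>2 - D * b\<^sup>2"]) auto
qed

lemma FI_D:
  assumes "I \<in> FI"
  shows "I \<subseteq> K" "0 \<in> I" "\<exists>x\<in>I. x \<noteq> 0" "\<And>x y. x \<in> I \<Longrightarrow> y \<in> I \<Longrightarrow> x + y \<in> I"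
    "\<And>r x. r \<in> R \<Longrightarrow> x \<in> I \<Longrightarrow> r * x \<in> I" "\<exists>c. c \<noteq> 0 \<and> (\<forall>x\<in>I. emb c * x \<in> R)"
    "\<And>x. x \<in> I \<Longrightarrow> - x \<in> I"
proof -
  show "I \<subseteq> K" "0 \<in> I" "\<exists>x\<in>I. x \<noteq> 0" and add: "\<And>x y. x \<in> I \<Longrightarrow> y \<in> I \<Longrightarrow> x + y \<in> I"
    and r: "\<And>r x. r \<in> R \<Longrightarrow> x \<in> I \<Longrightarrow> r * x \<in> I"
    using assms unfolding fractional_ideals_def field_of_fractions_R by blast+
  obtain c where c: "c \<in> R" "c \<noteq> 0" "\<forall>x\<in>I. c * x \<in> R" using assms unfolding fractional_ideals_def by blast
  obtain n where n: "c * conj c = emb n" "n \<noteq> 0" using norm_R[OF c(1)] c(2) by blast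
  have "emb n * x \<in> R" if "x \<in> I" for x
    using c that unfolding n(1)[symmetric] by (metis R_mult conj_R mult.assoc mult.commute)
  then show "\<exists>c. c \<noteq> 0 \<and> (\<forall>x\<in>I. emb c * x \<in> R)" using n(2) by blast
  show "- x \<in> I" if "x \<in> I" for x using r[of "- 1" x] that by simp
qed

lemma FI_I:
  assumes "I \<subseteq> K" "x \<in> I" "x \<noteq> 0" "\<And>x y. x \<in> I \<Longrightarrow> y \<in> I \<Longrightarrow> x + y \<in> I"
    "\<And>r x. r \<in> R \<Longrightarrow> x \<in> I \<Longrightarrow> r * x \<in> I" "c \<noteq> 0" "\<And>x. x \<in> I \<Longrightarrow> emb c * x \<in> R"
  shows "I \<in> FI"
proof -
  have "0 \<in> I" using assms(5)[of 0 x] assms(2) by simp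
  moreover have "\<exists>d\<in>R. d \<noteq> 0 \<and> (\<forall>x\<in>I. d * x \<in> R)"
    using assms(6,7) by (intro bexI[of _ "emb c"]) auto
  ultimately show ?thesis
    unfolding fractional_ideals_def field_of_fractions_R using assms(1-5) by blast
qed

lemma FI_R [simp]: "R \<in> FI"
  by (rule FI_I[of R 1 1]) auto

lemma FI_scale:
  assumes I: "I \<in> FI" and x: "x \<in> K" "x \<noteq> 0"
  shows "scale x I \<in> FI"
proof -
  obtain a b g where g: "g \<noteq> 0" "x = el a b / emb g" using x(1) by (rule K_cases)
  obtain c where c: "c \<noteq> 0" "\<And>y. y \<in> I \<Longrightarrow> emb c * y \<in> R" using FI_D(6)[OF I] by blast
  obtain y where y: "y \<in> I" "y \<noteq> 0" using FI_D(3)[OF I] by blast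
  show ?thesis
  proof (rule FI_I[where x = "y * x" and c = "g * c"])
    show "scale x I \<subseteq> K" using FI_D(1)[OF I] x(1) unfolding scale_def by auto
    show "y * x \<in> scale x I" using y(1) unfolding scale_def by auto
    show "u + v \<in> scale x I" if "u \<in> scale x I" "v \<in> scale x I" for u v
      using that x(2) FI_D(4)[OF I] by (simp add: mem_scale add_divide_distrib)
    show "r * v \<in> scale x I" if "r \<in> R" "v \<in> scale x I" for r v
      using that x(2) FI_D(5)[OF I, of r "v / x"] by (simp add: mem_scale)
    show "emb (g * c) * v \<in> R" if "v \<in> scale x I" for v
    proof -
      obtain w where w: "w \<in> I" "v = w * x" using \<open>v \<in> scale x I\<close> unfolding scale_def by auto
      have "emb (g * c) * v = (emb c * w) * el a b" unfolding w(2) g(2) emb_mult using g(1) by simp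
      then show ?thesis using c(2)[OF w(1)] by simp
    qed
  qed (use y x g c in auto)
qed

lemma FI_iprod:
  assumes I: "I \<in> FI" and J: "J \<in> FI"
  shows "iprod I J \<in> FI"
proof -
  obtain c where c: "c \<noteq> 0" "\<And>y. y \<in> I \<Longrightarrow> emb c * y \<in> R" using FI_D(6)[OF I] by blast
  obtain g where g: "g \<noteq> 0" "\<And>y. y \<in> J \<Longrightarrow> emb g * y \<in> R" using FI_D(6)[OF J] by blast
  obtain x y where xy: "x \<in> I" "x \<noteq> 0" "y \<in> J" "y \<noteq> 0" using FI_D(3) I J by blast
  show ?thesis
  proof (rule FI_I[where x = "x * y" and c = "c * g"])
    show "iprod I J \<subseteq> K" by (rule iprod_least) (use FI_D(1)[OF I] FI_D(1)[OF J] in \<open>auto simp: subset_iff\<close>)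
    show "x * y \<in> iprod I J" using xy by (simp add: iprod_memI)
    show "r * v \<in> iprod I J" if r: "r \<in> R" and v: "v \<in> iprod I J" for r v
    proof -
      have "iprod I J \<subseteq> {v. r * v \<in> iprod I J}"
      proof (rule iprod_least)
        fix i j assume "i \<in> I" "j \<in> J"
        then have "(r * i) * j \<in> iprod I J" using FI_D(5)[OF I r] by (intro iprod_memI)
        then show "i * j \<in> {v. r * v \<in> iprod I J}" by (simp add: mult.assoc)
      qed (auto simp: distrib_left iprod_add)
      then show ?thesis using v by blast
    qed
    show "emb (c * g) * v \<in> R" if v: "v \<in> iprod I J" for v
    proof -
      have "iprod I J \<subseteq> {v. emb (c * g) * v \<in> R}"
      proof (rule iprod_least)
        fix i j assume "i \<in> I" "j \<in> J"
        then have "(emb c * i) * (emb g * j) \<in> R" using c g by simp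
        then show "i * j \<in> {v. emb (c * g) * v \<in> R}" by (simp add: emb_mult mult_ac)
      qed (auto simp: distrib_left)
      then show ?thesis using v by blast
    qed
  qed (use xy c g iprod_add in auto)
qed

lemma FI_conj:
  assumes I: "I \<in> FI"
  shows "conj ` I \<in> FI"
proof -
  obtain c where c: "c \<noteq> 0" "\<And>y. y \<in> I \<Longrightarrow> emb c * y \<in> R" using FI_D(6)[OF I] by blast
  obtain x where x: "x \<in> I" "x \<noteq> 0" using FI_D(3)[OF I] by blast
  have IK: "y \<in> K" if "y \<in> I" for y using that FI_D(1)[OF I] by blast
  show ?thesis
  proof (rule FI_I[where x = "conj x" and c = c])
    show "u + v \<in> conj ` I" if uv: "u \<in> conj ` I" "v \<in> conj ` I" for u v
    proof -
      obtain u' v' where "u' \<in> I" "v' \<in> I" "u = conj u'" "v = conj v'" using uv by auto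
      then show ?thesis using FI_D(4)[OF I] IK conj_add by (metis image_eqI)
    qed
    show "r * v \<in> conj ` I" if rv: "r \<in> R" "v \<in> conj ` I" for r v
    proof -
      obtain v' where v': "v' \<in> I" "v = conj v'" using rv by auto
      have "conj r * v' \<in> I" using FI_D(5)[OF I] rv(1) v'(1) by simp
      moreover have "conj (conj r * v') = r * v" using v' rv(1) IK by (simp add: conj_mult)
      ultimately show ?thesis by (metis image_eqI)
    qed
    show "emb c * v \<in> R" if vc: "v \<in> conj ` I" for v
    proof -
      obtain v' where v': "v' \<in> I" "v = conj v'" using vc by auto
      then have "emb c * v = conj (emb c * v')" using IK by (simp add: conj_mult)
      then show ?thesis using c(2)[OF v'(1)] by simp
    qed
  qed (use x c IK in auto)
qed

lemma iprod_R:
  assumes I: "I \<in> FI"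
  shows "iprod R I = I"
proof
  show "iprod R I \<subseteq> I" by (rule iprod_least) (use FI_D[OF I] in auto)
  show "I \<subseteq> iprod R I" using iprod_memI[of 1 R _ I] by auto
qed

lemma conj_iprod:
  assumes "I \<subseteq> K" "J \<subseteq> K"
  shows "conj ` iprod I J = iprod (conj ` I) (conj ` J)"
proof -
  have sub: "conj ` iprod I J \<subseteq> iprod (conj ` I) (conj ` J) \<and> iprod I J \<subseteq> K" if IJ: "I \<subseteq> K" "J \<subseteq> K" for I J
  proof -
    have "iprod I J \<subseteq> {z. z \<in> K \<and> conj z \<in> iprod (conj ` I) (conj ` J)}"
    proof (rule iprod_least)
      fix i j assume "i \<in> I" "j \<in> J"
      then show "i * j \<in> {z. z \<in> K \<and> conj z \<in> iprod (conj ` I) (conj ` J)}"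
        using IJ by (auto simp: conj_mult subset_iff intro!: iprod_memI)
    qed (auto simp: conj_add iprod_add)
    then show ?thesis by blast
  qed
  have cc: "conj ` conj ` I = I" if "I \<subseteq> K" for I using that by (force simp: image_iff)
  have ck: "conj ` I \<subseteq> K" "conj ` J \<subseteq> K" using assms by auto
  have "conj ` iprod (conj ` I) (conj ` J) \<subseteq> iprod I J"
    using sub[OF ck] cc assms by simp
  then have "conj ` conj ` iprod (conj ` I) (conj ` J) \<subseteq> conj ` iprod I J" by blast
  then have "iprod (conj ` I) (conj ` J) \<subseteq> conj ` iprod I J" using cc sub[OF ck] by metis
  then show ?thesis using sub[OF assms] by blast
qed

lemma conj_scale:
  assumes "I \<subseteq> K" "x \<in> K"
  shows "conj ` scale x I = scale (conj x) (conj ` I)"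
proof -
  have "conj ` scale x I = (\<lambda>r. conj (r * x)) ` I" unfolding scale_def by (simp add: image_image)
  also have "\<dots> = (\<lambda>r. conj r * conj x) ` I" using assms by (intro image_cong) (auto simp: conj_mult)
  also have "\<dots> = scale (conj x) (conj ` I)" unfolding scale_def by (simp add: image_image)
  finally show ?thesis .
qed

lemma conj_image_R [simp]: "conj ` R = R"
proof
  show "R \<subseteq> conj ` R"
  proof
    fix x assume "x \<in> R"
    then have "x = conj (conj x)" "conj x \<in> R" by simp_all
    then show "x \<in> conj ` R" by blast
  qed
qed auto

text \<open>
  After clearing the common denominator \<open>c\<close> this is principality of ideals of \<open>F\<^sub>q[T]\<close>.
\<close>
lemma F_submodule_principal:
  assumes M: "M \<subseteq> F" "0 \<in> M" "\<And>x y. x \<in> M \<Longrightarrow> y \<in> M \<Longrightarrow> x + y \<in> M"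
    "\<And>f x. x \<in> M \<Longrightarrow> emb f * x \<in> M" and c: "c \<noteq> 0" "\<And>x. x \<in> M \<Longrightarrow> emb c * x \<in> A"
  shows "\<exists>n\<in>M. \<forall>x\<in>M. \<exists>f. x = emb f * n"
proof -
  define U where "U = {f. emb f / emb c \<in> M}"
  have "\<exists>g\<in>U. \<forall>x\<in>U. g dvd x"
  proof (rule poly_ideal_principal)
    show "0 \<in> U" unfolding U_def using M(2) by simp
    show "x + y \<in> U" if "x \<in> U" "y \<in> U" for x y
      using M(3) that unfolding U_def by (simp add: emb_add add_divide_distrib)
    show "r * x \<in> U" if "x \<in> U" for r x
      using M(4)[of "emb x / emb c" r] that unfolding U_def by (simp add: emb_mult)
  qed
  then obtain g where g: "g \<in> U" "\<And>x. x \<in> U \<Longrightarrow> g dvd x" by blast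
  show ?thesis
  proof (intro bexI[of _ "emb g / emb c"] ballI)
    show "emb g / emb c \<in> M" using g(1) unfolding U_def by simp
    fix x assume x: "x \<in> M"
    then obtain h where h: "emb c * x = emb h" using c(2) unfolding A_def by blast
    then have xh: "x = emb h / emb c" using c(1) by (simp add: field_simps)
    then have "h \<in> U" using x unfolding U_def by simp
    then obtain k where "h = g * k" using g(2) by (auto elim: dvdE)
    then show "\<exists>f. x = emb f * (emb g / emb c)" unfolding xh by (intro exI[of _ k]) (simp add: emb_mult)
  qed
qed

text \<open>
  A suitable polynomial multiple of the norm of a nonzero element lies in the ideal.
\<close>
lemma FI_inter_F:
  assumes I: "I \<in> FI"
  shows "\<exists>x\<in>I. x \<in> F \<and> x \<noteq> 0"
proof -
  obtain x where x: "x \<in> I" "x \<noteq> 0" using FI_D(3)[OF I] by blast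
  have xK: "x \<in> K" using x FI_D(1)[OF I] by blast
  obtain c where c: "c \<noteq> 0" "\<And>y. y \<in> conj ` I \<Longrightarrow> emb c * y \<in> R" using FI_D(6)[OF FI_conj[OF I]] by blast
  have "(emb c * conj x) * x \<in> I" using c(2) x FI_D(5)[OF I] by blast
  moreover have "(emb c * conj x) * x = emb c * (x * conj x)" by (simp add: mult_ac)
  moreover have "emb c * (x * conj x) \<in> F" using norm_in_F[OF xK] by simp
  moreover have "emb c * (x * conj x) \<noteq> 0" using c(1) x(2) xK by simp
  ultimately show ?thesis by metis
qed

text \<open>
  The product \<open>P\<close> of \<open>I\<close> and its conjugate meets \<open>F\<close> in a principal \<open>A\<close>-module, generated by \<open>n\<close> say. For
  \<open>\<alpha>, \<beta> \<in> I\<close> the element \<open>\<alpha> \<beta>' / n\<close>, with \<open>\<beta>'\<close> the conjugate of \<open>\<beta>\<close>, has trace and norm in \<open>A\<close>, because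
  \<open>\<alpha> \<beta>' + \<beta> \<alpha>'\<close>, \<open>\<alpha> \<alpha>'\<close> and \<open>\<beta> \<beta>'\<close> all lie in \<open>P \<inter> F\<close>. So it is in \<open>R\<close>, and \<open>n\<close> generates \<open>P\<close>. Dividing the
  conjugate ideal by \<open>n\<close> yields the inverse of \<open>I\<close>.
\<close>
lemma ideal_norm:
  assumes I: "I \<in> FI"
  shows "\<exists>n\<in>F. n \<noteq> 0 \<and> iprod I (conj ` I) = scale n R"
proof -
  define P where "P = iprod I (conj ` I)"
  have P: "P \<in> FI" unfolding P_def using I FI_conj FI_iprod by blast
  obtain c where c: "c \<noteq> 0" "\<And>y. y \<in> P \<Longrightarrow> emb c * y \<in> R" using FI_D(6)[OF P] by blast
  have "\<exists>n\<in>P \<inter> F. \<forall>x\<in>P \<inter> F. \<exists>f. x = emb f * n"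
    by (rule F_submodule_principal[OF _ _ _ _ c(1)])
      (use FI_D(2,4,5)[OF P] c(2) in \<open>auto intro: R_inter_F simp: emb_in_F[of 0, simplified]\<close>)
  then obtain n where n: "n \<in> P" "n \<in> F" "\<And>x. x \<in> P \<Longrightarrow> x \<in> F \<Longrightarrow> \<exists>f. x = emb f * n" by blast
  have n0: "n \<noteq> 0" using FI_inter_F[OF P] n(3) by fastforce
  have "P \<subseteq> scale n R"
    unfolding P_def
  proof (rule iprod_least)
    fix \<alpha> \<beta>' assume a: "\<alpha> \<in> I" and "\<beta>' \<in> conj ` I"
    then obtain \<beta> where b: "\<beta> \<in> I" "\<beta>' = conj \<beta>" by blast
    have K: "\<alpha> \<in> K" "\<beta> \<in> K" using a b FI_D(1)[OF I] by auto
    have mem: "x * conj y \<in> P" if "x \<in> I" "y \<in> I" for x y unfolding P_def using that by (auto intro: iprod_memI)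
    define z where "z = \<alpha> * conj \<beta> / n"
    have zK: "z \<in> K" unfolding z_def using K n(2) by simp
    have cz: "conj z = \<beta> * conj \<alpha> / n"
      unfolding z_def using K n(2) by (simp add: conj_divide conj_mult mult.commute)
    have "\<alpha> * conj \<beta> + \<beta> * conj \<alpha> \<in> P" using mem a b FI_D(4)[OF P] by blast
    moreover have "\<alpha> * conj \<beta> + \<beta> * conj \<alpha> \<in> F"
      using trace_in_F[of "\<alpha> * conj \<beta>"] K by (simp add: conj_mult mult.commute)
    ultimately obtain f where f: "\<alpha> * conj \<beta> + \<beta> * conj \<alpha> = emb f * n" using n(3) by blast
    obtain f1 where f1: "\<alpha> * conj \<alpha> = emb f1 * n" using n(3) mem a norm_in_F K by blast
    obtain f2 where f2: "\<beta> * conj \<beta> = emb f2 * n" using n(3) mem b norm_in_F K by blast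
    have "z + conj z = emb f" unfolding cz unfolding z_def using f n0 by (simp add: add_divide_distrib[symmetric])
    moreover have "z * conj z = emb (f1 * f2)"
    proof -
      have "z * conj z = (\<alpha> * conj \<alpha>) * (\<beta> * conj \<beta>) / (n * n)" unfolding cz unfolding z_def by (simp add: mult_ac)
      then show ?thesis unfolding f1 f2 using n0 by (simp add: emb_mult)
    qed
    ultimately have "z \<in> R" using zK by (intro trace_norm_integral) simp_all
    then show "\<alpha> * \<beta>' \<in> scale n R" unfolding mem_scale[OF n0] b(2) z_def .
  next
    fix x y assume "x \<in> scale n R" "y \<in> scale n R"
    then show "x + y \<in> scale n R" using n0 by (simp add: mem_scale add_divide_distrib)
  qed
  moreover have "scale n R \<subseteq> P" unfolding scale_def using FI_D(5)[OF P] n(1) by auto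
  ultimately show ?thesis using n n0 unfolding P_def by blast
qed

lemma ideal_inverse:
  assumes I: "I \<in> FI"
  shows "\<exists>J\<in>FI. iprod J I = R"
proof -
  obtain n where n: "n \<in> F" "n \<noteq> 0" "iprod I (conj ` I) = scale n R" using ideal_norm[OF I] by blast
  have "scale (1 / n) (conj ` I) \<in> FI" using n FI_conj[OF I] by (intro FI_scale) auto
  moreover have "iprod (scale (1 / n) (conj ` I)) I = R"
  proof -
    have "iprod (scale (1 / n) (conj ` I)) I = scale (1 / n) (iprod I (conj ` I))" unfolding iprod_scale by (simp only: iprod_comm)
    then show ?thesis using n(2) by (simp add: n(3) scale_scale)
  qed
  ultimately show ?thesis by blast
qed

lemma iprod_cancel:
  assumes "I \<in> FI" "J \<in> FI" "L \<in> FI" "iprod I J = iprod I L"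
  shows "J = L"
proof -
  obtain I' where I': "I' \<in> FI" "iprod I' I = R" using ideal_inverse assms(1) by blast
  have "iprod (iprod I' I) J = iprod (iprod I' I) L" unfolding iprod_assoc assms(4) ..
  then show ?thesis using assms unfolding I'(2) by (simp add: iprod_R)
qed

lemma scale_R_eq_iff:
  assumes "x \<in> K" "x \<noteq> 0" "y \<in> K" "y \<noteq> 0" "scale x R = scale y R"
  shows "\<exists>c. c \<noteq> 0 \<and> x = emb [:c:] * y"
proof -
  have "x \<in> scale x R" "y \<in> scale y R" unfolding scale_def using R_1 by force+
  then have "x / y \<in> R" "y / x \<in> R" using assms mem_scale by metis+
  moreover have "(x / y) * (y / x) = 1" using assms by simp
  ultimately obtain c where "c \<noteq> 0" "x / y = emb [:c:]" using R_unit_const by blast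
  then show ?thesis using assms by (intro exI[of _ c]) (auto simp: field_simps)
qed

lemma scale_unit_R:
  assumes "c \<noteq> 0"
  shows "scale (emb [:c:]) R = R"
proof -
  have "emb [:c:] * emb [:1/c:] = 1"
    using assms by (simp add: emb_mult[symmetric] del: emb_1) (simp add: one_pCons[symmetric])
  then have "x / emb [:c:] = emb [:1/c:] * x" for x using assms by (simp add: field_simps)
  then show ?thesis using assms by (auto simp: mem_scale scale_def) (metis R_mult emb_in_R mem_scale scale_def emb_eq_0_iff pCons_eq_0_iff)
qed

end

section \<open>Ideals whose square is principal\<close>

context imaginary_quadratic
begin

definition principal :: "'k set \<Rightarrow> bool" where
  "principal I \<longleftrightarrow> (\<exists>x\<in>K. x \<noteq> 0 \<and> I = scale x R)"

lemma irreducible_D_factor: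
  assumes "w * t = D"
  shows "w dvd 1 \<or> t dvd 1"
proof -
  have "p = smult (1 / e) w * t" using assms e_nonzero by simp
  then have "smult (1 / e) w dvd 1 \<or> t dvd 1"
    using irr unfolding Factorial_Ring.irreducible_def by blast
  then show ?thesis using e_nonzero by (simp add: smult_dvd_iff)
qed

text \<open>
  As \<open>2\<close> is invertible, a conjugation-stable ideal splits as \<open>I = A u + A v s\<close>. Multiplication by \<open>s\<close> shows
  that \<open>v\<close> divides \<open>u\<close> and \<open>u\<close> divides \<open>D v\<close>. Since \<open>D\<close> is irreducible, \<open>u\<close> is associated to \<open>v\<close>, and
  \<open>I = u R\<close>, or to \<open>D v\<close>, and \<open>I = v s R\<close>.
\<close>
lemma ambiguous_principal:
  assumes I: "I \<in> FI" and st: "conj ` I = I"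
  shows "principal I"
proof -
  have IK: "x \<in> K" if "x \<in> I" for x using that FI_D(1)[OF I] by blast
  have cI: "conj x \<in> I" if "x \<in> I" for x using st that by blast
  obtain c where c: "c \<noteq> 0" "\<And>y. y \<in> I \<Longrightarrow> emb c * y \<in> R" using FI_D(6)[OF I] by blast
  obtain x0 where x0: "x0 \<in> I" "x0 \<in> F" "x0 \<noteq> 0" using FI_inter_F[OF I] by blast
  have "\<exists>n\<in>I \<inter> F. \<forall>x\<in>I \<inter> F. \<exists>f. x = emb f * n"
    by (rule F_submodule_principal[OF _ _ _ _ c(1)])
      (use FI_D(2,4,5)[OF I] c(2) in \<open>auto intro: R_inter_F simp: emb_in_F[of 0, simplified]\<close>)
  then obtain u where u: "u \<in> I" "u \<in> F" "\<And>x. x \<in> I \<Longrightarrow> x \<in> F \<Longrightarrow> \<exists>f. x = emb f * u" by blast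
  define V where "V = {y \<in> F. y * s \<in> I}"
  have "\<exists>n\<in>V. \<forall>x\<in>V. \<exists>f. x = emb f * n"
  proof (rule F_submodule_principal)
    show "c * D \<noteq> 0" using c(1) e_nonzero irr by auto
    show "emb (c * D) * x \<in> A" if "x \<in> V" for x
    proof (rule R_inter_F)
      have "(emb c * (x * s)) * s \<in> R" using that c(2) unfolding V_def by simp
      then show "emb (c * D) * x \<in> R" by (simp only: emb_mult s_s[symmetric] mult_ac)
      show "emb (c * D) * x \<in> F" using that unfolding V_def by simp
    qed
    show "emb f * x \<in> V" if "x \<in> V" for f x
      using that FI_D(5)[OF I, of "emb f" "x * s"] unfolding V_def by (simp add: mult.assoc)
  qed (use FI_D(2,4)[OF I] in \<open>auto simp: V_def distrib_right emb_in_F[of 0, simplified]\<close>)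
  then obtain v where v: "v \<in> F" "v * s \<in> I" "\<And>x. x \<in> F \<Longrightarrow> x * s \<in> I \<Longrightarrow> \<exists>f. x = emb f * v"
    unfolding V_def by blast
  have u0: "u \<noteq> 0" using u(3)[OF x0(1,2)] x0(3) by auto
  have "u * s \<in> I" using u(1) FI_D(5)[OF I, of s u] by (simp add: mult.commute)
  then obtain t where t: "u = emb t * v" using v(3) u(2) by blast
  have amb_elt: "v \<noteq> 0" using t u0 by auto
  have "emb D * v = s * (v * s)" by (simp add: s_s[symmetric] mult_ac)
  then have "emb D * v \<in> I" using FI_D(5)[OF I s_in_R v(2)] by (simp only:)
  then obtain w where w: "emb D * v = emb w * u" using u(3) v(1) by fastforce
  then have "emb D = emb (w * t)" unfolding t using amb_elt by (simp add: emb_mult)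
  then have wt: "w * t = D" by (simp only: emb_eq_iff)
  have decomp: "\<exists>f g. z = emb f * u + emb g * v * s" if z: "z \<in> I" for z
  proof -
    have zK: "z \<in> K" using z IK by blast
    define h where "h = emb [:1 / 2:]"
    have hh: "h + h = 1"
      unfolding h_def emb_add[symmetric] using two_nonzero
      by (simp add: add_divide_distrib[symmetric] one_pCons[symmetric] del: emb_1) simp
    have h: "h \<in> F" "h \<in> R" unfolding h_def by simp_all
    define x y where "x = h * (z + conj z)" and "y = h * (z - conj z) / s"
    have "x \<in> I" unfolding x_def using FI_D(4,5)[OF I] z cI h by blast
    moreover have "x \<in> F" unfolding x_def using h trace_in_F[OF zK] by simp
    ultimately obtain f where f: "x = emb f * u" using u(3) by blast
    have ys: "y * s = h * (z - conj z)" unfolding y_def by simp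
    have "z - conj z \<in> I" using FI_D(4)[OF I z FI_D(7)[OF I cI[OF z]]] by simp
    then have "y * s \<in> I" unfolding ys using FI_D(5)[OF I] h by blast
    moreover have "y \<in> F"
    proof (rule conj_fixed_imp_F)
      show "y \<in> K" unfolding y_def using h zK by simp
      have "conj (z - conj z) = - (z - conj z)" using zK conj_add[of z "- conj z"] conj_mult[of "emb (-1)" "conj z"]
        by (simp add: emb_minus)
      moreover have "conj y = conj h * conj (z - conj z) / conj s"
        unfolding y_def using h zK by (simp add: conj_divide conj_mult)
      ultimately have "conj y = h * - (z - conj z) / - s" using h by (simp only: conj_F conj_s)
      also have "\<dots> = y" unfolding y_def by (simp only: mult_minus_right minus_divide_divide)
      finally show "conj y = y" .
    qed
    ultimately obtain g where g: "y = emb g * v" using v(3) by blast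
    have "x + y * s = (h + h) * z" unfolding x_def ys by (simp add: algebra_simps)
    then have "z = x + y * s" unfolding hh by simp
    then show ?thesis unfolding f g by blast
  qed
  from irreducible_D_factor[OF wt] show ?thesis
  proof
    assume "t dvd 1"
    then obtain t' where t': "1 = t * t'" by (auto elim: dvdE)
    have "emb t' * emb t = 1" using arg_cong[OF t', of emb] by (simp add: emb_mult mult.commute)
    then have vt: "v = emb t' * u" unfolding t by (simp add: mult.assoc[symmetric])
    have "I = scale u R"
    proof
      show "I \<subseteq> scale u R"
      proof
        fix z assume "z \<in> I"
        then obtain f g where "z = emb f * u + emb g * v * s" using decomp by blast
        then have "z = el f (g * t') * u" unfolding vt el_def by (simp add: emb_mult algebra_simps)
        then show "z \<in> scale u R" unfolding scale_def by auto
      qed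
      show "scale u R \<subseteq> I" unfolding scale_def using FI_D(5)[OF I] u(1) by auto
    qed
    then show ?thesis unfolding principal_def using u0 u(2) by auto
  next
    assume "w dvd 1"
    then obtain w' where w': "1 = w * w'" by (auto elim: dvdE)
    have "t = t * (w * w')" using w' by simp
    also have "\<dots> = D * w'" unfolding wt[symmetric] by (simp only: mult_ac)
    finally have "emb t = emb D * emb w'" by (simp only: emb_mult)
    then have ut: "u = s * s * emb w' * v" by (simp only: t s_s)
    have "I = scale (v * s) R"
    proof
      show "I \<subseteq> scale (v * s) R"
      proof
        fix z assume "z \<in> I"
        then obtain f g where "z = emb f * u + emb g * v * s" using decomp by blast
        then have "z = el g (f * w') * (v * s)" unfolding ut el_def by (simp add: emb_mult algebra_simps)
        then show "z \<in> scale (v * s) R" unfolding scale_def by auto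
      qed
      show "scale (v * s) R \<subseteq> I" unfolding scale_def using FI_D(5)[OF I] v(2) by auto
    qed
    then show ?thesis unfolding principal_def using amb_elt v(1) by (intro bexI[of _ "v * s"]) auto
  qed
qed

lemma principal_scale:
  assumes "x \<in> K" "x \<noteq> 0" "principal I"
  shows "principal (scale x I)"
proof -
  obtain y where "y \<in> K" "y \<noteq> 0" "I = scale y R" using assms(3) unfolding principal_def by blast
  then show ?thesis unfolding principal_def using assms by (intro bexI[of _ "x * y"]) (auto simp: scale_scale)
qed

text \<open>
  The element \<open>1 + w\<close> works unless it vanishes; for \<open>w = -1\<close> take \<open>s\<close>.
\<close>
lemma hilbert90:
  assumes w: "w \<in> K" "w * conj w = 1"
  shows "\<exists>v\<in>K. v \<noteq> 0 \<and> w * conj v = v"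
proof (cases "w = -1")
  case True
  then show ?thesis by (intro bexI[of _ s]) auto
next
  case False
  then have "1 + w \<noteq> 0" by (metis add.commute add_eq_0_iff)
  then show ?thesis using w by (intro bexI[of _ "1 + w"]) (auto simp: conj_add algebra_simps)
qed

lemma iprod_scale_R: "I \<in> FI \<Longrightarrow> iprod I (scale x R) = scale x I"
  using iprod_R[of I] by (simp add: iprod_scale_right iprod_comm)

text \<open>
  Both sides generate the norm of \<open>J\<^sup>2\<close>, and units are constants.
\<close>
lemma norm_of_square:
  assumes J: "J \<in> FI" and n: "n \<in> F" "n \<noteq> 0" "iprod J (conj ` J) = scale n R"
    and u: "u \<in> K" "u \<noteq> 0" "iprod J J = scale u R"
  shows "\<exists>c. c \<noteq> 0 \<and> u * conj u = emb [:c:] * n\<^sup>2"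
proof -
  have JK: "J \<subseteq> K" using FI_D(1)[OF J] .
  have "iprod (conj ` J) (conj ` J) = scale (conj u) R"
    using conj_iprod[OF JK JK] u(3) conj_scale[OF R_subset_K u(1)] by simp
  then have "scale (u * conj u) R = iprod (iprod J J) (iprod (conj ` J) (conj ` J))"
    unfolding u(3) by (simp add: iprod_scale iprod_R FI_R FI_scale u scale_scale)
  also have "\<dots> = iprod (iprod J (conj ` J)) (iprod J (conj ` J))"
    by (rule iprod_swap)
  also have "\<dots> = scale (n * n) R" unfolding n(3) by (simp add: iprod_scale iprod_R FI_R FI_scale n scale_scale)
  finally show ?thesis
    using scale_R_eq_iff[of "u * conj u" "n * n"] u n by (simp add: power2_eq_square)
qed

text \<open>
  The element \<open>w = u / (k n)\<close> has norm \<open>1\<close>, and \<open>J\<close> is \<open>w\<close> times its conjugate. Writing \<open>w\<close> as \<open>v\<close> over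
  its conjugate makes the conjugate of \<open>v\<close> times \<open>J\<close> an ideal stable under conjugation.
\<close>
lemma square_principal:
  assumes J: "J \<in> FI" and n: "n \<in> F" "n \<noteq> 0" "iprod J (conj ` J) = scale n R"
    and u: "u \<in> K" "u \<noteq> 0" "iprod J J = scale u R" and k: "u * conj u = emb [:k\<^sup>2:] * n\<^sup>2"
  shows "principal J"
proof -
  have k0: "k \<noteq> 0" using k u by auto
  have JK: "J \<subseteq> K" using FI_D(1)[OF J] .
  define w where "w = u / (emb [:k:] * n)"
  have wK: "w \<in> K" and w0: "w \<noteq> 0" unfolding w_def using u k0 n by auto
  have "w * conj w = (u * conj u) / (emb [:k\<^sup>2:] * n\<^sup>2)"
    unfolding w_def using u n by (simp add: conj_divide conj_mult power2_eq_square emb_mult[symmetric])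
  then have "w * conj w = 1" unfolding k using k0 n by simp
  then obtain v where v: "v \<in> K" "v \<noteq> 0" "w * conj v = v" using hilbert90 wK by blast
  \<comment> \<open>cancel \<open>J\<close> from \<open>J * J = w J * conj J\<close>\<close>
  have "scale u R = scale (w * n) (scale (emb [:k:]) R)" unfolding w_def scale_scale using k0 n by simp
  then have "iprod J J = iprod J (scale w (conj ` J))"
    unfolding iprod_scale_right n(3) scale_scale u(3) scale_unit_R[OF k0] .
  then have JJ: "J = scale w (conj ` J)"
    using wK w0 by (intro iprod_cancel[OF J J]) (auto intro!: FI_scale FI_conj J)
  define I where "I = scale (conj v) J"
  have I: "I \<in> FI" unfolding I_def using v by (intro FI_scale J) auto
  have cI: "conj ` I = scale v (conj ` J)" unfolding I_def using v by (simp add: conj_scale[OF JK])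
  have "I = scale (conj v * w) (conj ` J)" unfolding I_def by (subst JJ) (simp add: scale_scale)
  also have "conj v * w = v" using v(3) by (simp add: mult.commute)
  finally have "conj ` I = I" unfolding cI by simp
  then have "principal I" by (rule ambiguous_principal[OF I])
  moreover have "J = scale (1 / conj v) I" unfolding I_def scale_scale using v by simp
  ultimately show ?thesis using principal_scale[of "1 / conj v" I] v by simp
qed

lemma norm_gen:
  assumes "I \<in> FI"
  obtains n where "n \<in> F" "n \<noteq> 0" "iprod I (conj ` I) = scale n R"
  using ideal_norm[OF assms] by blast

lemma odd_degree_no_two_torsion:
  assumes odd: "odd d" and J: "J \<in> FI" and sq: "principal (iprod J J)"
  shows "principal J"
proof -
  obtain n where n: "n \<in> F" "n \<noteq> 0" "iprod J (conj ` J) = scale n R" by (rule norm_gen[OF J])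
  obtain u where u: "u \<in> K" "u \<noteq> 0" "iprod J J = scale u R" using sq unfolding principal_def by blast
  obtain c where c: "c \<noteq> 0" "u * conj u = emb [:c:] * n\<^sup>2" using norm_of_square[OF J n u] by blast
  obtain a b g where ab: "g \<noteq> 0" "u = el a b / emb g" using u(1) by (rule K_cases)
  obtain f h where fh: "h \<noteq> 0" "n = emb f / emb h" using n(1) by (rule F_cases)
  have f0: "f \<noteq> 0" using fh n(2) by auto
  have "emb (a\<^sup>2 - D * b\<^sup>2) / emb (g\<^sup>2) = emb [:c:] * (emb f / emb h)\<^sup>2"
    using c(2) norm_frac[OF ab(1)] unfolding ab(2) fh(2) by simp
  then have "emb (a\<^sup>2 - D * b\<^sup>2) * emb (h\<^sup>2) = emb [:c:] * emb (f\<^sup>2) * emb (g\<^sup>2)"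
    using ab(1) fh(1) by (simp add: emb_power field_simps)
  then have "(a\<^sup>2 - D * b\<^sup>2) * h\<^sup>2 = [:c:] * f\<^sup>2 * g\<^sup>2" by (simp only: emb_mult[symmetric] emb_eq_iff)
  then have "(a * h)\<^sup>2 - D * (b * h)\<^sup>2 = smult c ((f * g)\<^sup>2)"
    by (simp add: power_mult_distrib algebra_simps)
  then obtain k where "c = k\<^sup>2"
    using norm_form_eq_const_square[OF nonsquare_lead] odd degree_D ab(1) f0 by (metis mult_eq_0_iff)
  then show ?thesis using square_principal[OF J n u] c by blast
qed

definition isum :: "'k set \<Rightarrow> 'k set \<Rightarrow> 'k set" where
  "isum I J = {x + y | x y. x \<in> I \<and> y \<in> J}"

lemma isum_I: "x \<in> I \<Longrightarrow> y \<in> J \<Longrightarrow> x + y \<in> isum I J"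
  unfolding isum_def by blast

text \<open>
  Hilbert's Theorem 90 for ideals: \<open>R + B\<close> plays the role of \<open>1 + w\<close>, since multiplying the conjugate of \<open>R + B\<close>
  by \<open>B\<close> interchanges the two summands.
\<close>
lemma ideal_hilbert90:
  assumes B: "B \<in> FI" and n: "iprod B (conj ` B) = R"
  shows "isum R B \<in> FI" and "iprod B (conj ` isum R B) = isum R B"
proof -
  define C where "C = isum R B"
  have BK: "x \<in> K" if "x \<in> B" for x using that FI_D(1)[OF B] by blast
  obtain c where c: "c \<noteq> 0" "\<And>x. x \<in> B \<Longrightarrow> emb c * x \<in> R" using FI_D(6)[OF B] by blast
  have RC: "x \<in> C" if "x \<in> R" for x using isum_I[OF that FI_D(2)[OF B]] unfolding C_def by simp
  have BC: "x \<in> C" if "x \<in> B" for x using isum_I[OF R_0 that] unfolding C_def by simp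
  have add: "x + y \<in> C" if xy: "x \<in> C" "y \<in> C" for x y
  proof -
    obtain a b a' b' where *: "a \<in> R" "b \<in> B" "x = a + b" "a' \<in> R" "b' \<in> B" "y = a' + b'"
      using xy unfolding C_def isum_def by blast
    have "(a + a') + (b + b') \<in> C" unfolding C_def by (intro isum_I R_add FI_D(4)[OF B] *)
    then show ?thesis unfolding *(3,6) by (simp only: ac_simps)
  qed
  show CI: "isum R B \<in> FI"
    unfolding C_def[symmetric]
  proof (rule FI_I[where x = 1 and c = c])
    show "C \<subseteq> K" unfolding C_def isum_def using BK by auto
    show "r * x \<in> C" if rx: "r \<in> R" "x \<in> C" for r x
    proof -
      obtain a b where "a \<in> R" "b \<in> B" "x = a + b" using rx unfolding C_def isum_def by blast
      then show ?thesis using isum_I[of "r * a" R "r * b" B] rx FI_D(5)[OF B]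
        unfolding C_def by (simp add: distrib_left)
    qed
    show "emb c * x \<in> R" if x: "x \<in> C" for x
      using x c(2) unfolding C_def isum_def by (auto simp: distrib_left)
  qed (use RC add c in auto)
  have CK: "x \<in> K" if "x \<in> C" for x using that FI_D(1)[OF CI] unfolding C_def by blast
  show "iprod B (conj ` isum R B) = isum R B"
    unfolding C_def[symmetric]
  proof
    show "iprod B (conj ` C) \<subseteq> C"
    proof (rule iprod_least)
      fix b z assume b: "b \<in> B" and "z \<in> conj ` C"
      then obtain x y where xy: "x \<in> R" "y \<in> B" "z = conj (x + y)" unfolding C_def isum_def by blast
      have "b * z = b * conj y + conj x * b" using xy BK by (simp add: conj_add algebra_simps)
      moreover have "b * conj y \<in> R" unfolding n[symmetric] using b xy by (intro iprod_memI) auto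
      moreover have "conj x * b \<in> B" using FI_D(5)[OF B] b xy by simp
      ultimately show "b * z \<in> C" unfolding C_def by (simp add: isum_I)
    qed (rule add)
    show "C \<subseteq> iprod B (conj ` C)"
    proof
      fix z assume "z \<in> C"
      then obtain x y where xy: "x \<in> R" "y \<in> B" "z = x + y" unfolding C_def isum_def by blast
      have "iprod B (conj ` B) \<subseteq> iprod B (conj ` C)"
        by (rule iprod_least) (use BC in \<open>auto intro: iprod_memI iprod_add\<close>)
      then have "x \<in> iprod B (conj ` C)" using xy(1) n by blast
      moreover have "1 \<in> conj ` C" using RC[of 1] conj_F[OF F_1] by (metis R_1 image_eqI)
      then have "y * 1 \<in> iprod B (conj ` C)" using xy(2) by (intro iprod_memI)
      ultimately show "z \<in> iprod B (conj ` C)" unfolding xy(3) by (simp add: iprod_add)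
    qed
  qed
qed

section \<open>The ambiguous class in even degree\<close>

context
  fixes U V :: "'a poly"
  assumes even_d: "even d" and rep: "U\<^sup>2 - smult e (V\<^sup>2) = D" and V0: "V \<noteq> 0"
begin

text \<open>
  By Hilbert's Theorem 90 an ideal that differs from its conjugate by an element whose norm is a square of a
  constant is in a trivial class; this element has norm \<open>e\<close> instead.
\<close>
definition amb_elt :: 'k where "amb_elt = el U 1 / emb V"
definition amb_ideal :: "'k set" where "amb_ideal = isum R (scale amb_elt R)"

lemma amb_elt_K: "amb_elt \<in> K" unfolding amb_elt_def by simp

lemma amb_elt_nonzero: "amb_elt \<noteq> 0" unfolding amb_elt_def using V0 by simp

lemma norm_amb_elt: "amb_elt * conj amb_elt = emb [:e:]"
proof -
  have "U\<^sup>2 - D * 1\<^sup>2 = [:e:] * V\<^sup>2" using rep by (simp add: algebra_simps)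
  then have "emb (U\<^sup>2 - D * 1\<^sup>2) = emb [:e:] * emb (V\<^sup>2)" by (simp only: emb_mult)
  then show ?thesis unfolding amb_elt_def norm_frac[OF V0] using V0 by (simp only:) simp
qed

lemma amb_ideal_FI: "amb_ideal \<in> FI" and amb_ideal_conj: "scale amb_elt (conj ` amb_ideal) = amb_ideal"
proof -
  have B: "scale amb_elt R \<in> FI" using amb_elt_K amb_elt_nonzero by (intro FI_scale) auto
  have "iprod (scale amb_elt R) (conj ` scale amb_elt R) = scale (emb [:e:]) R"
    using amb_elt_K amb_elt_nonzero
    by (simp add: conj_scale[OF R_subset_K] iprod_scale iprod_scale_right iprod_R scale_scale norm_amb_elt mult.commute)
  then have n: "iprod (scale amb_elt R) (conj ` scale amb_elt R) = R" using scale_unit_R[OF e_nonzero] by simp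
  show "amb_ideal \<in> FI" unfolding amb_ideal_def by (rule ideal_hilbert90(1)[OF B n])
  then show "scale amb_elt (conj ` amb_ideal) = amb_ideal"
    using ideal_hilbert90(2)[OF B n] iprod_R[OF FI_conj, of amb_ideal] unfolding amb_ideal_def[symmetric] by (simp add: iprod_scale)
qed

lemma coprime_UV: "\<exists>x y. x * V + y * U = 1"
proof -
  obtain g x y where g: "g = x * V + y * U" "g dvd V" "g dvd U" using poly_bezout by blast
  obtain V' U' where "V = g * V'" "U = g * U'" using g(2,3) by (auto elim!: dvdE)
  then have "g * (g * (U'\<^sup>2 - smult e (V'\<^sup>2))) = D"
    unfolding rep[symmetric] by (simp add: power2_eq_square algebra_simps)
  then have "g dvd 1" using irreducible_D_factor by (metis dvd_mult_left)
  then obtain w where "1 = g * w" by (auto elim: dvdE)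
  then have "(w * x) * V + (w * y) * U = 1" unfolding g(1) by (simp add: algebra_simps)
  then show ?thesis by blast
qed

text \<open>
  The product is spanned by \<open>1\<close>, the element \<open>(U + s) / V\<close> and its conjugate; it contains \<open>1 / V\<close> because
  \<open>2 U\<close> and \<open>V\<close> are coprime.
\<close>
lemma amb_ideal_norm: "iprod amb_ideal (conj ` amb_ideal) = scale (1 / emb V) R"
proof
  have V': "1 / emb V \<noteq> 0" using V0 by simp
  show "iprod amb_ideal (conj ` amb_ideal) \<subseteq> scale (1 / emb V) R"
  proof (rule iprod_least)
    fix i j assume i: "i \<in> amb_ideal" and "j \<in> conj ` amb_ideal"
    then obtain k where k: "k \<in> amb_ideal" "j = conj k" by blast
    obtain a b where ab: "a \<in> R" "b \<in> R" "i = a + b * amb_elt" using i unfolding amb_ideal_def isum_def scale_def by blast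
    obtain a' b' where ab': "a' \<in> R" "b' \<in> R" "k = a' + b' * amb_elt" using k unfolding amb_ideal_def isum_def scale_def by blast
    have "i * j = a * conj a' + a * conj b' * conj amb_elt + b * conj a' * amb_elt + b * conj b' * (amb_elt * conj amb_elt)"
      unfolding k ab ab' using ab' amb_elt_K by (simp add: conj_add conj_mult algebra_simps)
    moreover have "emb V * amb_elt = el U 1" "emb V * conj amb_elt = el U (- 1)"
      unfolding amb_elt_def conj_frac[OF V0] using V0 by simp_all
    moreover have "emb V * (a * conj a' + a * conj b' * conj amb_elt + b * conj a' * amb_elt + b * conj b' * (amb_elt * conj amb_elt))
      = emb V * (a * conj a') + a * conj b' * (emb V * conj amb_elt) + b * conj a' * (emb V * amb_elt)
        + emb V * (b * conj b' * (amb_elt * conj amb_elt))"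
      by (simp only: distrib_left mult_ac)
    ultimately have "emb V * (i * j) = emb V * (a * conj a') + a * conj b' * el U (- 1) + b * conj a' * el U 1
        + emb V * (b * conj b' * emb [:e:])"
      by (simp only: norm_amb_elt)
    moreover have "\<dots> \<in> R" using ab ab' by (intro R_add R_mult) auto
    ultimately show "i * j \<in> scale (1 / emb V) R" unfolding mem_scale[OF V'] by (simp add: mult.commute)
  next
    fix x y assume "x \<in> scale (1 / emb V) R" "y \<in> scale (1 / emb V) R"
    then show "x + y \<in> scale (1 / emb V) R" unfolding mem_scale[OF V'] by (simp add: distrib_right)
  qed
  define P where "P = iprod amb_ideal (conj ` amb_ideal)"
  have P: "P \<in> FI" unfolding P_def using FI_iprod FI_conj amb_ideal_FI by blast
  have "0 * amb_elt \<in> scale amb_elt R" "1 * amb_elt \<in> scale amb_elt R" unfolding scale_def by (intro imageI R_0 R_1)+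
  then have one: "1 \<in> amb_ideal" and v: "amb_elt \<in> amb_ideal"
    unfolding amb_ideal_def using isum_I[OF R_1, of 0 "scale amb_elt R"] isum_I[OF R_0, of amb_elt "scale amb_elt R"] by simp_all
  have one': "1 \<in> conj ` amb_ideal" using one conj_F[OF F_1] by (metis image_eqI)
  have "1 * 1 \<in> P" "amb_elt * 1 \<in> P" "1 * conj amb_elt \<in> P" 
    unfolding P_def using iprod_memI[OF one one'] iprod_memI[OF v one'] iprod_memI[OF one imageI[OF v]] by simp_all
  then have mem: "1 \<in> P" "amb_elt + conj amb_elt \<in> P" using FI_D(4)[OF P] by auto
  obtain x y where xy: "x * V + y * U = 1" using coprime_UV by blast
  define y' where "y' = smult (1 / 2) y"
  have "y' + y' = smult (1 / 2 + 1 / 2) y" unfolding y'_def by (simp only: smult_add_left)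
  also have "1 / 2 + 1 / 2 = (1 :: 'a)" using two_nonzero by (simp add: add_divide_distrib[symmetric])
  finally have y': "y' + y' = y" by simp
  have "emb x * 1 + emb y' * (amb_elt + conj amb_elt) \<in> P"
    by (intro FI_D(4)[OF P] FI_D(5)[OF P] emb_in_R mem)
  also have "amb_elt + conj amb_elt = emb (U + U) / emb V"
    unfolding amb_elt_def conj_frac[OF V0] by (simp add: add_divide_distrib[symmetric] el_add)
  also have "emb x * 1 + emb y' * (emb (U + U) / emb V) = emb (x * V + y' * (U + U)) / emb V"
    using V0 by (simp add: emb_add emb_mult add_divide_distrib)
  also have "x * V + y' * (U + U) = x * V + (y' + y') * U" by (simp add: algebra_simps)
  also have "\<dots> = 1" unfolding y' by (rule xy)
  finally have "1 / emb V \<in> P" by simp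
  then show "scale (1 / emb V) R \<subseteq> iprod amb_ideal (conj ` amb_ideal)"
    unfolding P_def[symmetric] scale_def using FI_D(5)[OF P] by blast
qed

lemma amb_ideal_square: "iprod amb_ideal amb_ideal = scale (amb_elt / emb V) R"
proof -
  have "iprod amb_ideal amb_ideal = iprod amb_ideal (scale amb_elt (conj ` amb_ideal))" by (simp only: amb_ideal_conj)
  then show ?thesis by (simp add: iprod_scale_right amb_ideal_norm scale_scale)
qed

lemma amb_ideal_square_principal: "principal (iprod amb_ideal amb_ideal)"
  unfolding principal_def amb_ideal_square using amb_elt_K amb_elt_nonzero V0 by (intro bexI[of _ "amb_elt / emb V"]) auto

text \<open>
  If \<open>w\<close> generates the ideal, then \<open>(U + s) / V\<close> is a constant times \<open>w\<close> over its conjugate, so its norm \<open>e\<close> is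
  the square of that constant.
\<close>
lemma amb_ideal_not_principal: "\<not> principal amb_ideal"
proof
  assume "principal amb_ideal"
  then obtain w where w: "w \<in> K" "w \<noteq> 0" "amb_ideal = scale w R" unfolding principal_def by blast
  have "scale (amb_elt * conj w) R = scale w R"
    using amb_ideal_conj unfolding w(3) conj_scale[OF R_subset_K w(1)] by (simp add: scale_scale)
  then obtain c where c: "amb_elt * conj w = emb [:c:] * w"
    using scale_R_eq_iff[of "amb_elt * conj w" w] amb_elt_K amb_elt_nonzero w by auto
  then have "conj (amb_elt * conj w) = conj (emb [:c:] * w)" by simp
  then have c': "conj amb_elt * w = emb [:c:] * conj w" using amb_elt_K w by (simp add: conj_mult)
  have "(amb_elt * conj amb_elt) * (w * conj w) = (amb_elt * conj w) * (conj amb_elt * w)" by (simp add: mult_ac)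
  also have "\<dots> = emb [:c:] * emb [:c:] * (w * conj w)" unfolding c c' by (simp add: mult_ac)
  finally have "emb [:e:] = emb ([:c:] * [:c:])" unfolding norm_amb_elt emb_mult using w by simp
  then have "e = c\<^sup>2" unfolding emb_eq_iff by (simp add: power2_eq_square)
  then show False using nonsquare by blast
qed

text \<open>
  The element \<open>\<alpha>\<close> has norm \<open>c V\<close>, so \<open>\<alpha>\<close> times the ambiguous ideal has norm \<open>R\<close>, and Hilbert's Theorem 90 for
  ideals makes the ambiguous class a square.
\<close>
lemma class_of_order_four:
  assumes conic: "c \<noteq> 0" "m \<noteq> 0 \<or> w \<noteq> 0"
    "z\<^sup>2 - D * y\<^sup>2 = smult c V * (m\<^sup>2 - D * w\<^sup>2)"
  shows "\<exists>C\<in>FI. \<exists>x\<in>K. x \<noteq> 0 \<and> iprod C C = scale x amb_ideal"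
proof -
  define \<alpha> where "\<alpha> = el z y / el m w"
  have mw: "el m w \<noteq> 0" using conic(2) by auto
  have mw': "m\<^sup>2 - D * w\<^sup>2 \<noteq> 0" using conic(2) norm_zero by blast
  have \<alpha>K: "\<alpha> \<in> K" unfolding \<alpha>_def by simp
  have "\<alpha> * conj \<alpha> = (el z y * el z (- y)) / (el m w * el m (- w))"
    unfolding \<alpha>_def by (simp add: conj_divide)
  also have "\<dots> = emb (smult c V * (m\<^sup>2 - D * w\<^sup>2)) / emb (m\<^sup>2 - D * w\<^sup>2)"
    unfolding el_conj conic(3) ..
  also have "\<dots> = emb ([:c:] * V)" unfolding emb_mult[of "smult c V"] using mw' by simp
  finally have N: "\<alpha> * conj \<alpha> = emb [:c:] * emb V" unfolding emb_mult .
  then have \<alpha>0: "\<alpha> \<noteq> 0" using conic(1) V0 by auto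
  define B where "B = scale \<alpha> amb_ideal"
  have B: "B \<in> FI" unfolding B_def using \<alpha>K \<alpha>0 by (intro FI_scale amb_ideal_FI) auto
  have "iprod B (conj ` B) = scale (\<alpha> * conj \<alpha>) (iprod amb_ideal (conj ` amb_ideal))"
    unfolding B_def using conj_scale[OF FI_D(1)[OF amb_ideal_FI] \<alpha>K] by (simp add: iprod_scale iprod_scale_right scale_scale mult.commute)
  also have "\<dots> = scale (emb [:c:]) R" unfolding amb_ideal_norm N scale_scale using V0 by simp
  also have "\<dots> = R" by (rule scale_unit_R[OF conic(1)])
  finally have n: "iprod B (conj ` B) = R" .
  define C where "C = isum R B"
  have C: "C \<in> FI" "iprod B (conj ` C) = C" unfolding C_def using ideal_hilbert90[OF B n] by auto
  obtain k where k: "k \<in> F" "k \<noteq> 0" "iprod C (conj ` C) = scale k R" by (rule norm_gen[OF C(1)])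
  have "iprod C C = iprod (iprod B (conj ` C)) C" by (simp only: C(2))
  also have "\<dots> = iprod B (iprod C (conj ` C))" by (simp only: iprod_assoc iprod_comm[of "conj ` C" C])
  also have "\<dots> = scale k B" unfolding k(3) by (rule iprod_scale_R[OF B])
  also have "\<dots> = scale (k * \<alpha>) amb_ideal" unfolding B_def scale_scale ..
  finally show ?thesis using C(1) k \<alpha>K \<alpha>0 by (intro bexI[of _ C] bexI[of _ "k * \<alpha>"]) auto
qed

end

section \<open>The parity of the degree of an ideal\<close>

text \<open>
  Parity of the degree of a rational function; the degree of a quotient is the difference of the degrees, which
  has the parity of their sum.
\<close>
definition even_frac :: "'k \<Rightarrow> bool" where
  "even_frac n \<longleftrightarrow> (\<exists>a b. a \<noteq> 0 \<and> b \<noteq> 0 \<and> n = emb a / emb b \<and> even (deg a + deg b))"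

lemma even_frac:
  assumes "a \<noteq> 0" "b \<noteq> 0"
  shows "even_frac (emb a / emb b) \<longleftrightarrow> even (deg a + deg b)"
proof
  assume "even_frac (emb a / emb b)"
  then obtain a' b' where ab: "a' \<noteq> 0" "b' \<noteq> 0" "emb a / emb b = emb a' / emb b'"
    "even (deg a' + deg b')" unfolding even_frac_def by blast
  then have "emb (a * b') = emb (a' * b)" using assms by (simp add: emb_mult frac_eq_eq)
  then have "a * b' = a' * b" by (simp only: emb_eq_iff)
  then have "deg a + deg b' = deg a' + deg b"
    using assms ab(1,2) by (metis degree_mult_eq)
  then show "even (deg a + deg b)" using ab(4) by presburger
qed (use assms even_frac_def in blast)

lemma even_frac_mult:
  assumes "x \<in> F" "x \<noteq> 0" "y \<in> F" "y \<noteq> 0"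
  shows "even_frac (x * y) \<longleftrightarrow> (even_frac x \<longleftrightarrow> even_frac y)"
proof -
  obtain a b where ab: "b \<noteq> 0" "x = emb a / emb b" using assms(1) by (rule F_cases)
  obtain a' b' where ab': "b' \<noteq> 0" "y = emb a' / emb b'" using assms(3) by (rule F_cases)
  have a0: "a \<noteq> 0" "a' \<noteq> 0" using ab ab' assms by auto
  have xy: "x * y = emb (a * a') / emb (b * b')" unfolding ab ab' by (simp add: emb_mult)
  have nz: "a * a' \<noteq> 0" "b * b' \<noteq> 0" using a0 ab(1) ab'(1) by auto
  show ?thesis
    unfolding xy even_frac[OF nz] unfolding ab(2) ab'(2) even_frac[OF a0(1) ab(1)] even_frac[OF a0(2) ab'(1)]
    using a0 ab(1) ab'(1) by (simp add: degree_mult_eq) presburger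
qed

definition even_ideal :: "'k set \<Rightarrow> bool" where
  "even_ideal I \<longleftrightarrow> (\<exists>n\<in>F. n \<noteq> 0 \<and> iprod I (conj ` I) = scale n R \<and> even_frac n)"

lemma even_ideal:
  assumes "n \<in> F" "n \<noteq> 0" "iprod I (conj ` I) = scale n R"
  shows "even_ideal I \<longleftrightarrow> even_frac n"
proof
  assume "even_ideal I"
  then obtain n' where n': "n' \<in> F" "n' \<noteq> 0" "scale n R = scale n' R" "even_frac n'"
    unfolding even_ideal_def assms(3) by blast
  then obtain c where c: "c \<noteq> 0" "n = emb [:c:] * n'" using scale_R_eq_iff[of n n'] assms by auto
  have "even_frac (emb [:c:])" using even_frac[of "[:c:]" 1] c(1) by simp
  then show "even_frac n" unfolding c(2) using even_frac_mult[of "emb [:c:]" n'] n' c(1) by simp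
qed (use assms even_ideal_def in blast)

lemma even_ideal_iprod:
  assumes "I \<in> FI" "J \<in> FI"
  shows "even_ideal (iprod I J) \<longleftrightarrow> (even_ideal I \<longleftrightarrow> even_ideal J)"
proof -
  obtain n where n: "n \<in> F" "n \<noteq> 0" "iprod I (conj ` I) = scale n R" by (rule norm_gen[OF assms(1)])
  obtain m where m: "m \<in> F" "m \<noteq> 0" "iprod J (conj ` J) = scale m R" by (rule norm_gen[OF assms(2)])
  have "iprod (iprod I J) (conj ` iprod I J) = iprod (iprod I (conj ` I)) (iprod J (conj ` J))"
    unfolding conj_iprod[OF FI_D(1)[OF assms(1)] FI_D(1)[OF assms(2)]] by (rule iprod_swap)
  also have "\<dots> = scale (n * m) R" unfolding n(3) m(3) by (simp add: iprod_scale iprod_R FI_R FI_scale m scale_scale)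
  finally show ?thesis using even_ideal[OF n] even_ideal[OF m] even_ideal[of "n * m" "iprod I J"] even_frac_mult[of n m] n m by simp
qed

lemma principal_even_ideal:
  assumes "even d" "principal I"
  shows "even_ideal I"
proof -
  obtain x where x: "x \<in> K" "x \<noteq> 0" "I = scale x R" using assms(2) unfolding principal_def by blast
  obtain a b c where c: "c \<noteq> 0" "x = el a b / emb c" using x(1) by (rule K_cases)
  have N: "a\<^sup>2 - D * b\<^sup>2 \<noteq> 0" using x(2) c norm_zero by auto
  have "iprod I (conj ` I) = scale (x * conj x) R"
    unfolding x(3) conj_scale[OF R_subset_K x(1)] by (simp add: iprod_scale iprod_scale_right iprod_R scale_scale mult.commute)
  moreover have "even_frac (x * conj x)"
    unfolding c(2) norm_frac[OF c(1)] using even_frac[OF N, of "c\<^sup>2"] c(1) assms(1)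
      norm_form_even_degree[OF nonsquare_lead, of a b] degree_D
    by (simp add: degree_power_eq)
  ultimately show ?thesis unfolding even_ideal_def using norm_in_F[OF x(1)] x
    by (intro bexI[of _ "x * conj x"]) auto
qed

text \<open>
  If the norm of a generator of \<open>J\<^sup>2\<close> is \<open>e\<close> times a square, then multiplying \<open>J\<close> by the ambiguous ideal
  changes that factor into \<open>e\<^sup>2\<close>. So the product is principal, in particular even, which contradicts the odd
  degree of the norm \<open>1 / V\<close> of the ambiguous ideal.
\<close>
lemma even_two_torsion_trivial:
  assumes even_d: "even d" and rep: "U\<^sup>2 - smult e (V\<^sup>2) = D" and V0: "V \<noteq> 0"
    and odd: "odd (deg V)"
    and J: "J \<in> FI" "even_ideal J" "principal (iprod J J)"
  shows "principal J"
proof -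
  obtain n where n: "n \<in> F" "n \<noteq> 0" "iprod J (conj ` J) = scale n R" by (rule norm_gen[OF J(1)])
  obtain u where u: "u \<in> K" "u \<noteq> 0" "iprod J J = scale u R" using J(3) unfolding principal_def by blast
  obtain c where c: "c \<noteq> 0" "u * conj u = emb [:c:] * n\<^sup>2" using norm_of_square[OF J(1) n u] by blast
  obtain k where "c = k\<^sup>2 \<or> c = e * k\<^sup>2"
    using square_or_nonsquare_times_square[OF odd_card nonsquare] by blast
  then show ?thesis
  proof
    assume "c = k\<^sup>2"
    then show ?thesis using square_principal[OF J(1) n u] c by blast
  next
    assume ck: "c = e * k\<^sup>2"
    let ?I = "amb_ideal U V" and ?v = "amb_elt U V"
    note ctx = even_d rep V0
    have I: "?I \<in> FI" by (rule amb_ideal_FI[OF ctx])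
    have v: "?v \<in> K" "?v \<noteq> 0" using amb_elt_K[OF ctx] amb_elt_nonzero[OF ctx] by auto
    define M where "M = iprod J ?I"
    have M: "M \<in> FI" unfolding M_def by (rule FI_iprod[OF J(1) I])
    have Mn: "iprod M (conj ` M) = scale (n / emb V) R"
    proof -
      have "iprod M (conj ` M) = iprod (iprod J (conj ` J)) (iprod ?I (conj ` ?I))"
        unfolding M_def conj_iprod[OF FI_D(1)[OF J(1)] FI_D(1)[OF I]] by (rule iprod_swap)
      then show ?thesis unfolding n(3) amb_ideal_norm[OF ctx] using V0 n
        by (simp add: iprod_scale iprod_R FI_scale scale_scale)
    qed
    have Mu: "iprod M M = scale (u * (?v / emb V)) R"
    proof -
      have "iprod M M = iprod (iprod J J) (iprod ?I ?I)" unfolding M_def by (rule iprod_swap)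
      then show ?thesis unfolding u(3) amb_ideal_square[OF ctx] using v V0
        by (simp add: iprod_scale iprod_R FI_scale scale_scale)
    qed
    have "(u * (?v / emb V)) * conj (u * (?v / emb V)) = (u * conj u) * (?v * conj ?v) / (emb V)\<^sup>2"
      using u v V0 by (simp add: conj_mult conj_divide power2_eq_square mult_ac)
    also have "\<dots> = emb ([:e * k\<^sup>2:] * [:e:]) * (n / emb V)\<^sup>2"
      unfolding c(2) ck norm_amb_elt[OF ctx] emb_mult by (simp add: power_divide)
    also have "[:e * k\<^sup>2:] * [:e:] = [:(e * k)\<^sup>2:]" by (simp add: power2_eq_square mult_ac)
    finally have "principal M"
      using square_principal[OF M _ _ Mn _ _ Mu] n u v V0 by simp
    then have "even_ideal M" by (rule principal_even_ideal[OF even_d])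
    then have "even_ideal ?I" using even_ideal_iprod[OF J(1) I] J(2) unfolding M_def by simp
    then have "even_frac (emb 1 / emb V)" using even_ideal[OF _ _ amb_ideal_norm[OF ctx]] V0 by simp
    then show ?thesis using even_frac[of 1 V] V0 odd by simp
  qed
qed

section \<open>Finiteness of the class group\<close>

text \<open>
  Dirichlet approximation to \<open>b / c\<close>: the \<open>q\<^bsup>d+1\<^esup>\<close> polynomials \<open>t\<close> cannot have pairwise different top \<open>d\<close>
  coefficients of \<open>t b mod c\<close>, and a difference of two that agree has a small remainder. If \<open>deg c < d\<close>, the
  truncated difference of degrees is \<open>0\<close> and the remainder is \<open>0\<close>.
\<close>
lemma dirichlet_approximation:
  fixes a b c :: "'a poly"
  assumes c: "c \<noteq> 0"
  shows "\<exists>t\<in>polys_below (d + 1) - {0}. t * b mod c \<in> polys_below (deg c - d)"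
proof -
  define k where "k = deg c - d"
  define M :: "'a poly" where "M = Polynomial.monom 1 k"
  have M: "M \<noteq> 0" "deg M = k" unfolding M_def by (simp_all add: degree_monom_eq)
  have mod_below: "f mod g \<in> polys_below (deg g)" if "g \<noteq> 0" for f g :: "'a poly"
    using degree_mod_less[OF that, of f] by (simp add: polys_below_degree)
  have "(t * b mod c) div M \<in> polys_below d" for t
  proof -
    define f where "f = t * b mod c"
    have f: "f \<in> polys_below (deg c)" unfolding f_def by (rule mod_below[OF c])
    show ?thesis
      unfolding f_def[symmetric]
    proof (cases "f div M = 0")
      case False
      have "f mod M = 0 \<or> deg (f mod M) < k" using mod_below[OF M(1), of f] M(2) by (simp add: polys_below_degree)
      moreover have dm: "deg (f div M * M) = deg (f div M) + k"
        using False M by (simp add: degree_mult_eq)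
      moreover have "deg (g + h) = deg g"
        if "h = 0 \<or> deg h < deg g" for g h :: "'a poly"
        using that degree_add_eq_left[of h g] by auto
      ultimately have "deg (f div M * M + f mod M) = deg (f div M) + k"
        by (metis trans_less_add2)
      then have "deg f = deg (f div M) + k" by simp
      moreover have "f \<noteq> 0" using False by auto
      ultimately have "deg (f div M) < d"
        using f unfolding k_def polys_below_degree by auto
      then show "f div M \<in> polys_below d" by (simp add: polys_below_degree)
    qed (simp add: polys_below_degree)
  qed
  then have "\<exists>t\<in>polys_below (d + 1). \<exists>t'\<in>polys_below (d + 1). t \<noteq> t' \<and> (t * b mod c) div M = (t' * b mod c) div M"
    using card_gt_1[where 'a = 'a] by (intro collision[where B = "polys_below d"]) (auto simp: card_polys_below')
  then obtain t t' where t: "t \<in> polys_below (d + 1)" "t' \<in> polys_below (d + 1)" "t \<noteq> t'"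
    "(t * b mod c) div M = (t' * b mod c) div M" by blast
  have "(t - t') * b mod c = (t * b mod c) - (t' * b mod c)"
    by (simp add: left_diff_distrib poly_mod_diff_left)
  also have "\<dots> = (t * b mod c) mod M - (t' * b mod c) mod M"
    using div_mult_mod_eq[of "t * b mod c" M] div_mult_mod_eq[of "t' * b mod c" M]
    unfolding t(4) by (metis add_diff_cancel_left)
  also have "\<dots> \<in> polys_below k" using mod_below[OF M(1)] M(2) by (intro polys_below_diff) auto
  finally have "(t - t') * b mod c \<in> polys_below k" .
  moreover have "t - t' \<in> polys_below (d + 1) - {0}" using t polys_below_diff by auto
  ultimately show ?thesis unfolding k_def by blast
qed

text \<open>
  A substitute for the Euclidean algorithm: after multiplication by one of finitely many polynomials \<open>t\<close>, the
  element \<open>\<alpha>\<close> is congruent modulo \<open>R\<close> to an element whose norm has negative degree. Only the coefficient of \<open>s\<close>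
  needs to be approximated closely, to make up for the degree \<open>d\<close> of \<open>D\<close>.
\<close>
lemma approximate_division:
  assumes "\<alpha> \<in> K"
  shows "\<exists>t\<in>polys_below (d + 1) - {0}. \<exists>\<omega>\<in>R. \<exists>r1 r2 c. c \<noteq> 0 \<and> emb t * \<alpha> - \<omega> = el r1 r2 / emb c \<and>
    (r1\<^sup>2 - D * r2\<^sup>2 \<noteq> 0 \<longrightarrow> deg (r1\<^sup>2 - D * r2\<^sup>2) < 2 * deg c)"
proof -
  obtain a b c where c: "c \<noteq> 0" "\<alpha> = el a b / emb c" using assms by (rule K_cases)
  obtain t where t: "t \<in> polys_below (d + 1) - {0}" "t * b mod c \<in> polys_below (deg c - d)"
    using dirichlet_approximation[OF c(1)] by blast
  define r1 r2 where "r1 = t * a mod c" and "r2 = t * b mod c"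
  have r1: "r1 = 0 \<or> deg r1 < deg c" unfolding r1_def by (rule degree_mod_less[OF c(1)])
  have r2: "r2 = 0 \<or> deg r2 < deg c - d" using t(2) unfolding r2_def polys_below_degree .
  define q1 q2 where "q1 = t * a div c" and "q2 = t * b div c"
  have "t * a = c * q1 + r1" "t * b = c * q2 + r2" unfolding r1_def r2_def q1_def q2_def by simp_all
  then have "emb t * el a b = emb c * el q1 q2 + el r1 r2" by (simp only: emb_el el_add)
  then have "emb t * \<alpha> - el q1 q2 = el r1 r2 / emb c" unfolding c(2) using c(1) by (simp add: field_simps)
  moreover have "deg (r1\<^sup>2 - D * r2\<^sup>2) < 2 * deg c" if nz: "r1\<^sup>2 - D * r2\<^sup>2 \<noteq> 0"
  proof (cases "r2 = 0")
    case True
    then show ?thesis using nz r1 by (simp add: degree_power_eq)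
  next
    case False
    have "deg (r1\<^sup>2 - D * r2\<^sup>2) = max (2 * deg r1) (d + 2 * deg r2)"
      using norm_form_degree(2)[OF nonsquare_lead False, of r1] degree_D by simp
    moreover have "2 * deg r1 < 2 * deg c" using r1 r2 False by (cases "r1 = 0") auto
    moreover have "d + 2 * deg r2 < 2 * deg c" using r2 False by auto
    ultimately show ?thesis by simp
  qed
  ultimately show ?thesis using t(1) c(1) by (intro bexI[of _ t] bexI[of _ "el q1 q2"] exI[of _ r1] exI[of _ r2] exI[of _ c]) auto
qed

definition common_multiple :: "'a poly" where "common_multiple = \<Prod>(polys_below (d + 1) - {0})"

lemma common_multiple_nonzero: "common_multiple \<noteq> 0"
  unfolding common_multiple_def by (subst prod_zero_iff) auto

text \<open>
  Take \<open>\<beta>\<close> of least norm degree in an integral multiple of \<open>I\<close>. Division by \<open>\<beta>\<close> as above leaves remainders of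
  smaller norm degree, hence zero, so the common multiple of the multipliers carries the ideal into \<open>\<beta> R\<close>.
\<close>
lemma reduced_ideal:
  assumes I: "I \<in> FI"
  shows "\<exists>x\<in>K. x \<noteq> 0 \<and> scale x I \<subseteq> R \<and> emb common_multiple \<in> scale x I"
proof -
  obtain g where g: "g \<noteq> 0" "\<And>x. x \<in> I \<Longrightarrow> emb g * x \<in> R" using FI_D(6)[OF I] by blast
  define J where "J = scale (emb g) I"
  have J: "J \<in> FI" unfolding J_def using g(1) by (intro FI_scale I) auto
  have JR: "x \<in> R" if "x \<in> J" for x using that g(2) unfolding J_def scale_def by (auto simp: mult.commute)
  define P where "P ab \<longleftrightarrow> el (fst ab) (snd ab) \<in> J \<and> el (fst ab) (snd ab) \<noteq> 0" for ab
  define ndeg where "ndeg ab = deg ((fst ab)\<^sup>2 - D * (snd ab)\<^sup>2)" for ab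
  obtain y where "y \<in> J" "y \<noteq> 0" using FI_D(3)[OF J] by blast
  moreover obtain a b where "y = el a b" using JR[OF \<open>y \<in> J\<close>] unfolding R_def by blast
  ultimately have "P (a, b)" unfolding P_def by simp
  then obtain ab where ab: "P ab" "\<And>ab'. P ab' \<Longrightarrow> ndeg ab \<le> ndeg ab'"
    using ex_has_least_nat[of P "(a, b)" ndeg] by blast
  define b0 b1 where "b0 = fst ab" and "b1 = snd ab"
  define \<beta> where "\<beta> = el b0 b1"
  have \<beta>: "\<beta> \<in> J" "\<beta> \<noteq> 0" using ab(1) unfolding P_def \<beta>_def b0_def b1_def by auto
  have min: "deg (b0\<^sup>2 - D * b1\<^sup>2) \<le> deg (x\<^sup>2 - D * y\<^sup>2)"
    if "el x y \<in> J" "el x y \<noteq> 0" for x y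
    using ab(2)[of "(x, y)"] that unfolding P_def ndeg_def b0_def b1_def by simp
  have div: "\<exists>\<omega>\<in>R. emb common_multiple * \<alpha> = \<omega> * \<beta>" if \<alpha>: "\<alpha> \<in> J" for \<alpha>
  proof -
    have "\<alpha> / \<beta> \<in> K" using JR[OF \<alpha>] JR[OF \<beta>(1)] by simp
    then obtain t \<omega> r1 r2 c where t: "t \<in> polys_below (d + 1) - {0}" "\<omega> \<in> R" "c \<noteq> 0"
      "emb t * (\<alpha> / \<beta>) - \<omega> = el r1 r2 / emb c"
      "r1\<^sup>2 - D * r2\<^sup>2 \<noteq> 0 \<Longrightarrow> deg (r1\<^sup>2 - D * r2\<^sup>2) < 2 * deg c"
      using approximate_division by blast
    define \<delta> where "\<delta> = emb t * \<alpha> - \<omega> * \<beta>"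
    have "\<delta> = emb t * \<alpha> + (- \<omega>) * \<beta>" unfolding \<delta>_def by simp
    then have \<delta>J: "\<delta> \<in> J"
      using FI_D(4)[OF J FI_D(5)[OF J emb_in_R \<alpha>] FI_D(5)[OF J R_minus[OF t(2)] \<beta>(1)]] by (simp only:)
    have "\<delta> = \<beta> * (emb t * (\<alpha> / \<beta>) - \<omega>)" unfolding \<delta>_def using \<beta>(2) by (simp add: right_diff_distrib mult.commute)
    then have "\<delta> = \<beta> * (el r1 r2 / emb c)" unfolding t(4) .
    then have \<delta>c: "emb c * \<delta> = el b0 b1 * el r1 r2" unfolding \<beta>_def using t(3) by simp
    obtain x y where xy: "\<delta> = el x y" using JR[OF \<delta>J] unfolding R_def by blast
    have "\<delta> = 0"
    proof (rule ccontr)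
      assume nz: "\<delta> \<noteq> 0"
      have "(emb c * \<delta>) * conj (emb c * \<delta>) = (el b0 b1 * el r1 r2) * conj (el b0 b1 * el r1 r2)" unfolding \<delta>c ..
      then have "(emb c * emb c) * (el x y * el x (- y)) = (el b0 b1 * el b0 (- b1)) * (el r1 r2 * el r1 (- r2))"
        unfolding xy by (simp add: conj_mult mult_ac del: el_0_right)
      then have "emb (c\<^sup>2 * (x\<^sup>2 - D * y\<^sup>2)) = emb ((b0\<^sup>2 - D * b1\<^sup>2) * (r1\<^sup>2 - D * r2\<^sup>2))"
        unfolding el_conj by (simp add: emb_mult power2_eq_square)
      then have eq: "c\<^sup>2 * (x\<^sup>2 - D * y\<^sup>2) = (b0\<^sup>2 - D * b1\<^sup>2) * (r1\<^sup>2 - D * r2\<^sup>2)" by (simp only: emb_eq_iff)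
      have x0: "x\<^sup>2 - D * y\<^sup>2 \<noteq> 0" using nz norm_zero unfolding xy by auto
      then have "c\<^sup>2 * (x\<^sup>2 - D * y\<^sup>2) \<noteq> 0" using t(3) by simp
      then have nz': "b0\<^sup>2 - D * b1\<^sup>2 \<noteq> 0" "r1\<^sup>2 - D * r2\<^sup>2 \<noteq> 0" unfolding eq by auto
      have "2 * deg c + deg (x\<^sup>2 - D * y\<^sup>2)
        = deg (b0\<^sup>2 - D * b1\<^sup>2) + deg (r1\<^sup>2 - D * r2\<^sup>2)"
        using arg_cong[OF eq, of deg] x0 nz' t(3) by (simp add: degree_mult_eq degree_power_eq)
      then show False using t(5)[OF nz'(2)] min[of x y] \<delta>J nz unfolding xy by simp
    qed
    then have ta: "emb t * \<alpha> = \<omega> * \<beta>" unfolding \<delta>_def by simp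
    have "t dvd common_multiple" unfolding common_multiple_def using t(1) by (intro dvd_prodI) auto
    then obtain t'' where "common_multiple = t * t''" by (auto elim: dvdE)
    then have "emb common_multiple * \<alpha> = (emb t'' * \<omega>) * \<beta>" using ta by (simp add: emb_mult mult_ac)
    then show ?thesis using t(2) by (intro bexI[of _ "emb t'' * \<omega>"]) auto
  qed
  define x where "x = emb common_multiple / \<beta>"
  have x: "x \<in> K" "x \<noteq> 0" unfolding x_def using JR[OF \<beta>(1)] \<beta>(2) common_multiple_nonzero by auto
  have "scale x J \<subseteq> R"
  proof
    fix z assume "z \<in> scale x J"
    then obtain \<alpha> where \<alpha>: "\<alpha> \<in> J" "z = \<alpha> * x" unfolding scale_def by blast
    then obtain \<omega> where "\<omega> \<in> R" "emb common_multiple * \<alpha> = \<omega> * \<beta>" using div by blast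
    then show "z \<in> R" unfolding \<alpha>(2) x_def using \<beta>(2) by (simp add: mult.commute)
  qed
  moreover have "emb common_multiple \<in> scale x J" unfolding mem_scale[OF x(2)] unfolding x_def using \<beta> common_multiple_nonzero by simp
  ultimately show ?thesis
    using x g(1) unfolding J_def scale_scale by (intro bexI[of _ "x * emb g"]) auto
qed

text \<open>
  Such an ideal is determined by its elements reduced modulo the polynomial that it contains.
\<close>
lemma finite_reduced: "finite {J \<in> FI. J \<subseteq> R \<and> emb common_multiple \<in> J}"
proof -
  define S where "S = (\<lambda>(a, b). el a b) ` (polys_below (deg common_multiple) \<times> polys_below (deg common_multiple))"
  have fin: "finite (Pow S)" unfolding S_def by simp
  have inj: "inj_on (\<lambda>J. J \<inter> S) {J \<in> FI. J \<subseteq> R \<and> emb common_multiple \<in> J}"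
  proof -
    have sub: "J \<subseteq> J'" if J: "J \<in> FI" "J \<subseteq> R" "emb common_multiple \<in> J" and J': "J' \<in> FI" "emb common_multiple \<in> J'" "J \<inter> S = J' \<inter> S" for J J'
    proof
      fix z assume z: "z \<in> J"
      then obtain a b where ab: "z = el a b" using J(2) unfolding R_def by blast
      define q where "q = el (a div common_multiple) (b div common_multiple)"
      define r where "r = el (a mod common_multiple) (b mod common_multiple)"
      have zqr: "z = q * emb common_multiple + r" unfolding ab q_def r_def mult.commute[of _ "emb common_multiple"] by (simp add: emb_el el_add)
      have qR: "q \<in> R" unfolding q_def by simp
      have "r = z + (- q) * emb common_multiple" unfolding zqr by simp
      then have "r \<in> J" using FI_D(4)[OF J(1) z FI_D(5)[OF J(1) R_minus[OF qR] J(3)]] by (simp only:)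
      moreover have "r \<in> S" unfolding S_def r_def
        using degree_mod_less[OF common_multiple_nonzero] by (auto simp: polys_below_degree intro!: image_eqI[of _ _ "(a mod common_multiple, b mod common_multiple)"])
      ultimately have "r \<in> J'" using J'(3) by blast
      then show "z \<in> J'" unfolding zqr using FI_D(4,5)[OF J'(1)] J'(2) qR by simp
    qed
    show ?thesis
    proof (rule inj_onI)
      fix J J' assume "J \<in> {J \<in> FI. J \<subseteq> R \<and> emb common_multiple \<in> J}" "J' \<in> {J \<in> FI. J \<subseteq> R \<and> emb common_multiple \<in> J}" "J \<inter> S = J' \<inter> S"
      then show "J = J'" using sub[of J J'] sub[of J' J] by blast
    qed
  qed
  have "(\<lambda>J. J \<inter> S) ` {J \<in> FI. J \<subseteq> R \<and> emb common_multiple \<in> J} \<subseteq> Pow S" by blast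
  from finite_imageD[OF finite_subset[OF this fin] inj] show ?thesis .
qed

end

section \<open>Orders of quotients of commutative groups\<close>

text \<open>
  Divisibility of the order of a quotient by \<open>2\<close> and \<open>4\<close>, expressed through elements of the big group.
\<close>
locale comm_quotient = comm_group G for G (structure) +
  fixes H
  assumes H: "subgroup H G" and fin: "finite (carrier (G Mod H))"
begin

abbreviation "Q \<equiv> G Mod H"

lemma H_normal: "H \<lhd> G"
  using subgroup_imp_normal[OF H] .

lemma Q_group: "group Q"
  using normal.factorgroup_is_group[OF H_normal] .

lemma Q_carrier: "A \<in> carrier Q \<longleftrightarrow> (\<exists>x\<in>carrier G. A = H #> x)"
  unfolding FactGroup_def RCOSETS_def by auto

lemma coset_mult: "x \<in> carrier G \<Longrightarrow> y \<in> carrier G \<Longrightarrow> (H #> x) <#> (H #> y) = H #> (x \<otimes> y)"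
  by (rule normal.rcos_sum[OF H_normal])

lemma Q_one: "\<one>\<^bsub>Q\<^esub> = H" by (simp add: FactGroup_def)

lemma coset_eq_H: "x \<in> carrier G \<Longrightarrow> H #> x = H \<longleftrightarrow> x \<in> H"
  using coset_join1[OF _ _ H] coset_join2[OF _ H] H subgroup.subset by metis

lemma coset_carrier: "x \<in> carrier G \<Longrightarrow> H #> x \<in> carrier Q"
  using Q_carrier by blast

lemma pow_4: "group L \<Longrightarrow> A \<in> carrier L \<Longrightarrow> A [^]\<^bsub>L\<^esub> (4::nat) = (A \<otimes>\<^bsub>L\<^esub> A) \<otimes>\<^bsub>L\<^esub> (A \<otimes>\<^bsub>L\<^esub> A)"
proof -
  assume L: "group L" and A: "A \<in> carrier L"
  interpret L: group L by (rule L)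
  show ?thesis using A by (simp add: numeral_eq_Suc L.m_assoc)
qed

lemma pow_2: "group L \<Longrightarrow> A \<in> carrier L \<Longrightarrow> A [^]\<^bsub>L\<^esub> (2::nat) = A \<otimes>\<^bsub>L\<^esub> A"
proof -
  assume L: "group L" and A: "A \<in> carrier L"
  interpret L: group L by (rule L)
  show ?thesis using A by (simp add: numeral_eq_Suc)
qed

lemma even_orderI:
  assumes "x \<in> carrier G" "x \<notin> H" "x \<otimes> x \<in> H"
  shows "even (Coset.order Q)"
proof -
  interpret Q: group Q by (rule Q_group)
  define A where "A = H #> x"
  have A: "A \<in> carrier Q" unfolding A_def by (rule coset_carrier[OF assms(1)])
  have "A [^]\<^bsub>Q\<^esub> (2::nat) = \<one>\<^bsub>Q\<^esub>"
    unfolding pow_2[OF Q_group A] unfolding A_def Q_one using assms by (simp add: coset_mult coset_eq_H)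
  then have "Q.ord A dvd 2" using Q.pow_eq_id[OF A] by simp
  moreover have "Q.ord A \<noteq> 1"
    using Q.ord_eq_1[OF A] coset_eq_H[OF assms(1)] assms(2) unfolding A_def Q_one by simp
  ultimately have "Q.ord A = 2" using prime_nat_iff[of 2] two_is_prime_nat by metis
  then show ?thesis using Q.ord_dvd_group_order[OF A] by simp
qed

lemma four_dvd_orderI:
  assumes x: "x \<in> carrier G" and "x \<otimes> x \<notin> H" "(x \<otimes> x) \<otimes> (x \<otimes> x) \<in> H"
  shows "4 dvd Coset.order Q"
proof -
  interpret Q: group Q by (rule Q_group)
  define A where "A = H #> x"
  have A: "A \<in> carrier Q" unfolding A_def by (rule coset_carrier[OF x])
  have "A [^]\<^bsub>Q\<^esub> (4::nat) = \<one>\<^bsub>Q\<^esub>"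
    unfolding pow_4[OF Q_group A] unfolding A_def Q_one using assms by (simp add: coset_mult coset_eq_H)
  then have "Q.ord A dvd 2 ^ 2" using Q.pow_eq_id[OF A] by simp
  moreover have "\<not> Q.ord A dvd 2 ^ 1"
  proof -
    have "A [^]\<^bsub>Q\<^esub> (2::nat) \<noteq> \<one>\<^bsub>Q\<^esub>"
      unfolding pow_2[OF Q_group A] unfolding A_def Q_one using assms by (simp add: coset_mult coset_eq_H)
    then show ?thesis using Q.pow_eq_id[OF A] by simp
  qed
  moreover obtain i where i: "i \<le> 2" "Q.ord A = 2 ^ i"
    using calculation(1) divides_primepow_nat[OF two_is_prime_nat] by blast
  ultimately have "\<not> i \<le> 1" using le_imp_power_dvd[of i 1 "2::nat"] by auto
  then have "Q.ord A = 4" using i by (simp add: le_Suc_eq numeral_2_eq_2)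
  then show ?thesis using Q.ord_dvd_group_order[OF A] by simp
qed

lemma subgroup_pow_card:
  assumes S: "subgroup S Q" and A: "A \<in> S"
  shows "A [^]\<^bsub>Q\<^esub> card S = \<one>\<^bsub>Q\<^esub>"
proof -
  interpret Q: group Q by (rule Q_group)
  interpret L: group "Q\<lparr>carrier := S\<rparr>" using Q.subgroup_imp_group[OF S] .
  have "finite S" using fin subgroup.subset[OF S] finite_subset by blast
  then have "A [^]\<^bsub>Q\<lparr>carrier := S\<rparr>\<^esub> card S = \<one>\<^bsub>Q\<^esub>"
    using L.pow_order_eq_1[of A] A by (simp add: Coset.order_def)
  then show ?thesis using Q.nat_pow_consistent[of A "card S" S] by simp
qed

lemma odd_orderI:
  assumes tors: "\<And>x. x \<in> carrier G \<Longrightarrow> x \<otimes> x \<in> H \<Longrightarrow> x \<in> H"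
  shows "odd (Coset.order Q)"
proof
  interpret Q: group Q by (rule Q_group)
  assume "even (Coset.order Q)"
  then obtain m where "Coset.order Q = 2 ^ 1 * m" by (auto elim: evenE)
  then obtain S where S: "subgroup S Q" "card S = 2 ^ 1"
    using sylow_thm[OF two_is_prime_nat Q_group _ fin] by blast
  have "\<exists>A\<in>S. A \<noteq> H"
  proof (rule ccontr)
    assume "\<not> ?thesis"
    then have "S \<subseteq> {H}" by blast
    then have "card S \<le> 1" using card_mono[of "{H}" S] by simp
    then show False using S(2) by simp
  qed
  then obtain A where A: "A \<in> S" "A \<noteq> H" by blast
  then have XQ: "A \<in> carrier Q" using subgroup.subset[OF S(1)] by blast
  then obtain x where x: "x \<in> carrier G" "A = H #> x" using Q_carrier by blast
  have "A \<otimes>\<^bsub>Q\<^esub> A = H" using subgroup_pow_card[OF S(1) A(1)] S(2) pow_2[OF Q_group XQ] Q_one by simp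
  then have "x \<otimes> x \<in> H" unfolding x(2) using x(1) by (simp add: coset_mult coset_eq_H)
  then show False using tors x A(2) coset_eq_H by blast
qed

text \<open>
  In a subgroup of order four every element is an involution, since the square of an element of order four
  would be an even involution. Two different involutions are both odd, so their product is even and thus
  trivial, which makes them equal.
\<close>
lemma not_four_dvd_orderI:
  assumes ev: "\<And>x y. x \<in> carrier G \<Longrightarrow> y \<in> carrier G \<Longrightarrow> ev (x \<otimes> y) \<longleftrightarrow> (ev x \<longleftrightarrow> ev y)"
    and tors: "\<And>x. x \<in> carrier G \<Longrightarrow> ev x \<Longrightarrow> x \<otimes> x \<in> H \<Longrightarrow> x \<in> H"
  shows "\<not> 4 dvd Coset.order Q"
proof
  interpret Q: group Q by (rule Q_group)
  assume "4 dvd Coset.order Q"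
  then obtain m where "Coset.order Q = 2 ^ 2 * m" by (auto elim: dvdE)
  then obtain S where S: "subgroup S Q" "card S = 2 ^ 2"
    using sylow_thm[OF two_is_prime_nat Q_group _ fin] by blast
  have SQ: "A \<in> carrier Q" if "A \<in> S" for A using that subgroup.subset[OF S(1)] by blast
  have sq: "x \<otimes> x \<in> H" if x: "x \<in> carrier G" "H #> x \<in> S" for x
  proof -
    have "(x \<otimes> x) \<otimes> (x \<otimes> x) \<in> H"
      using subgroup_pow_card[OF S(1) x(2)] S(2) pow_4[OF Q_group SQ[OF x(2)]] x(1)
      by (simp add: coset_mult coset_eq_H Q_one)
    then show ?thesis using tors[of "x \<otimes> x"] ev[of x x] x(1) by simp
  qed
  have "\<exists>A\<in>S. \<exists>B\<in>S. A \<noteq> H \<and> B \<noteq> H \<and> A \<noteq> B"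
  proof (rule ccontr)
    assume n: "\<not> ?thesis"
    have "card (S - {H}) \<ge> 3" using S(2) diff_card_le_card_Diff[of "{H}" S] by simp
    moreover have "card (S - {H}) \<le> 1" 
    proof -
      have "\<exists>a. S - {H} \<subseteq> {a}"
      proof (cases "S - {H} = {}")
        case False
        then obtain a where "a \<in> S" "a \<noteq> H" by auto
        then have "S - {H} \<subseteq> {a}" using n by auto
        then show ?thesis ..
      qed blast
      then obtain a where "S - {H} \<subseteq> {a}" by blast
      then show ?thesis using card_mono[of "{a}" "S - {H}"] by simp
    qed
    ultimately show False by simp
  qed
  then obtain A B where AB: "A \<in> S" "B \<in> S" "A \<noteq> H" "B \<noteq> H" "A \<noteq> B" by blast
  obtain x where x: "x \<in> carrier G" "A = H #> x" using Q_carrier SQ AB(1) by blast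
  obtain y where y: "y \<in> carrier G" "B = H #> y" using Q_carrier SQ AB(2) by blast
  have x2: "x \<otimes> x \<in> H" and y2: "y \<otimes> y \<in> H" using sq x y AB(1,2) by auto
  have "\<not> ev x" "\<not> ev y" using tors x2 y2 x y AB(3,4) coset_eq_H by blast+
  then have "ev (x \<otimes> y)" using ev x(1) y(1) by simp
  moreover have "(x \<otimes> y) \<otimes> (x \<otimes> y) = (x \<otimes> x) \<otimes> (y \<otimes> y)" using x(1) y(1) by (simp add: m_ac)
  then have "(x \<otimes> y) \<otimes> (x \<otimes> y) \<in> H" using x2 y2 subgroup.m_closed[OF H] by simp
  ultimately have xy: "x \<otimes> y \<in> H" using tors x(1) y(1) by simp
  have "H #> (x \<otimes> y) = H" "H #> (x \<otimes> x) = H" using coset_eq_H x(1) y(1) x2 xy by simp_all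
  then have "A \<otimes>\<^bsub>Q\<^esub> B = A \<otimes>\<^bsub>Q\<^esub> A" unfolding x(2) y(2) using x(1) y(1) by (simp add: coset_mult)
  then show False using AB SQ Q.l_cancel by metis
qed

end

section \<open>The class group\<close>

context imaginary_quadratic
begin

text \<open>
  The elements \<open>y\<close> with \<open>g y z\<^sup>k \<in> R\<close> for all \<open>k\<close> form a fractional ideal \<open>M\<close> with \<open>z M \<subseteq> M\<close>; multiply by the
  inverse of \<open>M\<close>.
\<close>
lemma completely_integrally_closed:
  assumes z: "z \<in> K" and g: "g \<noteq> 0" "\<And>k. emb g * z ^ k \<in> R"
  shows "z \<in> R"
proof (cases "z = 0")
  case False
  have zk: "z ^ k \<in> K" for k using z by (induction k) auto
  define M where "M = {y \<in> K. \<forall>k. emb g * (y * z ^ k) \<in> R}"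
  have M: "M \<in> FI"
  proof (rule FI_I[where x = 1 and c = g])
    show "emb g * y \<in> R" if "y \<in> M" for y
      using that unfolding M_def by (auto dest: spec[of _ 0])
    show "r * y \<in> M" if ry: "r \<in> R" "y \<in> M" for r y
    proof -
      have "emb g * (r * y * z ^ k) = r * (emb g * (y * z ^ k))" for k by (simp add: mult_ac)
      then have "emb g * (r * y * z ^ k) \<in> R" for k using ry unfolding M_def by (simp only: R_mult) simp
      then show ?thesis using ry unfolding M_def by simp
    qed
  qed (use g in \<open>auto simp: M_def distrib_left distrib_right\<close>)
  obtain M' where M': "M' \<in> FI" "iprod M' M = R" using ideal_inverse[OF M] by blast
  have "scale z M \<subseteq> M"
  proof
    fix x assume "x \<in> scale z M"
    then obtain y where y: "y \<in> M" "x = y * z" unfolding scale_def by blast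
    have eq: "emb g * (x * z ^ k) = emb g * (y * z ^ Suc k)" for k unfolding y(2) by (simp add: mult_ac)
    have "emb g * (x * z ^ k) \<in> R" for k unfolding eq using y(1) unfolding M_def by blast
    moreover have "x \<in> K" using y z unfolding M_def by simp
    ultimately show "x \<in> M" unfolding M_def by blast
  qed
  then have "iprod M' (scale z M) \<subseteq> iprod M' M" by (intro iprod_least) (auto intro: iprod_memI iprod_add)
  then have "scale z R \<subseteq> R" unfolding iprod_scale_right M'(2) .
  moreover have "1 * z \<in> scale z R" unfolding scale_def by (rule imageI[OF R_1])
  ultimately show ?thesis by auto
qed simp

text \<open>
  The powers of an integral element have a common denominator, namely a power of any denominator of the element.
\<close>
lemma integral_closure_eq: "integral_closure (range emb) K = R"
proof
  show "R \<subseteq> integral_closure (range emb) K"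
  proof
    fix z assume "z \<in> R"
    then obtain a b where ab: "z = el a b" unfolding R_def by blast
    define f :: "'k poly" where "f = [: emb (a\<^sup>2 - D * b\<^sup>2), emb (- (a + a)), 1 :]"
    have "1 \<in> range emb" "0 \<in> range emb" using emb_1 emb_0 by (metis rangeI)+
    then have coeffs: "coeff f i \<in> range emb" for i
      unfolding f_def by (auto simp: coeff_pCons split: nat.split)
    have lead: "lead_coeff f = 1" unfolding f_def by simp
    have tr: "emb (- (a + a)) = - (el a b + el a (- b))" by (simp add: el_add emb_minus)
    have "poly f z = el a b * el a (- b) + el a b * (- (el a b + el a (- b)) + el a b)"
      unfolding f_def ab el_conj[symmetric] tr by simp
    also have "x * y + x * (- (x + y) + x) = 0" for x y :: 'k by (simp add: algebra_simps)
    finally have "poly f z = 0" .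
    then show "z \<in> integral_closure (range emb) K"
      unfolding integral_closure_def using coeffs lead ab by auto
  qed
  show "integral_closure (range emb) K \<subseteq> R"
  proof
    fix z assume "z \<in> integral_closure (range emb) K"
    then obtain f where z: "z \<in> K" and f: "\<And>i. coeff f i \<in> range emb" "lead_coeff f = 1" "poly f z = 0"
      unfolding integral_closure_def by blast
    obtain a b c where c: "c \<noteq> 0" "z = el a b / emb c" using z by (rule K_cases)
    define n where "n = deg f"
    have rel: "z ^ n = - (\<Sum>i<n. coeff f i * z ^ i)"
    proof -
      have "poly f z = (\<Sum>i<n. coeff f i * z ^ i) + lead_coeff f * z ^ n"
        unfolding poly_altdef n_def by (simp add: lessThan_Suc_atMost[symmetric])
      then show ?thesis using f(2,3) by (simp add: add_eq_0_iff)
    qed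
    have "emb (c ^ n) * z ^ k \<in> R" for k
    proof (induction k rule: less_induct)
      case (less k)
      show ?case
      proof (cases "k < n")
        case True
        have pw: "el a b ^ j \<in> R" for j by (induction j) auto
        have "c ^ n = c ^ (n - k) * c ^ k" using True by (simp add: power_add[symmetric])
        then have "emb (c ^ n) * z ^ k = emb (c ^ (n - k)) * (emb c * z) ^ k"
          by (simp add: emb_mult emb_power power_mult_distrib mult.assoc)
        also have "emb c * z = el a b" using c by simp
        finally show ?thesis using pw by simp
      next
        case False
        define j where "j = k - n"
        have k: "k = j + n" using False unfolding j_def by simp
        have "emb (c ^ n) * z ^ k = - (\<Sum>i<n. coeff f i * (emb (c ^ n) * z ^ (j + i)))"
          unfolding k power_add[of z j n] rel by (simp add: sum_distrib_left power_add mult_ac)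
        also have "\<dots> \<in> R"
        proof (intro R_minus)
          have sum_R: "(\<Sum>i\<in>A. h i) \<in> R" if "\<And>i. i \<in> A \<Longrightarrow> h i \<in> R" for A :: "nat set" and h
            using that by (induction A rule: infinite_finite_induct) auto
          show "(\<Sum>i<n. coeff f i * (emb (c ^ n) * z ^ (j + i))) \<in> R"
          proof (rule sum_R)
            fix i assume "i \<in> {..<n}"
            then have "j + i < k" unfolding k by simp
            moreover obtain h where "coeff f i = emb h" using f(1) by blast
            ultimately show "coeff f i * (emb (c ^ n) * z ^ (j + i)) \<in> R" using less.IH by simp
          qed
        qed
        finally show ?thesis .
      qed
    qed
    moreover have "c ^ n \<noteq> 0" using c(1) by simp
    ultimately show "z \<in> R" using completely_integrally_closed[OF z] by blast
  qed
qed

abbreviation "G \<equiv> fractional_ideal_group R"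
abbreviation "H \<equiv> principal_fractional_ideals R"

lemma G_simps [simp]: "carrier G = FI" "monoid.mult G = iprod" "one G = R"
  by (simp_all add: fractional_ideal_group_def)

lemma G_comm_group: "comm_group G"
proof (rule comm_groupI)
  show "\<exists>y\<in>carrier G. y \<otimes>\<^bsub>G\<^esub> x = \<one>\<^bsub>G\<^esub>" if "x \<in> carrier G" for x
    using ideal_inverse that by simp
qed (simp_all add: FI_iprod iprod_assoc iprod_R, rule iprod_comm)

lemma H_iff: "I \<in> H \<longleftrightarrow> principal I"
  unfolding principal_fractional_ideals_def principal_def field_of_fractions_R scale_def by auto

lemma principal_FI: "principal I \<Longrightarrow> I \<in> FI"
  unfolding principal_def by (auto intro: FI_scale)

lemma H_subgroup: "subgroup H G"
proof -
  interpret G: comm_group G by (rule G_comm_group)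
  show ?thesis
  proof (rule G.subgroupI)
    show "H \<subseteq> carrier G" using principal_FI H_iff by auto
    have "R \<in> H" unfolding H_iff principal_def by (intro bexI[of _ 1]) auto
    then show "H \<noteq> {}" by blast
    show "inv\<^bsub>G\<^esub> I \<in> H" if I: "I \<in> H" for I
    proof -
      obtain x where x: "x \<in> K" "x \<noteq> 0" "I = scale x R" using I unfolding H_iff principal_def by blast
      have "iprod (scale (1 / x) R) I = R" unfolding x(3) using x(2) by (simp add: iprod_scale iprod_R FI_scale x scale_scale)
      then have "inv\<^bsub>G\<^esub> I = scale (1 / x) R"
        using x by (intro G.inv_equality) (auto intro!: FI_scale)
      then show ?thesis unfolding H_iff principal_def using x by (intro bexI[of _ "1 / x"]) auto
    qed
    show "I \<otimes>\<^bsub>G\<^esub> J \<in> H" if IJ: "I \<in> H" "J \<in> H" for I J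
    proof -
      obtain x where x: "x \<in> K" "x \<noteq> 0" "I = scale x R" using IJ unfolding H_iff principal_def by blast
      have "iprod I J = scale x J" unfolding x(3) using IJ(2) principal_FI H_iff by (simp add: iprod_scale iprod_R)
      then show ?thesis using principal_scale[of x J] x IJ(2) H_iff by simp
    qed
  qed
qed

text \<open>
  Every class contains one of the finitely many reduced ideals.
\<close>
lemma class_group_finite: "finite (carrier (G Mod H))"
proof -
  have "carrier (G Mod H) \<subseteq> (\<lambda>J. H #>\<^bsub>G\<^esub> J) ` {J \<in> FI. J \<subseteq> R \<and> emb common_multiple \<in> J}"
  proof
    interpret G: comm_group G by (rule G_comm_group)
    fix A assume "A \<in> carrier (G Mod H)"
    then obtain I where I: "I \<in> FI" "A = H #>\<^bsub>G\<^esub> I" unfolding FactGroup_def RCOSETS_def by auto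
    obtain x where x: "x \<in> K" "x \<noteq> 0" "scale x I \<subseteq> R" "emb common_multiple \<in> scale x I" using reduced_ideal[OF I(1)] by blast
    have J: "scale x I \<in> FI" using FI_scale[OF I(1)] x by blast
    have "scale x R \<in> H" unfolding H_iff principal_def using x by blast
    moreover have "scale x I = iprod (scale x R) I" by (simp add: iprod_scale iprod_R[OF I(1)])
    ultimately have "scale x I \<in> A" unfolding I(2) r_coset_def by auto
    then have "H #>\<^bsub>G\<^esub> I = H #>\<^bsub>G\<^esub> scale x I"
      using G.repr_independence[of "scale x I" H I] I H_subgroup by simp
    then show "A \<in> (\<lambda>J. H #>\<^bsub>G\<^esub> J) ` {J \<in> FI. J \<subseteq> R \<and> emb common_multiple \<in> J}" using I(2) J x(3,4) by blast
  qed
  then show ?thesis using finite_reduced finite_surj by blast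
qed

lemma class_number_parity:
  "even (Coset.order (G Mod H)) \<longleftrightarrow> even d" "4 dvd Coset.order (G Mod H) \<longleftrightarrow> 4 dvd d"
proof -
  interpret comm_quotient G H
    using G_comm_group H_subgroup class_group_finite
    by (simp add: comm_quotient_def comm_quotient_axioms_def)
  have odd_case: "odd (Coset.order (G Mod H))" if "odd d"
    using odd_degree_no_two_torsion[OF that] by (intro odd_orderI) (simp add: H_iff)
  have even_case: "even (Coset.order (G Mod H)) \<and> (4 dvd Coset.order (G Mod H) \<longleftrightarrow> 4 dvd d)" if ev: "even d"
  proof -
    have "deg (map_poly to_ac p) = d" by (intro map_poly_degree_eq) (use monic in simp)
    then obtain \<theta> where "ac_eval p \<theta> = 0"
      unfolding ac_eval_def using alg_closed_imp_poly_has_root[of "map_poly to_ac p"] d_pos by auto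
    then interpret rt: irreducible_root p \<theta>
      using irr by unfold_locales
    obtain U V where UV: "U\<^sup>2 - smult e (V\<^sup>2) = D" "deg U \<le> d div 2"
      "deg V = d div 2" "V \<noteq> 0"
      using rt.genus_representation[OF odd_card nonsquare ev monic] by blast
    note ctx = ev UV(1,4)
    have I: "amb_ideal U V \<in> FI" by (rule amb_ideal_FI[OF ctx])
    have ev_ord: "even (Coset.order (G Mod H))"
      using I amb_ideal_not_principal[OF ctx] amb_ideal_square_principal[OF ctx]
      by (intro even_orderI[of "amb_ideal U V"]) (simp_all add: H_iff)
    moreover have "4 dvd Coset.order (G Mod H)" if four: "4 dvd d"
    proof -
      obtain c z y m w where "c \<noteq> 0" "m \<noteq> 0 \<or> w \<noteq> 0"
        "z\<^sup>2 - D * y\<^sup>2 = smult c V * (m\<^sup>2 - D * w\<^sup>2)"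
        using rt.conic_point[OF odd_card nonsquare ev monic four UV] by blast
      then obtain C x where C: "C \<in> FI" "x \<in> K" "x \<noteq> 0" "iprod C C = scale x (amb_ideal U V)"
        using class_of_order_four[OF ctx] by blast
      have "\<not> principal (iprod C C)"
      proof
        assume "principal (iprod C C)"
        then have "principal (scale (1 / x) (scale x (amb_ideal U V)))"
          using principal_scale[of "1 / x" "scale x (amb_ideal U V)"] C(2,3) unfolding C(4) by simp
        then show False using amb_ideal_not_principal[OF ctx] C(3) by (simp add: scale_scale)
      qed
      moreover have "principal (iprod (iprod C C) (iprod C C))"
      proof -
        have "iprod (iprod C C) (iprod C C) = scale (x * x) (iprod (amb_ideal U V) (amb_ideal U V))" unfolding C(4) by (simp add: iprod_scale iprod_scale_right scale_scale)
        then show ?thesis using principal_scale[of "x * x"] C amb_ideal_square_principal[OF ctx] by simp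
      qed
      ultimately show ?thesis using C(1) by (intro four_dvd_orderI[of C]) (simp_all add: H_iff)
    qed
    moreover have "\<not> 4 dvd Coset.order (G Mod H)" if four: "\<not> 4 dvd d"
    proof (rule not_four_dvd_orderI[where ev = even_ideal])
      have "odd (deg V)" unfolding UV(3) using four ev by (auto elim!: evenE)
      then show "I \<in> H" if "I \<in> carrier G" "even_ideal I" "I \<otimes>\<^bsub>G\<^esub> I \<in> H" for I
        using even_two_torsion_trivial[OF ctx] that by (simp add: H_iff)
    qed (simp add: even_ideal_iprod)
    ultimately show ?thesis by blast
  qed
  show "even (Coset.order (G Mod H)) \<longleftrightarrow> even d" "4 dvd Coset.order (G Mod H) \<longleftrightarrow> 4 dvd d"
    using odd_case even_case by (meson dvd_trans even_numeral)+
qed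

end

section \<open>The ring of the theorem\<close>

lemma type_ring_inv:
  fixes x :: "'k::field"
  assumes "x \<noteq> 0"
  shows "inv\<^bsub>ring_of_type_algebra\<^esub> x = inverse x"
proof -
  interpret cring "ring_of_type_algebra :: 'k ring" by (rule cring_from_type_algebra)
  show ?thesis by (rule comm_inv_char) (use assms in \<open>auto simp: ring_of_type_algebra_def\<close>)
qed

lemma type_ring_a_inv:
  fixes x :: "'k::field"
  shows "\<ominus>\<^bsub>ring_of_type_algebra\<^esub> x = - x"
proof -
  interpret cring "ring_of_type_algebra :: 'k ring" by (rule cring_from_type_algebra)
  show ?thesis by (rule minus_equality) (auto simp: ring_of_type_algebra_def)
qed

lemma poly_to_ac_imaginary_quadratic:
  fixes e :: "'a::finite_field"
  assumes "odd CARD('a)" "\<nexists>x. x ^ 2 = e" "lead_coeff p = 1" "irreducible p"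
    "s ^ 2 = poly_to_ac (smult e p)"
  shows "imaginary_quadratic poly_to_ac e p s"
  using assms by unfold_locales (auto simp: poly_to_ac_def)

lemma quadratic_ring_eq:
  fixes e :: "'a::finite_field"
  assumes "imaginary_quadratic poly_to_ac e p s"
  shows "quadratic_ring s = imaginary_quadratic.R poly_to_ac s"
proof -
  interpret imaginary_quadratic poly_to_ac e p s by (rule assms)
  let ?T = "ring_of_type_algebra :: 'a poly fract alg_closure ring"
  have frac: "\<exists>a c. c \<noteq> 0 \<and> to_ac q = poly_to_ac a / poly_to_ac c" for q :: "'a poly fract"
  proof (cases q)
    case (Fract a c)
    then show ?thesis
      by (intro exI[of _ a] exI[of _ c]) (simp add: poly_to_ac_def Fract_conv_to_fract)
  qed
  have "generate_field ?T (insert s (range to_ac)) = K"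
  proof
    show "generate_field ?T (insert s (range to_ac)) \<subseteq> K"
    proof
      fix x assume "x \<in> generate_field ?T (insert s (range to_ac))"
      then show "x \<in> K"
      proof induction
        case (incl h)
        then show ?case
        proof
          assume "h \<in> range to_ac"
          then have "h \<in> F" using frac unfolding F_def by blast
          then show ?thesis by simp
        qed simp
      next
        case (m_inv h)
        then have "h \<noteq> 0" by (simp add: ring_of_type_algebra_def)
        then show ?case using m_inv by (metis K_inverse type_ring_inv)
      qed (auto simp: type_ring_a_inv, auto simp: ring_of_type_algebra_def)
    qed
    show "K \<subseteq> generate_field ?T (insert s (range to_ac))"
    proof
      fix z assume "z \<in> K"
      then obtain a b c where c: "c \<noteq> 0" "z = el a b / poly_to_ac c" by (rule K_cases)
      define x y where "x = to_ac (to_fract a / to_fract c)" and "y = to_ac (to_fract b / to_fract c)"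
      have "x \<in> generate_field ?T (insert s (range to_ac))" "y \<in> generate_field ?T (insert s (range to_ac))"
        "s \<in> generate_field ?T (insert s (range to_ac))"
        unfolding x_def y_def by (intro generate_field.incl insertI2 rangeI insertI1)+
      then have "x \<oplus>\<^bsub>?T\<^esub> (y \<otimes>\<^bsub>?T\<^esub> s) \<in> generate_field ?T (insert s (range to_ac))"
        by (intro generate_field.eng_add generate_field.eng_mult)
      moreover have "x \<oplus>\<^bsub>?T\<^esub> (y \<otimes>\<^bsub>?T\<^esub> s) = z"
        unfolding c(2) x_def y_def el_def poly_to_ac_def ring_of_type_algebra_def by (simp add: add_divide_distrib)
      ultimately show "z \<in> generate_field ?T (insert s (range to_ac))" by simp
    qed
  qed
  then show ?thesis unfolding quadratic_ring_def using integral_closure_eq by simp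
qed

theorem theorem1:
  fixes e :: "'a::finite_field"
    and \<pp> :: "'a poly"
    and s :: "'a poly fract alg_closure"
  assumes "odd CARD('a)"
    and "\<nexists>x. x ^ 2 = e"
    and "Polynomial.lead_coeff \<pp> = 1"
    and "Factorial_Ring.irreducible \<pp>"
    and "s ^ 2 = poly_to_ac (Polynomial.smult e \<pp>)"
  shows "finite (carrier (ideal_class_group (quadratic_ring s))) \<and>
    (even (class_number (quadratic_ring s)) \<longleftrightarrow> even (Polynomial.degree \<pp>)) \<and>
    (4 dvd class_number (quadratic_ring s) \<longleftrightarrow> 4 dvd Polynomial.degree \<pp>)"
proof -
  have iq: "imaginary_quadratic poly_to_ac e \<pp> s"
    using assms by (rule poly_to_ac_imaginary_quadratic)
  interpret imaginary_quadratic poly_to_ac e \<pp> s by (rule iq)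
  show ?thesis
    unfolding class_number_def ideal_class_group_def quadratic_ring_eq[OF iq]
    using class_group_finite class_number_parity by blast
qed

end
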